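(* Let $X_{\Sigma_A}$ be a smooth projective toric weak Fano variety. With the notation of the context, there is a Zariski open subset $U$ of $\overline{S_2^0}\subset\mathbb C^r$ containing the origin of $\mathbb C^r$ such that the module $${}_0\mathcal{QM}_{\widetilde A}:=\mathcal O_{\mathbb C_z\times U}\otimes_{\mathcal O_{\mathbb C_z\times\mathbb C^r}}\widetilde{\mathcal R}/\widetilde{\mathcal I}$$ is $\mathcal O_{\mathbb C_z\times U}$-coherent. If $X_{\Sigma_A}$ is Fano, then one can choose $U=\mathbb C^r$ (which equals $\overline{S_2^0}$ in this case). Moreover, there is a connection operator $$\nabla:{}_0\mathcal{QM}_{\widetilde A}\longrightarrow{}_0\mathcal{QM}_{\widetilde A}\otimes z^{-1}\Omega^1_{\mathbb C_z\times U}\big(\log((\{0\}\times U)\cup(\mathbb C_z\times Z))\big),\qquad Z=\bigcup_{a=1}^r\{q_a=0\},$$ extending the $\mathcal D_{\mathbb C_\tau^*\times(U\cap S_2)}$-module structure on the restriction of ${}_0\mathcal{QM}_{\widetilde A}$ to $\mathbb C_\tau^*\times(U\cap S_2)$.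
   Context: $\Sigma_A$ is a fan in $N\otimes\mathbb R$, $N\cong\mathbb Z^n$, defining $X_{\Sigma_A}$ (weak Fano: anticanonical divisor nef; Fano: ample), with primitive ray generators $\underline a_1,\dots,\underline a_m$. $\mathbb L=\{\underline l\in\mathbb Z^m:\sum l_i\underline a_i=0\}$, of rank $r=m-n$; $\mathbb L^\vee\cong\mathrm{Pic}(X_{\Sigma_A})$; $\rho=\sum_i[D_i]\in\mathbb L^\vee$ is the anticanonical class. Fix a basis $p_1,\dots,p_r$ of $\mathbb L^\vee$ of nef classes such that $\rho$ lies in the cone they generate; $p_a^\vee$ is the dual basis of $\mathbb L$, $m_{ia}$ the $i$-th coordinate of $p_a^\vee\in\mathbb Z^m$. $S_2=\mathrm{Spec}\,\mathbb C[\mathbb L]\cong(\mathbb C^* )^r\subset\mathbb C^r$ with coordinates $q_1,\dots,q_r$ given by this basis. Choose integers $g_{ia}\ge0$ such that $(g_{ia})_i\in\mathbb Z^m$ maps to $p_a$ under $\mathbb Z^m\to\mathbb L^\vee$, and put $\widetilde W(\underline y,\underline q)=\sum_{i=1}^m\underline y^{\underline a_i}\prod_aq_a^{g_{ia}}$. $S_2^0\subset S_2$ is the Zariski open set of $\underline q$ such that $\widetilde W(-,\underline q)$ is non-degenerate, i.e. for every proper face $\sigma$ of $\mathrm{Conv}(\underline0,\underline a_1,\dots,\underline a_m)$ not containing $\underline0$ the sum of the terms with $\underline a_i\in\sigma$ has no critical points in $(\mathbb C^* )^n$. $\Delta_{S_2}=S_2\setminus S_2^0$, $\overline{\Delta_{S_2}}$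 is its closure in $\mathbb C^r$ and $\overline{S_2^0}:=\mathbb C^r\setminus\overline{\Delta_{S_2}}$ (this contains the origin). $\widetilde{\mathcal R}$ is the sheaf of $\mathcal O_{\mathbb C_z\times\mathbb C^r}$-algebras associated to $\widetilde R=\mathbb C[q_1,\dots,q_r,z]\langle zq_1\partial_{q_1},\dots,zq_r\partial_{q_r},z^2\partial_z\rangle$ (with the usual commutation relations of differential operators). $\widetilde{\mathcal I}$ is the left ideal generated by $$\widetilde\Box_{\underline l}=\prod_{a:p_a(\underline l)>0}q_a^{p_a(\underline l)}\prod_{i:l_i<0}\prod_{\nu=0}^{-l_i-1}\Big(\sum_{a}m_{ia}zq_a\partial_{q_a}-\nu z\Big)-\prod_{a:p_a(\underline l)<0}q_a^{-p_a(\underline l)}\prod_{i:l_i>0}\prod_{\nu=0}^{l_i-1}\Big(\sum_{a}m_{ia}zq_a\partial_{q_a}-\nu z\Big)$$ for all $\underline l\in\mathbb L$ and by $z^2\partial_z+\sum_{a=1}^r\rho(p_a^\vee)zq_a\partial_{q_a}$. $\mathbb C^*_\tau=\{z\neq0\}$, $\tau=z^{-1}$; on $\mathbb C_\tau^*\times S_2$ one has $\widetilde{\mathcal R}=\mathcal D_{\mathbb C_\tau^*\times S_2}$. *)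

theory Defs
  imports
    "HOL-Analysis.Analysis"
    "HOL-Library.Poly_Mapping"
    "HOL-Algebra.Module"
begin

section \<open>Fans and divisors on toric varieties\<close>

definition lat :: "int ^ 'n \<Rightarrow> real ^ 'n" where
  "lat v = (\<chi> k. of_int (v $ k))"

definition rational_cone :: "(real ^ 'n) set \<Rightarrow> bool" where
  "rational_cone \<sigma> \<longleftrightarrow> (\<exists>B :: (int ^ 'n) set. finite B \<and> \<sigma> = convex_cone hull (lat ` B))"

definition fan :: "(real ^ 'n) set set \<Rightarrow> bool" where
  "fan F \<longleftrightarrow> finite F \<and> F \<noteq> {} \<and>
     (\<forall>\<sigma>\<in>F. rational_cone \<sigma> \<and> (\<forall>x\<in>\<sigma>. - x \<in> \<sigma> \<longrightarrow> x = 0)) \<and>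
     (\<forall>\<sigma>\<in>F. \<forall>\<tau>. \<tau> face_of \<sigma> \<and> \<tau> \<noteq> {} \<longrightarrow> \<tau> \<in> F) \<and>
     (\<forall>\<sigma>\<in>F. \<forall>\<tau>\<in>F. (\<sigma> \<inter> \<tau>) face_of \<sigma> \<and> (\<sigma> \<inter> \<tau>) face_of \<tau>)"

definition lattice_basis :: "('n \<Rightarrow> int ^ 'n) \<Rightarrow> bool" where
  "lattice_basis b \<longleftrightarrow> (\<forall>w. \<exists>!c :: 'n \<Rightarrow> int. w = (\<Sum>k\<in>UNIV. c k *s b k))"

definition smooth_fan :: "(real ^ 'n) set set \<Rightarrow> bool" where
  "smooth_fan F \<longleftrightarrow>
     (\<forall>\<sigma>\<in>F. \<exists>b K. lattice_basis b \<and> \<sigma> = convex_cone hull ((\<lambda>k. lat (b k)) ` K))"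

definition complete_fan :: "(real ^ 'n) set set \<Rightarrow> bool" where
  "complete_fan F \<longleftrightarrow> \<Union>F = UNIV"

definition primitive_ray_generators :: "(real ^ 'n) set set \<Rightarrow> ('m \<Rightarrow> int ^ 'n) \<Rightarrow> bool" where
  "primitive_ray_generators F A \<longleftrightarrow> inj A \<and> (\<forall>i. Gcd (range (($) (A i))) = 1) \<and>
     {\<sigma>\<in>F. dim \<sigma> = 1} = range (\<lambda>i. convex_cone hull {lat (A i)})"

text \<open>
  A torus-invariant divisor \<open>\<Sum>\<^sub>i u\<^sub>i D\<^sub>i\<close> is given by its coefficient vector. Its support
  function \<open>\<psi>\<close> is linear on the cones of the fan, with \<open>\<psi>(a\<^sub>i) = - u\<^sub>i\<close>. The divisor is nef iff
  \<open>\<psi>\<close> is concave, and ample iff moreover its linear pieces belonging to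
  the maximal cones are pairwise different, i.e. \<open>\<psi>\<close> agrees with the piece of \<open>\<sigma>\<close> only on \<open>\<sigma>\<close>.
\<close>

definition support_function ::
    "(real ^ 'n) set set \<Rightarrow> ('m \<Rightarrow> int ^ 'n) \<Rightarrow> int ^ 'm \<Rightarrow> (real ^ 'n \<Rightarrow> real) \<Rightarrow> bool" where
  "support_function F A u \<psi> \<longleftrightarrow>
     (\<forall>\<sigma>\<in>F. \<exists>v. \<forall>x\<in>\<sigma>. \<psi> x = v \<bullet> x) \<and> (\<forall>i. \<psi> (lat (A i)) = - of_int (u $ i))"

definition nef_divisor :: "(real ^ 'n) set set \<Rightarrow> ('m \<Rightarrow> int ^ 'n) \<Rightarrow> int ^ 'm \<Rightarrow> bool" where
  "nef_divisor F A u \<longleftrightarrow> (\<exists>\<psi>. support_function F A u \<psi> \<and> concave_on UNIV \<psi>)"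

definition ample_divisor :: "(real ^ 'n) set set \<Rightarrow> ('m \<Rightarrow> int ^ 'n) \<Rightarrow> int ^ 'm \<Rightarrow> bool" where
  "ample_divisor F A u \<longleftrightarrow> (\<exists>\<psi>. support_function F A u \<psi> \<and> concave_on UNIV \<psi> \<and>
     (\<forall>\<sigma>\<in>F. (\<forall>\<tau>\<in>F. \<sigma> \<subseteq> \<tau> \<longrightarrow> \<tau> = \<sigma>) \<longrightarrow> (\<exists>v. \<forall>x. \<psi> x = v \<bullet> x \<longleftrightarrow> x \<in> \<sigma>)))"

definition smooth_projective_toric :: "(real ^ 'n) set set \<Rightarrow> ('m::finite \<Rightarrow> int ^ 'n) \<Rightarrow> bool" where
  "smooth_projective_toric F A \<longleftrightarrow> fan F \<and> primitive_ray_generators F A \<and> smooth_fan F \<and>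
     complete_fan F \<and> (\<exists>u. ample_divisor F A u)"

definition anticanonical_divisor :: "int ^ 'm" where
  "anticanonical_divisor = (\<chi> i. 1)"

definition weak_fano :: "(real ^ 'n) set set \<Rightarrow> ('m::finite \<Rightarrow> int ^ 'n) \<Rightarrow> bool" where
  "weak_fano F A \<longleftrightarrow> nef_divisor F A anticanonical_divisor"

definition fano :: "(real ^ 'n) set set \<Rightarrow> ('m::finite \<Rightarrow> int ^ 'n) \<Rightarrow> bool" where
  "fano F A \<longleftrightarrow> ample_divisor F A anticanonical_divisor"

section \<open>The lattice of relations and its dual, the Picard group\<close>

definition rel_lattice :: "('m::finite \<Rightarrow> int ^ 'n) \<Rightarrow> (int ^ 'm) set" where
  "rel_lattice A = {l. (\<Sum>i\<in>UNIV. (l $ i) *s A i) = 0}"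

definition dual_lattice :: "('m::finite \<Rightarrow> int ^ 'n) \<Rightarrow> (int ^ 'm \<Rightarrow> int) set" where
  "dual_lattice A = {\<phi> \<in> extensional (rel_lattice A).
     \<forall>l\<in>rel_lattice A. \<forall>l'\<in>rel_lattice A. \<phi> (l + l') = \<phi> l + \<phi> l'}"

definition divisor_class :: "('m::finite \<Rightarrow> int ^ 'n) \<Rightarrow> int ^ 'm \<Rightarrow> int ^ 'm \<Rightarrow> int" where
  "divisor_class A u = (\<lambda>l\<in>rel_lattice A. \<Sum>i\<in>UNIV. u $ i * l $ i)"

definition nef_class ::
    "(real ^ 'n) set set \<Rightarrow> ('m::finite \<Rightarrow> int ^ 'n) \<Rightarrow> (int ^ 'm \<Rightarrow> int) \<Rightarrow> bool" where
  "nef_class F A \<phi> \<longleftrightarrow> (\<exists>u. nef_divisor F A u \<and> \<phi> = divisor_class A u)"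

abbreviation anticanonical_class :: "('m::finite \<Rightarrow> int ^ 'n) \<Rightarrow> int ^ 'm \<Rightarrow> int" where
  "anticanonical_class A \<equiv> divisor_class A anticanonical_divisor"

definition dual_lattice_basis ::
    "('m::finite \<Rightarrow> int ^ 'n) \<Rightarrow> ('r::finite \<Rightarrow> int ^ 'm \<Rightarrow> int) \<Rightarrow> bool" where
  "dual_lattice_basis A p \<longleftrightarrow> (\<forall>a. p a \<in> dual_lattice A) \<and>
     (\<forall>\<phi>\<in>dual_lattice A. \<exists>!c :: 'r \<Rightarrow> int. \<forall>l\<in>rel_lattice A. \<phi> l = (\<Sum>a\<in>UNIV. c a * p a l))"

definition in_generated_cone ::
    "('m::finite \<Rightarrow> int ^ 'n) \<Rightarrow> ('r::finite \<Rightarrow> int ^ 'm \<Rightarrow> int) \<Rightarrow> (int ^ 'm \<Rightarrow> int) \<Rightarrow> bool" where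
  "in_generated_cone A p \<phi> \<longleftrightarrow> (\<exists>c :: 'r \<Rightarrow> real. (\<forall>a. 0 \<le> c a) \<and>
     (\<forall>l\<in>rel_lattice A. real_of_int (\<phi> l) = (\<Sum>a\<in>UNIV. c a * real_of_int (p a l))))"

definition is_dual_basis ::
    "('m::finite \<Rightarrow> int ^ 'n) \<Rightarrow> ('r \<Rightarrow> int ^ 'm \<Rightarrow> int) \<Rightarrow> ('r \<Rightarrow> int ^ 'm) \<Rightarrow> bool" where
  "is_dual_basis A p pd \<longleftrightarrow>
     (\<forall>b. pd b \<in> rel_lattice A) \<and> (\<forall>a b. p a (pd b) = (if a = b then 1 else 0))"

definition monomial_exponents ::
    "('m::finite \<Rightarrow> int ^ 'n) \<Rightarrow> ('r \<Rightarrow> int ^ 'm \<Rightarrow> int) \<Rightarrow> ('m \<Rightarrow> 'r \<Rightarrow> nat) \<Rightarrow> bool" where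
  "monomial_exponents A p g \<longleftrightarrow> (\<forall>a. p a = divisor_class A (\<chi> i. int (g i a)))"

section \<open>Polynomials and the Zariski topology on affine space\<close>

type_synonym 'v mpol = "('v \<Rightarrow>\<^sub>0 nat) \<Rightarrow>\<^sub>0 complex"

definition var :: "'v \<Rightarrow> 'v mpol" where
  "var v = Poly_Mapping.single (Poly_Mapping.single v 1) 1"

definition eval :: "('v::finite \<Rightarrow> complex) \<Rightarrow> 'v mpol \<Rightarrow> complex" where
  "eval x f = (\<Sum>t\<in>Poly_Mapping.keys f.
     Poly_Mapping.lookup f t * (\<Prod>v\<in>UNIV. x v ^ Poly_Mapping.lookup t v))"

definition partial :: "'v \<Rightarrow> 'v mpol \<Rightarrow> 'v mpol" where
  "partial v f = (\<Sum>t\<in>Poly_Mapping.keys f.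
     Poly_Mapping.single (t - Poly_Mapping.single v 1)
       (of_nat (Poly_Mapping.lookup t v) * Poly_Mapping.lookup f t))"

definition zariski_closed :: "('v::finite \<Rightarrow> complex) set \<Rightarrow> bool" where
  "zariski_closed S \<longleftrightarrow> (\<exists>T. S = {x. \<forall>f\<in>T. eval x f = 0})"

definition zariski_open :: "('v::finite \<Rightarrow> complex) set \<Rightarrow> bool" where
  "zariski_open V \<longleftrightarrow> zariski_closed (- V)"

definition zariski_closure :: "('v::finite \<Rightarrow> complex) set \<Rightarrow> ('v \<Rightarrow> complex) set" where
  "zariski_closure S = \<Inter>{C. zariski_closed C \<and> S \<subseteq> C}"

section \<open>Non-degenerate Laurent polynomials\<close>

definition newton_polytope :: "('m \<Rightarrow> int ^ 'n) \<Rightarrow> (real ^ 'n) set" where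
  "newton_polytope A = convex hull (insert 0 (range (\<lambda>i. lat (A i))))"

text \<open>The sum of the terms of the family of Laurent polynomials whose exponents lie in \<open>\<sigma>\<close>.\<close>

definition laurent_part ::
    "('m::finite \<Rightarrow> int ^ 'n) \<Rightarrow> ('m \<Rightarrow> 'r::finite \<Rightarrow> nat) \<Rightarrow> ('r \<Rightarrow> complex) \<Rightarrow>
     (real ^ 'n) set \<Rightarrow> complex ^ 'n \<Rightarrow> complex" where
  "laurent_part A g q \<sigma> y = (\<Sum>i | lat (A i) \<in> \<sigma>.
     (\<Prod>k\<in>UNIV. (y $ k) powi (A i $ k)) * (\<Prod>a\<in>UNIV. q a ^ g i a))"

definition nondegenerate ::
    "('m::finite \<Rightarrow> int ^ 'n) \<Rightarrow> ('m \<Rightarrow> 'r::finite \<Rightarrow> nat) \<Rightarrow> ('r \<Rightarrow> complex) \<Rightarrow> bool" where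
  "nondegenerate A g q \<longleftrightarrow>
     (\<forall>\<sigma>. \<sigma> face_of newton_polytope A \<and> \<sigma> \<noteq> {} \<and> \<sigma> \<noteq> newton_polytope A \<and> 0 \<notin> \<sigma> \<longrightarrow>
       \<not> (\<exists>y. (\<forall>k. y $ k \<noteq> 0) \<and> (laurent_part A g q \<sigma> has_derivative (\<lambda>_. 0)) (at y)))"

definition S2 :: "('r \<Rightarrow> complex) set" where
  "S2 = {q. \<forall>a. q a \<noteq> 0}"

definition S2_0 ::
    "('m::finite \<Rightarrow> int ^ 'n) \<Rightarrow> ('m \<Rightarrow> 'r::finite \<Rightarrow> nat) \<Rightarrow> ('r \<Rightarrow> complex) set" where
  "S2_0 A g = {q\<in>S2. nondegenerate A g q}"

definition S2_0_bar ::
    "('m::finite \<Rightarrow> int ^ 'n) \<Rightarrow> ('m \<Rightarrow> 'r::finite \<Rightarrow> nat) \<Rightarrow> ('r \<Rightarrow> complex) set" where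
  "S2_0_bar A g = - zariski_closure (S2 - S2_0 A g)"

section \<open>Sheaves associated to modules over the polynomial ring\<close>

text \<open>
  Throughout, \<open>M\<close> is a module over the ring of polynomials in the variables of type \<open>'v\<close>; the
  ring multiplication and unit which the record type provides are irrelevant and left undefined.
  \<open>germ M x m f\<close> is the fraction \<open>m/f\<close> in the localization of \<open>M\<close> at the maximal ideal of \<open>x\<close>.
\<close>

definition germ ::
    "('v::finite mpol, 'b) module \<Rightarrow> ('v \<Rightarrow> complex) \<Rightarrow> 'b \<Rightarrow> 'v mpol \<Rightarrow> ('b \<times> 'v mpol) set" where
  "germ M x m f = {(n, g). n \<in> carrier M \<and> eval x g \<noteq> 0 \<and>
     (\<exists>h. eval x h \<noteq> 0 \<and> h \<odot>\<^bsub>M\<^esub> (g \<odot>\<^bsub>M\<^esub> m) = h \<odot>\<^bsub>M\<^esub> (f \<odot>\<^bsub>M\<^esub> n))}"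

definition poly_module :: "('v mpol, 'v mpol) module" where
  "poly_module = \<lparr>carrier = UNIV, mult = (*), one = 1, zero = 0, add = (+), smult = (*)\<rparr>"

text \<open>The stalk at \<open>x\<close>, as a module over the local ring \<open>stalk poly_module x\<close>.\<close>

definition stalk ::
    "('v::finite mpol, 'b) module \<Rightarrow> ('v \<Rightarrow> complex) \<Rightarrow>
     (('v mpol \<times> 'v mpol) set, ('b \<times> 'v mpol) set) module" where
  "stalk M x = \<lparr>
     carrier = {germ M x m f | m f. m \<in> carrier M \<and> eval x f \<noteq> 0},
     mult = undefined,
     one = undefined,
     zero = germ M x \<zero>\<^bsub>M\<^esub> 1,
     add = (\<lambda>s t. \<Union>(m, f)\<in>s. \<Union>(n, g)\<in>t.
              germ M x ((g \<odot>\<^bsub>M\<^esub> m) \<oplus>\<^bsub>M\<^esub> (f \<odot>\<^bsub>M\<^esub> n)) (f * g)),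
     smult = (\<lambda>c s. \<Union>(u, h)\<in>c. \<Union>(m, f)\<in>s. germ M x (u \<odot>\<^bsub>M\<^esub> m) (h * f))\<rparr>"

definition sections ::
    "('v::finite mpol, 'b) module \<Rightarrow> ('v \<Rightarrow> complex) set \<Rightarrow>
     (('v \<Rightarrow> complex) \<Rightarrow> ('b \<times> 'v mpol) set) set" where
  "sections M V = {s \<in> extensional V. \<forall>x\<in>V. \<exists>W m f.
     zariski_open W \<and> x \<in> W \<and> W \<subseteq> V \<and> m \<in> carrier M \<and>
     (\<forall>y\<in>W. eval y f \<noteq> 0 \<and> s y = germ M y m f)}"

definition sec_add ::
    "('v::finite mpol, 'b) module \<Rightarrow> ('v \<Rightarrow> complex) set \<Rightarrow>
     (('v \<Rightarrow> complex) \<Rightarrow> ('b \<times> 'v mpol) set) \<Rightarrow> (('v \<Rightarrow> complex) \<Rightarrow> ('b \<times> 'v mpol) set) \<Rightarrow>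
     ('v \<Rightarrow> complex) \<Rightarrow> ('b \<times> 'v mpol) set" where
  "sec_add M V s t = (\<lambda>x\<in>V. s x \<oplus>\<^bsub>stalk M x\<^esub> t x)"

definition sec_smult ::
    "('v::finite mpol, 'b) module \<Rightarrow> ('v \<Rightarrow> complex) set \<Rightarrow>
     (('v \<Rightarrow> complex) \<Rightarrow> ('v mpol \<times> 'v mpol) set) \<Rightarrow>
     (('v \<Rightarrow> complex) \<Rightarrow> ('b \<times> 'v mpol) set) \<Rightarrow> ('v \<Rightarrow> complex) \<Rightarrow> ('b \<times> 'v mpol) set" where
  "sec_smult M V c s = (\<lambda>x\<in>V. c x \<odot>\<^bsub>stalk M x\<^esub> s x)"

text \<open>Coherence of the restriction to an open set \<open>X\<close> of the sheaf associated to \<open>M\<close>: it is of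
  finite type, and so is the kernel of every morphism from a finite free module, over any open
  subset, given by sections \<open>s\<^sub>0, \<dots>, s\<^sub>k\<^sub>-\<^sub>1\<close>.\<close>

definition finite_type_on ::
    "('v::finite mpol, 'b) module \<Rightarrow> ('v \<Rightarrow> complex) set \<Rightarrow> bool" where
  "finite_type_on M X \<longleftrightarrow> (\<forall>x\<in>X. \<exists>W (k::nat) s.
     zariski_open W \<and> x \<in> W \<and> W \<subseteq> X \<and> (\<forall>j<k. s j \<in> sections M W) \<and>
     (\<forall>y\<in>W. \<forall>t\<in>carrier (stalk M y). \<exists>c.
        (\<forall>j<k. c j \<in> carrier (stalk poly_module y)) \<and>
        t = finsum (stalk M y) (\<lambda>j. c j \<odot>\<^bsub>stalk M y\<^esub> s j y) {..<k}))"

definition germ_relation ::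
    "('v::finite mpol, 'b) module \<Rightarrow> ('v \<Rightarrow> complex) \<Rightarrow> nat \<Rightarrow>
     (nat \<Rightarrow> ('v \<Rightarrow> complex) \<Rightarrow> ('b \<times> 'v mpol) set) \<Rightarrow> (nat \<Rightarrow> ('v mpol \<times> 'v mpol) set) \<Rightarrow> bool" where
  "germ_relation M y k s c \<longleftrightarrow> (\<forall>j<k. c j \<in> carrier (stalk poly_module y)) \<and>
     finsum (stalk M y) (\<lambda>j. c j \<odot>\<^bsub>stalk M y\<^esub> s j y) {..<k} = \<zero>\<^bsub>stalk M y\<^esub>"

definition relations_finite_type_on ::
    "('v::finite mpol, 'b) module \<Rightarrow> ('v \<Rightarrow> complex) set \<Rightarrow> nat \<Rightarrow>
     (nat \<Rightarrow> ('v \<Rightarrow> complex) \<Rightarrow> ('b \<times> 'v mpol) set) \<Rightarrow> bool" where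
  "relations_finite_type_on M V k s \<longleftrightarrow> (\<forall>x\<in>V. \<exists>W (e::nat) R.
     zariski_open W \<and> x \<in> W \<and> W \<subseteq> V \<and>
     (\<forall>i<e. (\<forall>j<k. R i j \<in> sections poly_module W) \<and>
            (\<forall>y\<in>W. germ_relation M y k s (\<lambda>j. R i j y))) \<and>
     (\<forall>y\<in>W. \<forall>c. germ_relation M y k s c \<longrightarrow>
        (\<exists>d. (\<forall>i<e. d i \<in> carrier (stalk poly_module y)) \<and>
             (\<forall>j<k. c j = finsum (stalk poly_module y)
                             (\<lambda>i. d i \<odot>\<^bsub>stalk poly_module y\<^esub> R i j y) {..<e}))))"

definition coherent_on :: "('v::finite mpol, 'b) module \<Rightarrow> ('v \<Rightarrow> complex) set \<Rightarrow> bool" where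
  "coherent_on M X \<longleftrightarrow> finite_type_on M X \<and>
     (\<forall>V (k::nat) s. zariski_open V \<and> V \<subseteq> X \<and> (\<forall>j<k. s j \<in> sections M V) \<longrightarrow>
        relations_finite_type_on M V k s)"

section \<open>The ring of differential operators and the hypergeometric module\<close>

text \<open>
  The coordinates on the product of the \<open>z\<close>-line with affine \<open>r\<close>-space are indexed by
  \<open>'r option\<close>: \<open>None\<close> stands for \<open>z\<close> and \<open>Some a\<close> for \<open>q\<^sub>a\<close>. Differential operators are
  identified with the endomorphisms of the polynomial ring by which they act; the Weyl algebra
  acts faithfully in characteristic zero.
\<close>

type_synonym 'r oper = "'r option mpol \<Rightarrow> 'r option mpol"

abbreviation zvar :: "'r option mpol" where
  "zvar \<equiv> var None"

abbreviation qvar :: "'r \<Rightarrow> 'r option mpol" where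
  "qvar a \<equiv> var (Some a)"

fun log_weight :: "'r option \<Rightarrow> 'r option mpol" where
  "log_weight None = zvar ^ 2"
| "log_weight (Some a) = zvar * qvar a"

text \<open>\<open>log_der None\<close> is \<open>z\<^sup>2 \<partial>\<^sub>z\<close> and \<open>log_der (Some a)\<close> is \<open>z q\<^sub>a \<partial>\<^sub>q\<^sub>a\<close>.\<close>

definition log_der :: "'r option \<Rightarrow> 'r oper" where
  "log_der v = (\<lambda>f. log_weight v * partial v f)"

inductive_set Rtilde :: "'r oper set" where
  mul: "(\<lambda>f. h * f) \<in> Rtilde"
| der: "log_der v \<in> Rtilde"
| add: "P \<in> Rtilde \<Longrightarrow> Q \<in> Rtilde \<Longrightarrow> (\<lambda>f. P f + Q f) \<in> Rtilde"
| comp: "P \<in> Rtilde \<Longrightarrow> Q \<in> Rtilde \<Longrightarrow> P \<circ> Q \<in> Rtilde"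

inductive_set left_ideal :: "'r oper set \<Rightarrow> 'r oper set" for G where
  zero: "(\<lambda>f. 0) \<in> left_ideal G"
| gen: "T \<in> Rtilde \<Longrightarrow> P \<in> G \<Longrightarrow> T \<circ> P \<in> left_ideal G"
| add: "P \<in> left_ideal G \<Longrightarrow> Q \<in> left_ideal G \<Longrightarrow> (\<lambda>f. P f + Q f) \<in> left_ideal G"

text \<open>\<open>pd a $ i\<close> is the integer \<open>m\<^sub>i\<^sub>a\<close>.\<close>

definition box_factor :: "('r::finite \<Rightarrow> int ^ 'm) \<Rightarrow> 'm \<Rightarrow> nat \<Rightarrow> 'r oper" where
  "box_factor pd i \<nu> = (\<lambda>f. (\<Sum>a\<in>UNIV. of_int (pd a $ i) * log_der (Some a) f)
                             - of_nat \<nu> * zvar * f)"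

text \<open>The product over \<open>i \<in> I\<close> and \<open>0 \<le> \<nu> < k i\<close>; all factors commute, so the result of
  \<open>Finite_Set.fold\<close> does not depend on the order.\<close>

definition box_product ::
    "('r::finite \<Rightarrow> int ^ 'm) \<Rightarrow> 'm set \<Rightarrow> ('m \<Rightarrow> nat) \<Rightarrow> 'r oper" where
  "box_product pd I k =
     Finite_Set.fold (\<lambda>i T. foldr (\<lambda>\<nu> T'. box_factor pd i \<nu> \<circ> T') [0..<k i] id \<circ> T) id I"

definition box_operator ::
    "('r::finite \<Rightarrow> int ^ 'm \<Rightarrow> int) \<Rightarrow> ('r \<Rightarrow> int ^ 'm) \<Rightarrow> int ^ 'm \<Rightarrow> 'r oper" where
  "box_operator p pd l = (\<lambda>f.
     (\<Prod>a | p a l > 0. qvar a ^ nat (p a l)) *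
        box_product pd {i. l $ i < 0} (\<lambda>i. nat (- (l $ i))) f -
     (\<Prod>a | p a l < 0. qvar a ^ nat (- p a l)) *
        box_product pd {i. l $ i > 0} (\<lambda>i. nat (l $ i)) f)"

definition euler_operator ::
    "('m::finite \<Rightarrow> int ^ 'n) \<Rightarrow> ('r::finite \<Rightarrow> int ^ 'm) \<Rightarrow> 'r oper" where
  "euler_operator A pd = (\<lambda>f. log_der None f +
     (\<Sum>a\<in>UNIV. of_int (anticanonical_class A (pd a)) * log_der (Some a) f))"

definition Itilde ::
    "('m::finite \<Rightarrow> int ^ 'n) \<Rightarrow> ('r::finite \<Rightarrow> int ^ 'm \<Rightarrow> int) \<Rightarrow> ('r \<Rightarrow> int ^ 'm) \<Rightarrow> 'r oper set" where
  "Itilde A p pd =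
     left_ideal (insert (euler_operator A pd) (box_operator p pd ` rel_lattice A))"

definition residue_class :: "'r oper set \<Rightarrow> 'r oper \<Rightarrow> 'r oper set" where
  "residue_class I P = {Q \<in> Rtilde. (\<lambda>f. Q f - P f) \<in> I}"

text \<open>The quotient of \<open>Rtilde\<close> by a left ideal, as a module over the polynomial ring.\<close>

definition Rtilde_quotient :: "'r oper set \<Rightarrow> ('r option mpol, 'r oper set) module" where
  "Rtilde_quotient I = \<lparr>
     carrier = residue_class I ` Rtilde,
     mult = undefined,
     one = undefined,
     zero = residue_class I (\<lambda>f. 0),
     add = (\<lambda>C D. \<Union>P\<in>C. \<Union>Q\<in>D. residue_class I (\<lambda>f. P f + Q f)),
     smult = (\<lambda>h C. \<Union>P\<in>C. residue_class I (\<lambda>f. h * P f))\<rparr>"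

definition left_action :: "'r oper set \<Rightarrow> 'r oper \<Rightarrow> 'r oper set \<Rightarrow> 'r oper set" where
  "left_action I T C = (\<Union>P\<in>C. residue_class I (T \<circ> P))"

definition QM ::
    "('m::finite \<Rightarrow> int ^ 'n) \<Rightarrow> ('r::finite \<Rightarrow> int ^ 'm \<Rightarrow> int) \<Rightarrow> ('r \<Rightarrow> int ^ 'm) \<Rightarrow>
     ('r option mpol, 'r oper set) module" where
  "QM A p pd = Rtilde_quotient (Itilde A p pd)"

definition z_line_times :: "('r \<Rightarrow> complex) set \<Rightarrow> ('r option \<Rightarrow> complex) set" where
  "z_line_times U = {x. (\<lambda>a. x (Some a)) \<in> U}"

definition tau_line_times :: "('r \<Rightarrow> complex) set \<Rightarrow> ('r option \<Rightarrow> complex) set" where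
  "tau_line_times U = {x. x None \<noteq> 0 \<and> (\<lambda>a. x (Some a)) \<in> U}"

section \<open>Logarithmic connections\<close>

text \<open>
  The sheaf of forms \<open>z\<^sup>-\<^sup>1 \<Omega>\<^sup>1(log)\<close> with logarithmic poles along the coordinate hyperplanes
  is free with basis \<open>e\<^sub>v = dx\<^sub>v / log_weight v\<close>, that is \<open>z\<^sup>-\<^sup>1 dz/z\<close> and \<open>z\<^sup>-\<^sup>1 dq\<^sub>a/q\<^sub>a\<close>.
  A section of its tensor product with a sheaf of modules is therefore given by its
  coefficients with respect to this basis, a family of sections indexed by \<open>'r option\<close>.
  In particular, the coefficients of \<open>d\<phi>\<close> are \<open>log_weight v \<cdot> \<partial>\<^sub>v \<phi> = log_der v \<phi>\<close>, which
  is computed on fractions by the quotient rule.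
\<close>

definition log_differential ::
    "('r::finite option \<Rightarrow> complex) set \<Rightarrow>
     (('r option \<Rightarrow> complex) \<Rightarrow> ('r option mpol \<times> 'r option mpol) set) \<Rightarrow> 'r option \<Rightarrow>
     ('r option \<Rightarrow> complex) \<Rightarrow> ('r option mpol \<times> 'r option mpol) set" where
  "log_differential V \<phi> v = (\<lambda>x\<in>V. \<Union>(u, h)\<in>\<phi> x.
     germ poly_module x (h * log_der v u - log_der v h * u) (h * h))"

text \<open>A connection on the restriction to \<open>X\<close> is a morphism of sheaves: \<open>nabla V\<close> is its effect
  on the sections over \<open>V\<close>. Homogeneity for constants is a case of the Leibniz rule.\<close>

definition log_connection ::
    "('r::finite option mpol, 'b) module \<Rightarrow> ('r option \<Rightarrow> complex) set \<Rightarrow>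
     (('r option \<Rightarrow> complex) set \<Rightarrow> (('r option \<Rightarrow> complex) \<Rightarrow> ('b \<times> 'r option mpol) set) \<Rightarrow>
       'r option \<Rightarrow> ('r option \<Rightarrow> complex) \<Rightarrow> ('b \<times> 'r option mpol) set) \<Rightarrow> bool" where
  "log_connection M X nabla \<longleftrightarrow> (\<forall>V. zariski_open V \<and> V \<subseteq> X \<longrightarrow>
     (\<forall>s\<in>sections M V. \<forall>v.
        nabla V s v \<in> sections M V \<and>
        (\<forall>W. zariski_open W \<and> W \<subseteq> V \<longrightarrow> nabla W (restrict s W) v = restrict (nabla V s v) W) \<and>
        (\<forall>t\<in>sections M V.
           nabla V (sec_add M V s t) v = sec_add M V (nabla V s v) (nabla V t v)) \<and>
        (\<forall>\<phi>\<in>sections poly_module V.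
           nabla V (sec_smult M V \<phi> s) v =
             sec_add M V (sec_smult M V \<phi> (nabla V s v))
                         (sec_smult M V (log_differential V \<phi> v) s))))"

text \<open>
  Where all coordinates are invertible, the sheaf associated to \<open>Rtilde\<close> is the sheaf of all
  differential operators, with \<open>\<partial>\<^sub>v = (log_weight v)\<^sup>-\<^sup>1 log_der v\<close>, and the sheaf associated to
  the quotient of \<open>Rtilde\<close> by a left ideal \<open>I\<close> is a left module over it by left multiplication.
  This is the action of \<open>\<partial>\<^sub>v\<close> on the stalk at \<open>x\<close>, from
  \<open>log_der v \<circ> f\<^sup>-\<^sup>1 = f\<^sup>-\<^sup>2 (f log_der v - log_der v f)\<close>.
\<close>

definition dmodule_partial ::
    "'r::finite oper set \<Rightarrow> 'r option \<Rightarrow> ('r option \<Rightarrow> complex) \<Rightarrow>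
     ('r oper set \<times> 'r option mpol) set \<Rightarrow> ('r oper set \<times> 'r option mpol) set" where
  "dmodule_partial I v x s = (let M = Rtilde_quotient I in
     \<Union>(C, f)\<in>s. germ M x
       ((f \<odot>\<^bsub>M\<^esub> left_action I (log_der v) C) \<oplus>\<^bsub>M\<^esub> ((- log_der v f) \<odot>\<^bsub>M\<^esub> C))
       (log_weight v * f * f))"

text \<open>On \<open>Y\<close>, the connection is \<open>s \<mapsto> \<Sum>\<^sub>v \<partial>\<^sub>v s \<otimes> dx\<^sub>v\<close>, where \<open>dx\<^sub>v = log_weight v \<cdot> e\<^sub>v\<close>.\<close>

definition extends_dmodule_structure ::
    "'r::finite oper set \<Rightarrow> ('r option \<Rightarrow> complex) set \<Rightarrow>
     (('r option \<Rightarrow> complex) set \<Rightarrow>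
       (('r option \<Rightarrow> complex) \<Rightarrow> ('r oper set \<times> 'r option mpol) set) \<Rightarrow>
       'r option \<Rightarrow> ('r option \<Rightarrow> complex) \<Rightarrow> ('r oper set \<times> 'r option mpol) set) \<Rightarrow> bool" where
  "extends_dmodule_structure I Y nabla \<longleftrightarrow>
     (\<forall>V. zariski_open V \<and> V \<subseteq> Y \<longrightarrow>
       (\<forall>s\<in>sections (Rtilde_quotient I) V. \<forall>v. \<forall>x\<in>V.
          nabla V s v x = germ poly_module x (log_weight v) 1
            \<odot>\<^bsub>stalk (Rtilde_quotient I) x\<^esub> dmodule_partial I v x (s x)))"

end

theory Submission
  imports
    Defs
    "HOL-Library.Multiset"
    "HOL-Computational_Algebra.Polynomial"
begin

text \<open>
  Once \<open>z\<^sup>2 \<partial>\<^sub>z\<close> is eliminated with the Euler operator, the quotient is generated over the polynomial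
  ring by the monomials in the commuting operators \<open>D\<^sub>i = \<Sum>\<^sub>a m\<^sub>i\<^sub>a z q\<^sub>a \<partial>\<^sub>q\<^sub>a\<close>. If the rays \<open>a\<^sub>i\<close>,
  \<open>i \<in> I\<close>, do not lie in a common cone, then rewriting \<open>\<Sum>\<^sub>i\<^sub>\<in>\<^sub>I a\<^sub>i\<close> in the cone which contains it
  gives a relation \<open>l\<close>. By concavity of the support functions \<open>p\<^sub>a(l) \<ge> 0\<close>, so the box operator of \<open>l\<close>
  replaces \<open>\<Prod>\<^sub>i\<^sub>\<in>\<^sub>I D\<^sub>i\<close>, up to lower order, by \<open>q\<^bsup>p(l)\<^esup>\<close> times a monomial of the same degree, and by
  nothing if \<open>\<Sum>\<^sub>i l\<^sub>i > 0\<close>, as is the case if the variety is Fano. Monomials supported on a cone are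
  reduced to this case by the linear relations between the \<open>D\<^sub>i\<close>. Hence in a fixed large degree all
  monomials are combinations of each other with coefficients vanishing at \<open>q = 0\<close>, and Nakayama's lemma
  gives a polynomial \<open>f\<close> with \<open>f(0) = 1\<close> (and \<open>f = 1\<close> in the Fano case) such that multiplication by \<open>f\<close>
  lowers the order. One can take \<open>U = {f \<noteq> 0}\<close>: the module is finitely generated there, relations
  between sections are finitely generated since the polynomial ring is Noetherian, and a critical
  point of a face of \<open>W(-, q)\<close> is a non-zero common zero of the symbols used for the reduction, so that
  \<open>f(q) = 0\<close> for degenerate \<open>q\<close>. The connection is left multiplication, extended to fractions by the
  quotient rule.
\<close>

section \<open>Polynomials in several variables\<close>

text \<open>The open set has to be a product with the whole z-line, so the polynomial f may involve
  only q. The reduction is therefore carried out with vectors of coefficients in q alone: z enters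
  only through the shifts -\<nu> z and through commutators, that is, through terms of lower order.
  The degree N = CARD('m) + 1 is chosen for a pigeonhole argument: a monomial of that degree
  contains some D_i twice. If its support lies in a cone, one copy can be exchanged for factors
  outside the support, while the other copy keeps i in it; the support grows until it fits into no
  cone. The coefficients in Nakayama's lemma vanish at the origin because a nonzero relation l with
  all p_a(l) \<ge> 0 has some p_a(l) > 0. A single module of coefficient vectors records both the
  reductions of operators and the vanishing at characteristic points, so the same f serves for
  finite generation and for the inclusion of U in \<open>S2_0_bar A g\<close>.\<close>

definition const :: "complex \<Rightarrow> 'v mpol" where
  "const c = Poly_Mapping.single 0 c"

lemma mpol_monomial_induct [case_names monomial add]:
  fixes f :: "'v mpol"
  assumes "\<And>t c. P (Poly_Mapping.single t c)" and "\<And>f g. P f \<Longrightarrow> P g \<Longrightarrow> P (f + g)"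
  shows "P f"
proof (induction f rule: update_induct)
  case const
  show ?case using assms(1)[of 0 0] by simp
next
  case (update f a b)
  have "Poly_Mapping.update a b f = f + Poly_Mapping.single a b"
    using update.hyps
    by (intro poly_mapping_eqI)
       (auto simp: lookup_update lookup_add lookup_single when_def in_keys_iff)
  then show ?case using update.IH assms by metis
qed

lemma var_power: "var v ^ n = Poly_Mapping.single (Poly_Mapping.single v n) 1"
  by (induction n) (simp_all add: var_def mult_single single_add[symmetric])

text \<open>With this rule, identities between ring maps or derivations are checked on constants and
  variables only.\<close>

lemma mpol_induct [case_names const var add mult]:
  fixes f :: "'v mpol"
  assumes "\<And>c. P (const c)" and "\<And>v. P (var v)"
    and "\<And>f g. P f \<Longrightarrow> P g \<Longrightarrow> P (f + g)" and "\<And>f g. P f \<Longrightarrow> P g \<Longrightarrow> P (f * g)"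
  shows "P f"
proof (induction f rule: mpol_monomial_induct)
  case (monomial t c)
  show ?case
  proof (induction t rule: update_induct)
    case const
    show ?case using assms(1) by (simp add: const_def)
  next
    case (update t v n)
    have t: "Poly_Mapping.update v n t = t + Poly_Mapping.single v n"
      using update.hyps
      by (intro poly_mapping_eqI)
         (auto simp: lookup_update lookup_add lookup_single when_def in_keys_iff)
    have "P (var v ^ n)"
    proof (induction n)
      case 0
      show ?case using assms(1)[of 1] by (simp add: const_def)
    qed (simp add: assms)
    then have "P (Poly_Mapping.single t c * var v ^ n)"
      using update.IH assms(4) by blast
    then show ?case by (simp add: t var_power mult_single)
  qed
qed (use assms in auto)

text \<open>With the identity for \<phi> this is \<open>eval\<close>, with \<open>const\<close> it
  is the substitution of polynomials for the variables; the ring laws are proved once for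
  both.\<close>

definition poly_ev ::
    "(complex \<Rightarrow> 'c::comm_ring_1) \<Rightarrow> ('v::finite \<Rightarrow> 'c) \<Rightarrow> 'v mpol \<Rightarrow> 'c" where
  "poly_ev \<phi> x f = (\<Sum>t\<in>Poly_Mapping.keys f.
     \<phi> (Poly_Mapping.lookup f t) * (\<Prod>v\<in>UNIV. x v ^ Poly_Mapping.lookup t v))"

locale poly_evaluation =
  fixes \<phi> :: "complex \<Rightarrow> 'c::comm_ring_1"
  assumes add: "\<phi> (a + b) = \<phi> a + \<phi> b" and mult: "\<phi> (a * b) = \<phi> a * \<phi> b" and one: "\<phi> 1 = 1"
begin

lemma zero: "\<phi> 0 = 0"
  using add[of 0 0] by simp

lemma poly_ev_add: "poly_ev \<phi> x (f + g) = poly_ev \<phi> x f + poly_ev \<phi> x g"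
  unfolding poly_ev_def
  by (rule setsum_keys_plus_distrib) (simp_all add: zero add distrib_right)

lemma poly_ev_single:
  "poly_ev \<phi> x (Poly_Mapping.single t c) = \<phi> c * (\<Prod>v\<in>UNIV. x v ^ Poly_Mapping.lookup t v)"
  by (cases "c = 0") (simp_all add: poly_ev_def zero)

lemma poly_ev_const: "poly_ev \<phi> x (const c) = \<phi> c"
  by (simp add: const_def poly_ev_single)

lemma poly_ev_var: "poly_ev \<phi> x (var v) = x v"
proof -
  have "(\<Prod>w\<in>UNIV. x w ^ Poly_Mapping.lookup (Poly_Mapping.single v 1) w) =
        (\<Prod>w\<in>UNIV. if w = v then x w else 1)"
    by (rule prod.cong) (auto simp: lookup_single when_def)
  then show ?thesis by (simp add: var_def poly_ev_single one)
qed

lemma poly_ev_mult: "poly_ev \<phi> x (f * g) = poly_ev \<phi> x f * poly_ev \<phi> x g"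
proof (induction f rule: mpol_monomial_induct)
  case (monomial t c)
  show ?case
  proof (induction g rule: mpol_monomial_induct)
    case (monomial u d)
    show ?case
      by (simp add: mult_single poly_ev_single mult lookup_add power_add prod.distrib ac_simps)
  qed (simp add: distrib_left poly_ev_add)
qed (simp add: distrib_right poly_ev_add)

end

lemma eval_eq_poly_ev: "eval x f = poly_ev (\<lambda>c. c) x f"
  by (simp add: eval_def poly_ev_def)

interpretation eval_id: poly_evaluation "\<lambda>c. c"
  by unfold_locales auto

interpretation poly_const: poly_evaluation const
  by unfold_locales (simp_all add: const_def single_add mult_single)

lemma eval_add [simp]: "eval x (f + g) = eval x f + eval x g"
  and eval_mult [simp]: "eval x (f * g) = eval x f * eval x g"
  and eval_const [simp]: "eval x (const c) = c"
  and eval_var [simp]: "eval x (var v) = x v"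
  by (simp_all add: eval_eq_poly_ev eval_id.poly_ev_add eval_id.poly_ev_mult
      eval_id.poly_ev_const eval_id.poly_ev_var)

lemma const_0 [simp]: "const 0 = 0" and const_1 [simp]: "const 1 = 1"
  by (simp_all add: const_def)

lemma const_of_nat: "const (of_nat n) = of_nat n" and const_of_int: "const (of_int k) = of_int k"
  by (simp_all add: const_def)

lemma eval_0 [simp]: "eval x 0 = 0" and eval_1 [simp]: "eval x 1 = 1"
  using eval_const[of x 0] eval_const[of x 1] by (simp_all del: eval_const)

lemma eval_uminus [simp]: "eval x (- f) = - eval x f"
  using eval_add[of x f "- f"] by (simp del: eval_add add: eq_neg_iff_add_eq_0 add.commute)

lemma eval_diff [simp]: "eval x (f - g) = eval x f - eval x g"
  using eval_add[of x f "- g"] by (simp del: eval_add)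

lemma eval_power [simp]: "eval x (f ^ n) = eval x f ^ n"
  by (induction n) simp_all

lemma eval_prod [simp]: "eval x (prod f S) = (\<Prod>s\<in>S. eval x (f s))"
  by (induction S rule: infinite_finite_induct) simp_all

lemma eval_sum: "eval x (sum f S) = (\<Sum>s\<in>S. eval x (f s))"
  by (induction S rule: infinite_finite_induct) simp_all

lemma eval_of_nat [simp]: "eval x (of_nat n) = of_nat n"
  and eval_of_int [simp]: "eval x (of_int k) = of_int k"
  using eval_const[of x "of_nat n"] eval_const[of x "of_int k"]
  by (simp_all add: const_of_nat const_of_int del: eval_const)

text \<open>Keeps coefficients in q visibly free of z: the locus where \<open>q_embed f\<close> does
  not vanish is the product of the z-line with the corresponding locus of f.\<close>

definition q_embed :: "'r::finite mpol \<Rightarrow> 'r option mpol" where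
  "q_embed = poly_ev const qvar"

lemma q_embed_add [simp]: "q_embed (f + g) = q_embed f + q_embed g"
  and q_embed_mult [simp]: "q_embed (f * g) = q_embed f * q_embed g"
  and q_embed_const [simp]: "q_embed (const c) = const c"
  and q_embed_var [simp]: "q_embed (var a) = qvar a"
  by (simp_all add: q_embed_def poly_const.poly_ev_add poly_const.poly_ev_mult
      poly_const.poly_ev_const poly_const.poly_ev_var)

lemma q_embed_0 [simp]: "q_embed 0 = 0" and q_embed_1 [simp]: "q_embed 1 = 1"
  using q_embed_const[of 0] q_embed_const[of 1] by (simp_all del: q_embed_const)

lemma q_embed_of_int [simp]: "q_embed (of_int k) = of_int k"
  using q_embed_const[of "of_int k"] by (simp add: const_of_int del: q_embed_const)

lemma q_embed_power [simp]: "q_embed (f ^ n) = q_embed f ^ n"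
  by (induction n) simp_all

lemma q_embed_prod [simp]: "q_embed (prod f S) = (\<Prod>s\<in>S. q_embed (f s))"
  by (induction S rule: infinite_finite_induct) simp_all

lemma q_embed_uminus [simp]: "q_embed (- f) = - q_embed f"
  using q_embed_add[of f "- f"] by (simp del: q_embed_add add: eq_neg_iff_add_eq_0 add.commute)

lemma eval_q_embed: "eval x (q_embed f) = eval (\<lambda>a. x (Some a)) f"
  by (induction f rule: mpol_induct) simp_all

section \<open>Partial derivatives and the logarithmic derivations\<close>

lemma partial_add: "partial v (f + g) = partial v f + partial v g"
  unfolding partial_def
  by (rule setsum_keys_plus_distrib) (simp_all add: single_add distrib_left)

lemma partial_single:
  "partial v (Poly_Mapping.single t c) =
     Poly_Mapping.single (t - Poly_Mapping.single v 1) (of_nat (Poly_Mapping.lookup t v) * c)"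
  by (cases "c = 0") (simp_all add: partial_def)

lemma exponent_add_diff:
  fixes t u :: "'v \<Rightarrow>\<^sub>0 nat"
  assumes "Poly_Mapping.lookup t v \<noteq> 0"
  shows "t - Poly_Mapping.single v 1 + u = t + u - Poly_Mapping.single v 1"
  using assms
  by (intro poly_mapping_eqI) (auto simp: lookup_add lookup_minus lookup_single when_def)

lemma partial_mult: "partial v (f * g) = f * partial v g + partial v f * g"
proof (induction f rule: mpol_monomial_induct)
  case (monomial t c)
  show ?case
  proof (induction g rule: mpol_monomial_induct)
    case (monomial u d)
    let ?w = "t + u - Poly_Mapping.single v 1"
    \<comment> \<open>Subtraction of exponents is truncated. If v does not occur in u, the two
      exponents may differ, but then the coefficient is 0.\<close>
    have 1: "Poly_Mapping.single (t + (u - Poly_Mapping.single v 1))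
            (c * (of_nat (Poly_Mapping.lookup u v) * d)) =
          Poly_Mapping.single ?w (c * (of_nat (Poly_Mapping.lookup u v) * d))"
      using exponent_add_diff[of u v t]
      by (cases "Poly_Mapping.lookup u v = 0") (simp_all add: add.commute)
    have 2: "Poly_Mapping.single (t - Poly_Mapping.single v 1 + u)
            (of_nat (Poly_Mapping.lookup t v) * c * d) =
          Poly_Mapping.single ?w (of_nat (Poly_Mapping.lookup t v) * c * d)"
      using exponent_add_diff[of t v u]
      by (cases "Poly_Mapping.lookup t v = 0") simp_all
    show ?case
      unfolding mult_single partial_single 1 2 single_add[symmetric]
      by (simp add: lookup_add algebra_simps)
  qed (simp add: distrib_left distrib_right partial_add add.commute add.left_commute)
qed (simp add: distrib_left distrib_right partial_add add.commute add.left_commute)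

lemma partial_const [simp]: "partial v (const c) = 0"
  by (simp add: const_def partial_single)

lemma partial_var: "partial v (var w) = (if v = w then 1 else 0)"
  by (simp add: var_def partial_single lookup_single when_def)

lemma log_der_add [simp]: "log_der v (f + g) = log_der v f + log_der v g"
  by (simp add: log_der_def partial_add distrib_left)

lemma log_der_mult: "log_der v (f * g) = f * log_der v g + log_der v f * g"
  by (simp add: log_der_def partial_mult algebra_simps)

lemma log_der_const [simp]: "log_der v (const c) = 0"
  by (simp add: log_der_def)

lemma log_der_var: "log_der v (var w) = (if v = w then log_weight v else 0)"
  by (simp add: log_der_def partial_var)

lemma log_der_0 [simp]: "log_der v 0 = 0" and log_der_1 [simp]: "log_der v 1 = 0"
  using log_der_const[of v 0] log_der_const[of v 1] by (simp_all del: log_der_const)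

lemma log_der_of_nat [simp]: "log_der v (of_nat n) = 0"
  and log_der_of_int [simp]: "log_der v (of_int k) = 0"
  using log_der_const[of v "of_nat n"] log_der_const[of v "of_int k"]
  by (simp_all add: const_of_nat const_of_int del: log_der_const)

lemma log_der_uminus [simp]: "log_der v (- f) = - log_der v f"
  using log_der_add[of v f "- f"] by (simp del: log_der_add add: eq_neg_iff_add_eq_0 add.commute)

lemma log_der_diff [simp]: "log_der v (f - g) = log_der v f - log_der v g"
  using log_der_add[of v f "- g"] by (simp del: log_der_add)

lemma log_der_sum: "log_der v (sum f S) = (\<Sum>s\<in>S. log_der v (f s))"
  by (induction S rule: infinite_finite_induct) simp_all

lemma log_der_commute:
  "log_der (Some a) (log_der (Some b) f) = log_der (Some b) (log_der (Some a) f)"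
proof (induction f rule: mpol_induct)
  case (var v)
  show ?case by (cases v) (auto simp: log_der_var log_der_mult)
qed (simp_all add: log_der_mult algebra_simps)

text \<open>The extra term arises from z^2 d_z applied to the factor z of the weight z q_a.\<close>

lemma log_der_None_commute:
  "log_der None (log_der (Some a) f) = log_der (Some a) (log_der None f) + zvar * log_der (Some a) f"
proof (induction f rule: mpol_induct)
  case (var v)
  show ?case by (cases v) (auto simp: log_der_var log_der_mult power2_eq_square algebra_simps)
qed (simp_all add: log_der_mult algebra_simps)

section \<open>Localization of modules over the polynomial ring\<close>

lemma zariski_open_basic: "zariski_open {x. eval x f \<noteq> 0}"
proof -
  have "- {x. eval x f \<noteq> 0} = {x. \<forall>g\<in>{f}. eval x g = 0}" by auto
  then show ?thesis unfolding zariski_open_def zariski_closed_def by blast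
qed

lemma zariski_open_Int:
  assumes "zariski_open V" "zariski_open W"
  shows "zariski_open (V \<inter> W)"
proof -
  obtain S T where S: "- V = {x. \<forall>f\<in>S. eval x f = 0}" and T: "- W = {x. \<forall>f\<in>T. eval x f = 0}"
    using assms unfolding zariski_open_def zariski_closed_def by auto
  have "- (V \<inter> W) = - V \<union> - W" by auto
  also have "\<dots> = {x. \<forall>f\<in>{g * h | g h. g \<in> S \<and> h \<in> T}. eval x f = 0}"
    unfolding S T
  proof (intro subset_antisym subsetI)
    fix x assume "x \<in> {x. \<forall>f\<in>{g * h | g h. g \<in> S \<and> h \<in> T}. eval x f = 0}"
    then have "eval x g * eval x h = 0" if "g \<in> S" "h \<in> T" for g h
      using that by (subst eval_mult[symmetric]) blast
    then show "x \<in> {x. \<forall>f\<in>S. eval x f = 0} \<union> {x. \<forall>f\<in>T. eval x f = 0}"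
      by auto
  qed auto
  finally show ?thesis unfolding zariski_open_def zariski_closed_def by blast
qed

lemma zariski_open_finite_INT:
  assumes "finite J" "zariski_open V" "\<And>j. j \<in> J \<Longrightarrow> zariski_open (W j)"
  shows "zariski_open (V \<inter> (\<Inter>j\<in>J. W j))"
  using assms
proof (induction J rule: finite_induct)
  case (insert j J)
  then have "zariski_open (W j \<inter> (V \<inter> (\<Inter>j\<in>J. W j)))"
    by (intro zariski_open_Int[of "W j"]) auto
  moreover have "W j \<inter> (V \<inter> (\<Inter>j\<in>J. W j)) = V \<inter> (\<Inter>j\<in>insert j J. W j)" by auto
  ultimately show ?case by simp
qed simp

text \<open>Operations on germs are defined as unions over all representatives; once the result does
  not depend on the representative, such a union collapses to it.\<close>

lemma UN_pair_const:
  assumes "(m, f) \<in> S" and "\<And>n g. (n, g) \<in> S \<Longrightarrow> T n g = C"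
  shows "(\<Union>(n, g)\<in>S. T n g) = C"
proof -
  have "(\<Union>(n, g)\<in>S. T n g) = (\<Union>p\<in>S. C)"
    by (rule SUP_cong) (auto simp: assms(2))
  then show ?thesis using assms(1) by auto
qed

text \<open>The scalars form a type and not the carrier of a ring record, so the module laws are
  stated directly for all polynomials.\<close>

locale mpol_module = abelian_group M for M :: "('v::finite mpol, 'b) module" (structure) +
  assumes smult_closed [simp, intro]: "m \<in> carrier M \<Longrightarrow> h \<odot> m \<in> carrier M"
    and smult_add_left: "m \<in> carrier M \<Longrightarrow> (f + g) \<odot> m = f \<odot> m \<oplus> g \<odot> m"
    and smult_add_right:
      "m \<in> carrier M \<Longrightarrow> n \<in> carrier M \<Longrightarrow> h \<odot> (m \<oplus> n) = h \<odot> m \<oplus> h \<odot> n"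
    and smult_assoc: "m \<in> carrier M \<Longrightarrow> f \<odot> (g \<odot> m) = (f * g) \<odot> m"
    and smult_1 [simp]: "m \<in> carrier M \<Longrightarrow> 1 \<odot> m = m"
begin

lemma smult_0 [simp]: "m \<in> carrier M \<Longrightarrow> 0 \<odot> m = \<zero>"
  using smult_add_left[of m 0 0] smult_closed[of m 0] by (simp add: add.l_cancel_one)

lemma smult_zero [simp]: "h \<odot> \<zero> = \<zero>"
proof -
  have "h \<odot> (0 \<odot> \<zero>) = \<zero>" by (subst smult_assoc) auto
  then show ?thesis by simp
qed

lemma smult_minus [simp]: "m \<in> carrier M \<Longrightarrow> (- h) \<odot> m = \<ominus> (h \<odot> m)"
  using smult_add_left[of m "- h" h] by (simp add: minus_equality)

lemma smult_finsum:
  "finite A \<Longrightarrow> (\<And>j. j \<in> A \<Longrightarrow> m j \<in> carrier M) \<Longrightarrow>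
     h \<odot> finsum M m A = finsum M (\<lambda>j. h \<odot> m j) A"
proof (induction A rule: finite_induct)
  case (insert a A)
  then have "m a \<in> carrier M" "m \<in> A \<rightarrow> carrier M" "(\<lambda>j. h \<odot> m j) \<in> A \<rightarrow> carrier M" by auto
  then show ?case using insert by (simp add: smult_add_right)
qed simp

lemma mem_germ: "m \<in> carrier M \<Longrightarrow> eval x f \<noteq> 0 \<Longrightarrow> (m, f) \<in> germ M x m f"
  unfolding germ_def by (auto intro!: exI[of _ 1])

lemma mem_germ_iff:
  "m \<in> carrier M \<Longrightarrow> (n, g) \<in> germ M x m f \<longleftrightarrow> n \<in> carrier M \<and> eval x g \<noteq> 0 \<and>
     (\<exists>h. eval x h \<noteq> 0 \<and> (h * g) \<odot> m = (h * f) \<odot> n)"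
  unfolding germ_def by (auto simp: smult_assoc)

lemma germ_sym:
  "m \<in> carrier M \<Longrightarrow> eval x f \<noteq> 0 \<Longrightarrow> (n, g) \<in> germ M x m f \<Longrightarrow> (m, f) \<in> germ M x n g"
  using mem_germ_iff[of m n g x f] mem_germ_iff[of n m f x g] by metis

text \<open>Transitivity of the equality of fractions. The witness h * h' * f contains the
  denominator f of the middle fraction, which must not vanish at x.\<close>

lemma germ_subset:
  assumes m: "m \<in> carrier M" and f: "eval x f \<noteq> 0" and n: "(n, g) \<in> germ M x m f"
  shows "germ M x m f \<subseteq> germ M x n g"
proof clarify
  fix k e assume "(k, e) \<in> germ M x m f"
  then obtain h' where k: "k \<in> carrier M" "eval x e \<noteq> 0" "eval x h' \<noteq> 0"
      "(h' * e) \<odot> m = (h' * f) \<odot> k"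
    using m by (auto simp: mem_germ_iff)
  obtain h where h: "n \<in> carrier M" "eval x g \<noteq> 0" "eval x h \<noteq> 0" "(h * g) \<odot> m = (h * f) \<odot> n"
    using m n by (auto simp: mem_germ_iff)
  have "(h * h' * f * e) \<odot> n = (h' * e) \<odot> ((h * f) \<odot> n)"
    using h by (simp add: smult_assoc ac_simps)
  also have "\<dots> = (h' * e) \<odot> ((h * g) \<odot> m)"
    using h by simp
  also have "\<dots> = (h * g) \<odot> ((h' * e) \<odot> m)"
    using m by (simp add: smult_assoc ac_simps)
  also have "\<dots> = (h * h' * f * g) \<odot> k"
    unfolding k(4) using k by (simp add: smult_assoc ac_simps)
  finally have "(h * h' * f * e) \<odot> n = (h * h' * f * g) \<odot> k" .
  then show "(k, e) \<in> germ M x n g"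
    using h k f by (subst mem_germ_iff) (auto intro!: exI[of _ "h * h' * f"])
qed

lemma germ_eq_if_mem:
  assumes "m \<in> carrier M" "eval x f \<noteq> 0" "(n, g) \<in> germ M x m f"
  shows "germ M x n g = germ M x m f"
proof -
  have "n \<in> carrier M" "eval x g \<noteq> 0" using assms by (auto simp: mem_germ_iff)
  then show ?thesis
    using germ_subset[OF assms] germ_subset[OF _ _ germ_sym[OF assms]] by blast
qed

lemma germ_eq_iff:
  assumes "m \<in> carrier M" "n \<in> carrier M" "eval x f \<noteq> 0" "eval x g \<noteq> 0"
  shows "germ M x m f = germ M x n g \<longleftrightarrow>
    (\<exists>h. eval x h \<noteq> 0 \<and> (h * g) \<odot> m = (h * f) \<odot> n)"
  using assms germ_eq_if_mem[of m x f n g] mem_germ[of n x g]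
  by (metis (no_types, lifting) mem_germ_iff)

lemma germ_cancel:
  assumes "m \<in> carrier M" "eval x f \<noteq> 0" "eval x e \<noteq> 0"
  shows "germ M x (e \<odot> m) (e * f) = germ M x m f"
  using assms by (subst germ_eq_iff) (auto simp: smult_assoc ac_simps intro!: exI[of _ 1])

section \<open>Stalks and their operations\<close>

lemma stalk_carrierE:
  assumes "s \<in> carrier (stalk M x)"
  obtains m f where "m \<in> carrier M" "eval x f \<noteq> 0" "s = germ M x m f"
  using assms by (auto simp: stalk_def)

lemma germ_in_stalk [simp, intro]:
  "m \<in> carrier M \<Longrightarrow> eval x f \<noteq> 0 \<Longrightarrow> germ M x m f \<in> carrier (stalk M x)"
  by (auto simp: stalk_def)

lemma stalk_zero: "\<zero>\<^bsub>stalk M x\<^esub> = germ M x \<zero> 1"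
  by (simp add: stalk_def)

lemma stalk_add:
  assumes m: "m \<in> carrier M" "eval x f \<noteq> 0" and n: "n \<in> carrier M" "eval x g \<noteq> 0"
  shows "germ M x m f \<oplus>\<^bsub>stalk M x\<^esub> germ M x n g = germ M x (g \<odot> m \<oplus> f \<odot> n) (f * g)"
proof -
  have *: "germ M x (g' \<odot> m' \<oplus> f' \<odot> n') (f' * g') = germ M x (g \<odot> m \<oplus> f \<odot> n) (f * g)"
    if m': "(m', f') \<in> germ M x m f" and n': "(n', g') \<in> germ M x n g" for m' f' n' g'
  proof -
    obtain h where h: "m' \<in> carrier M" "eval x f' \<noteq> 0" "eval x h \<noteq> 0"
        "(h * f') \<odot> m = (h * f) \<odot> m'"
      using m m' by (auto simp: mem_germ_iff)
    obtain k where k: "n' \<in> carrier M" "eval x g' \<noteq> 0" "eval x k \<noteq> 0"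
        "(k * g') \<odot> n = (k * g) \<odot> n'"
      using n n' by (auto simp: mem_germ_iff)
    have "(h * k * (f * g)) \<odot> (g' \<odot> m' \<oplus> f' \<odot> n') =
        (k * g * g') \<odot> ((h * f) \<odot> m') \<oplus> (h * f * f') \<odot> ((k * g) \<odot> n')"
      using h k by (simp add: smult_add_right smult_assoc ac_simps)
    also have "\<dots> = (k * g * g') \<odot> ((h * f') \<odot> m) \<oplus> (h * f * f') \<odot> ((k * g') \<odot> n)"
      using h k by simp
    also have "\<dots> = (h * k * (f' * g')) \<odot> (g \<odot> m \<oplus> f \<odot> n)"
      using m n by (simp add: smult_add_right smult_assoc ac_simps)
    finally have "(h * k * (f * g)) \<odot> (g' \<odot> m' \<oplus> f' \<odot> n') =
        (h * k * (f' * g')) \<odot> (g \<odot> m \<oplus> f \<odot> n)" .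
    then show ?thesis
      using h k m n by (subst germ_eq_iff) (auto intro!: exI[of _ "h * k"])
  qed
  have "germ M x m f \<oplus>\<^bsub>stalk M x\<^esub> germ M x n g =
      (\<Union>(m', f')\<in>germ M x m f. \<Union>(n', g')\<in>germ M x n g.
         germ M x (g' \<odot> m' \<oplus> f' \<odot> n') (f' * g'))"
    by (simp add: stalk_def)
  also have "\<dots> = germ M x (g \<odot> m \<oplus> f \<odot> n) (f * g)"
    by (intro UN_pair_const[OF mem_germ[OF m]] UN_pair_const[OF mem_germ[OF n]] *)
  finally show ?thesis .
qed

end

lemma mpol_module_poly_module: "mpol_module (poly_module :: ('v::finite mpol, 'v mpol) module)"
proof -
  have "abelian_group (poly_module :: ('v::finite mpol, 'v mpol) module)"
    by (rule abelian_groupI)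
       (auto simp: poly_module_def ac_simps intro: exI[of _ "- x" for x] simp: add_eq_0_iff)
  then show ?thesis
    by (simp add: mpol_module_def mpol_module_axioms_def)
       (simp add: poly_module_def algebra_simps)
qed

interpretation pm: mpol_module poly_module
  rewrites "carrier poly_module = UNIV"
    and "add poly_module = (+)" and "smult poly_module = (*)" and "zero poly_module = 0"
  by (rule mpol_module_poly_module) (simp_all add: poly_module_def)

lemma finsum_poly_module:
  fixes f :: "'c \<Rightarrow> 'v::finite mpol"
  shows "finite A \<Longrightarrow> finsum poly_module f A = sum f A"
proof (induction A rule: finite_induct)
  case empty
  have "finsum poly_module f {} = \<zero>\<^bsub>poly_module\<^esub>"
    by (rule abelian_monoid.finsum_empty[OF pm.abelian_monoid_axioms])
  then show ?case by (simp add: poly_module_def)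
next
  case (insert a A)
  then show ?case
    using abelian_monoid.finsum_insert[OF pm.abelian_monoid_axioms, of A a f]
    by (simp add: poly_module_def)
qed

context mpol_module
begin

lemma stalk_smult:
  assumes "eval x h \<noteq> 0" and m: "m \<in> carrier M" "eval x f \<noteq> 0"
  shows "germ poly_module x u h \<odot>\<^bsub>stalk M x\<^esub> germ M x m f = germ M x (u \<odot> m) (h * f)"
proof -
  have *: "germ M x (u' \<odot> m') (h' * f') = germ M x (u \<odot> m) (h * f)"
    if u': "(u', h') \<in> germ poly_module x u h" and m': "(m', f') \<in> germ M x m f" for u' h' m' f'
  proof -
    obtain k where k: "m' \<in> carrier M" "eval x f' \<noteq> 0" "eval x k \<noteq> 0"
        "(k * f') \<odot> m = (k * f) \<odot> m'"
      using m m' by (auto simp: mem_germ_iff)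
    obtain e where e: "eval x h' \<noteq> 0" "eval x e \<noteq> 0" "e * h' * u = e * h * u'"
      using u' by (auto simp: pm.mem_germ_iff)
    have "(e * k * (h * f)) \<odot> (u' \<odot> m') = (e * h * u') \<odot> ((k * f) \<odot> m')"
      using k by (simp add: smult_assoc ac_simps)
    also have "\<dots> = (e * h' * u) \<odot> ((k * f') \<odot> m)"
      using k e by simp
    also have "\<dots> = (e * k * (h' * f')) \<odot> (u \<odot> m)"
      using m by (simp add: smult_assoc ac_simps)
    finally have "(e * k * (h * f)) \<odot> (u' \<odot> m') = (e * k * (h' * f')) \<odot> (u \<odot> m)" .
    then show ?thesis
      using k e m assms(1) by (subst germ_eq_iff) (auto intro!: exI[of _ "e * k"])
  qed
  have "germ poly_module x u h \<odot>\<^bsub>stalk M x\<^esub> germ M x m f =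
      (\<Union>(u', h')\<in>germ poly_module x u h. \<Union>(m', f')\<in>germ M x m f. germ M x (u' \<odot> m') (h' * f'))"
    by (simp add: stalk_def)
  also have "\<dots> = germ M x (u \<odot> m) (h * f)"
    by (intro UN_pair_const[OF pm.mem_germ[OF UNIV_I assms(1)]] UN_pair_const[OF mem_germ[OF m]] *)
  finally show ?thesis .
qed

lemma abelian_monoid_stalk: "abelian_monoid (stalk M x)"
proof (rule abelian_monoidI)
  fix s t assume "s \<in> carrier (stalk M x)" "t \<in> carrier (stalk M x)"
  then obtain m f n g where
    m: "m \<in> carrier M" "eval x f \<noteq> 0" "s = germ M x m f" and
    n: "n \<in> carrier M" "eval x g \<noteq> 0" "t = germ M x n g"
    by (metis stalk_carrierE)
  show "s \<oplus>\<^bsub>stalk M x\<^esub> t \<in> carrier (stalk M x)" using m n by (simp add: stalk_add)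
  show "s \<oplus>\<^bsub>stalk M x\<^esub> t = t \<oplus>\<^bsub>stalk M x\<^esub> s"
    using m n by (simp add: stalk_add mult.commute a_comm)
  fix w assume "w \<in> carrier (stalk M x)"
  then obtain k e where k: "k \<in> carrier M" "eval x e \<noteq> 0" "w = germ M x k e"
    by (metis stalk_carrierE)
  show "s \<oplus>\<^bsub>stalk M x\<^esub> t \<oplus>\<^bsub>stalk M x\<^esub> w = s \<oplus>\<^bsub>stalk M x\<^esub> (t \<oplus>\<^bsub>stalk M x\<^esub> w)"
    using m n k by (simp add: stalk_add smult_add_right smult_assoc ac_simps a_assoc)
next
  show "\<zero>\<^bsub>stalk M x\<^esub> \<in> carrier (stalk M x)" by (simp add: stalk_zero)
  fix s assume "s \<in> carrier (stalk M x)"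
  then obtain m f where m: "m \<in> carrier M" "eval x f \<noteq> 0" "s = germ M x m f"
    by (metis stalk_carrierE)
  show "\<zero>\<^bsub>stalk M x\<^esub> \<oplus>\<^bsub>stalk M x\<^esub> s = s" using m by (simp add: stalk_zero stalk_add)
qed

lemma finsum_germ:
  assumes "finite A" "eval x e \<noteq> 0" "\<And>j. j \<in> A \<Longrightarrow> m j \<in> carrier M"
  shows "finsum (stalk M x) (\<lambda>j. germ M x (m j) e) A = germ M x (finsum M m A) e"
  using assms(1,3)
proof (induction A rule: finite_induct)
  case empty
  have "germ M x \<zero> 1 = germ M x \<zero> e"
    using assms(2) by (subst germ_eq_iff) (auto intro: exI[of _ 1])
  then show ?case
    by (simp add: stalk_zero abelian_monoid.finsum_empty[OF abelian_monoid_stalk])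
next
  case (insert a A)
  then have m: "m a \<in> carrier M" "m \<in> A \<rightarrow> carrier M" by auto
  have "finsum (stalk M x) (\<lambda>j. germ M x (m j) e) (insert a A) =
      germ M x (m a) e \<oplus>\<^bsub>stalk M x\<^esub> germ M x (finsum M m A) e"
    using insert assms(2)
    by (subst abelian_monoid.finsum_insert[OF abelian_monoid_stalk]) auto
  also have "\<dots> = germ M x (e \<odot> (m a \<oplus> finsum M m A)) (e * e)"
    using m assms(2) by (subst stalk_add) (auto simp: smult_add_right)
  also have "\<dots> = germ M x (m a \<oplus> finsum M m A) e"
    using m assms(2) by (intro germ_cancel) auto
  finally show ?case using insert m by simp
qed

section \<open>Sections given by a single fraction, and sheaves of finite type\<close>

lemma germ_section:
  assumes "zariski_open W" "m \<in> carrier M" "\<And>y. y \<in> W \<Longrightarrow> eval y f \<noteq> 0"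
  shows "(\<lambda>y\<in>W. germ M y m f) \<in> sections M W"
proof -
  have "\<exists>W' m' f'. zariski_open W' \<and> x \<in> W' \<and> W' \<subseteq> W \<and> m' \<in> carrier M \<and>
      (\<forall>y\<in>W'. eval y f' \<noteq> 0 \<and> (\<lambda>y\<in>W. germ M y m f) y = germ M y m' f')" if "x \<in> W" for x
    using assms that by (intro exI[of _ W] exI[of _ m] exI[of _ f]) simp
  then show ?thesis unfolding sections_def by auto
qed

text \<open>It is enough to express a multiple f m by the generators, where f is invertible at x and
  may depend on x and m: f is moved into the denominators of the coefficients.\<close>

lemma finite_type_onI:
  assumes X: "zariski_open X" and E: "finite E" "\<And>e. e \<in> E \<Longrightarrow> b e \<in> carrier M"
    and gen: "\<And>x m. x \<in> X \<Longrightarrow> m \<in> carrier M \<Longrightarrow>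
      \<exists>f r. eval x f \<noteq> 0 \<and> f \<odot> m = finsum M (\<lambda>e. r e \<odot> b e) E"
  shows "finite_type_on M X"
  unfolding finite_type_on_def
proof
  fix x assume "x \<in> X"
  obtain n where n: "bij_betw n {..<card E} E"
    using ex_bij_betw_nat_finite[OF E(1)] by (auto simp: atLeast0LessThan)
  have bM: "b (n j) \<in> carrier M" if "j < card E" for j
    using n E that by (auto simp: bij_betw_def)
  define s where "s j = (\<lambda>y\<in>X. germ M y (b (n j)) 1)" for j
  have sec: "\<forall>j<card E. s j \<in> sections M X"
    unfolding s_def using X bM by (auto intro: germ_section)
  have gen': "\<exists>c. (\<forall>j<card E. c j \<in> carrier (stalk poly_module y)) \<and>
      t = finsum (stalk M y) (\<lambda>j. c j \<odot>\<^bsub>stalk M y\<^esub> s j y) {..<card E}"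
    if y: "y \<in> X" and t: "t \<in> carrier (stalk M y)" for y t
  proof -
    obtain m g where m: "m \<in> carrier M" "eval y g \<noteq> 0" "t = germ M y m g"
      using t by (rule stalk_carrierE)
    obtain f r where f: "eval y f \<noteq> 0" "f \<odot> m = finsum M (\<lambda>e. r e \<odot> b e) E"
      using gen[OF y m(1)] by blast
    define c where "c j = germ poly_module y (r (n j)) (f * g)" for j
    have "finsum (stalk M y) (\<lambda>j. c j \<odot>\<^bsub>stalk M y\<^esub> s j y) {..<card E} =
        finsum (stalk M y) (\<lambda>j. germ M y (r (n j) \<odot> b (n j)) (f * g)) {..<card E}"
      using y f m bM
      by (intro abelian_monoid.finsum_cong'[OF abelian_monoid_stalk] refl)
         (auto simp: c_def s_def stalk_smult)
    also have "\<dots> = germ M y (finsum M (\<lambda>j. r (n j) \<odot> b (n j)) {..<card E}) (f * g)"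
      using f m bM by (intro finsum_germ) auto
    also have "finsum M (\<lambda>j. r (n j) \<odot> b (n j)) {..<card E} = finsum M (\<lambda>e. r e \<odot> b e) E"
    proof -
      have "(\<lambda>e. r e \<odot> b e) \<in> n ` {..<card E} \<rightarrow> carrier M" using bM by auto
      from finsum_reindex[OF this] show ?thesis using n by (simp add: bij_betw_def)
    qed
    also have "\<dots> = f \<odot> m" using f by simp
    also have "germ M y (f \<odot> m) (f * g) = t" using f(1) m by (simp add: germ_cancel)
    finally show ?thesis using f m by (intro exI[of _ c]) (auto simp: c_def)
  qed
  show "\<exists>W (k::nat) s. zariski_open W \<and> x \<in> W \<and> W \<subseteq> X \<and> (\<forall>j<k. s j \<in> sections M W) \<and>
     (\<forall>y\<in>W. \<forall>t\<in>carrier (stalk M y). \<exists>c.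
        (\<forall>j<k. c j \<in> carrier (stalk poly_module y)) \<and>
        t = finsum (stalk M y) (\<lambda>j. c j \<odot>\<^bsub>stalk M y\<^esub> s j y) {..<k})"
    using X \<open>x \<in> X\<close> sec gen' by (intro exI[of _ X] exI[of _ "card E"] exI[of _ s]) blast
qed

end

section \<open>The polynomial ring is Noetherian\<close>

locale scalar_module = Modules.module scale
  for scale :: "'a::comm_ring_1 \<Rightarrow> 'b::ab_group_add \<Rightarrow> 'b" (infixr "*\<^sub>m" 75)
begin

text \<open>Closure is only required under multiplication by a set of scalars generating a subring; so
  adjoining a variable to the ring amounts to inserting one scalar.\<close>

definition submod :: "'a set \<Rightarrow> 'b set \<Rightarrow> bool" where
  "submod G N \<longleftrightarrow> 0 \<in> N \<and> (\<forall>a\<in>N. \<forall>b\<in>N. a + b \<in> N) \<and> (\<forall>g\<in>G. \<forall>a\<in>N. g *\<^sub>m a \<in> N)"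

text \<open>Generation is phrased through minimality, because G need not be a ring and linear
  combinations with coefficients in G would not suffice.\<close>

definition fin_gen :: "'a set \<Rightarrow> 'b set \<Rightarrow> bool" where
  "fin_gen G N \<longleftrightarrow> (\<exists>B. finite B \<and> B \<subseteq> N \<and> (\<forall>Q. submod G Q \<and> B \<subseteq> Q \<longrightarrow> N \<subseteq> Q))"

definition noeth :: "'a set \<Rightarrow> 'b set \<Rightarrow> bool" where
  "noeth G N \<longleftrightarrow> (\<forall>P. submod G P \<and> P \<subseteq> N \<longrightarrow> fin_gen G P)"

text \<open>For a module N these are the values at x of polynomials of degree less than d with
  coefficients in N. Since x is a scalar and not a new variable, the coefficients need not be
  determined by the value.\<close>

primrec adjoin :: "'a \<Rightarrow> 'b set \<Rightarrow> nat \<Rightarrow> 'b set" where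
  "adjoin x N 0 = {0}"
| "adjoin x N (Suc d) = {x ^ d *\<^sub>m n + w | n w. n \<in> N \<and> w \<in> adjoin x N d}"

lemma submodD:
  assumes "submod G N"
  shows "0 \<in> N" and "a \<in> N \<Longrightarrow> b \<in> N \<Longrightarrow> a + b \<in> N" and "g \<in> G \<Longrightarrow> a \<in> N \<Longrightarrow> g *\<^sub>m a \<in> N"
  using assms by (auto simp: submod_def)

lemma fin_genE:
  assumes "fin_gen G N"
  obtains B where "finite B" "B \<subseteq> N" "\<forall>Q. submod G Q \<and> B \<subseteq> Q \<longrightarrow> N \<subseteq> Q"
  using assms unfolding fin_gen_def by metis

lemma submod_diff:
  assumes "submod G N" "- 1 \<in> G" "a \<in> N" "b \<in> N"
  shows "a - b \<in> N"
  using submodD(2)[OF assms(1), of a "- 1 *\<^sub>m b"] submodD(3)[OF assms(1), of "- 1" b] assms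
  by simp

lemma submod_adjoin:
  assumes "submod G N"
  shows "submod G (adjoin x N d)"
proof (induction d)
  case 0
  then show ?case by (simp add: submod_def)
next
  case (Suc d)
  show ?case
    unfolding submod_def
  proof (intro conjI ballI)
    show "0 \<in> adjoin x N (Suc d)"
      using submodD(1)[OF assms] submodD(1)[OF Suc] by (auto intro!: exI[of _ 0])
  next
    fix a b assume "a \<in> adjoin x N (Suc d)" "b \<in> adjoin x N (Suc d)"
    then obtain n w n' w' where *: "a = x ^ d *\<^sub>m n + w" "b = x ^ d *\<^sub>m n' + w'"
        "n \<in> N" "n' \<in> N" "w \<in> adjoin x N d" "w' \<in> adjoin x N d"
      by auto
    have "a + b = x ^ d *\<^sub>m (n + n') + (w + w')"
      unfolding * by (simp add: scale_right_distrib algebra_simps)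
    then show "a + b \<in> adjoin x N (Suc d)"
      using submodD(2)[OF assms *(3,4)] submodD(2)[OF Suc *(5,6)] unfolding adjoin.simps by blast
  next
    fix g a assume g: "g \<in> G" and "a \<in> adjoin x N (Suc d)"
    then obtain n w where *: "a = x ^ d *\<^sub>m n + w" "n \<in> N" "w \<in> adjoin x N d"
      by auto
    have "g *\<^sub>m a = x ^ d *\<^sub>m (g *\<^sub>m n) + g *\<^sub>m w"
      unfolding * by (simp add: scale_right_distrib mult.commute)
    then show "g *\<^sub>m a \<in> adjoin x N (Suc d)"
      using submodD(3)[OF assms g *(2)] submodD(3)[OF Suc g *(3)] unfolding adjoin.simps by blast
  qed
qed

lemma adjoin_scale:
  assumes "submod G N" "a \<in> adjoin x N d"
  shows "x *\<^sub>m a \<in> adjoin x N (Suc d)"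
  using assms(2)
proof (induction d arbitrary: a)
  case 0
  then show ?case
    using submodD(1)[OF submod_adjoin[OF assms(1)], of x "Suc 0"] by simp
next
  case (Suc d)
  then obtain n w where *: "a = x ^ d *\<^sub>m n + w" "n \<in> N" "w \<in> adjoin x N d"
    by auto
  have "x *\<^sub>m a = x ^ Suc d *\<^sub>m n + x *\<^sub>m w"
    unfolding * by (simp add: scale_right_distrib)
  then show ?case using * Suc.IH[OF *(3)] by (subst adjoin.simps) blast
qed

lemma adjoin_scale_power:
  assumes "submod G N" "a \<in> adjoin x N d"
  shows "x ^ k *\<^sub>m a \<in> adjoin x N (k + d)"
  using adjoin_scale[OF assms(1)] assms(2) by (induction k) (auto simp flip: scale_scale)

lemma adjoin_Suc:
  assumes "submod G N"
  shows "adjoin x N d \<subseteq> adjoin x N (Suc d)"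
proof
  fix w assume "w \<in> adjoin x N d"
  moreover have "w = x ^ d *\<^sub>m 0 + w" by simp
  ultimately show "w \<in> adjoin x N (Suc d)"
    using submodD(1)[OF assms] unfolding adjoin.simps by blast
qed

lemma adjoin_mono:
  assumes "submod G N" "d \<le> e"
  shows "adjoin x N d \<subseteq> adjoin x N e"
  using assms(2) by (rule lift_Suc_mono_le[of "adjoin x N", OF adjoin_Suc[OF assms(1)]])

lemma submod_adjoin_all:
  assumes "submod G N"
  shows "submod (insert x G) (\<Union>d. adjoin x N d)"
  unfolding submod_def
proof (intro conjI ballI)
  show "0 \<in> (\<Union>d. adjoin x N d)" by (auto intro: exI[of _ 0])
  fix a b assume "a \<in> (\<Union>d. adjoin x N d)" "b \<in> (\<Union>d. adjoin x N d)"
  then obtain d e where "a \<in> adjoin x N d" "b \<in> adjoin x N e" by auto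
  then have "a \<in> adjoin x N (max d e)" "b \<in> adjoin x N (max d e)"
    using adjoin_mono[OF assms] by (meson max.cobounded1 max.cobounded2 subsetD)+
  then show "a + b \<in> (\<Union>d. adjoin x N d)"
    using submodD(2)[OF submod_adjoin[OF assms]] by blast
next
  fix g a assume g: "g \<in> insert x G" and "a \<in> (\<Union>d. adjoin x N d)"
  then obtain d where a: "a \<in> adjoin x N d" by auto
  show "g *\<^sub>m a \<in> (\<Union>d. adjoin x N d)"
    using g adjoin_scale[OF assms a] submodD(3)[OF submod_adjoin[OF assms] _ a] by blast
qed

lemma submod_subset: "submod G N \<Longrightarrow> H \<subseteq> G \<Longrightarrow> submod H N"
  by (auto simp: submod_def)

text \<open>These n are the possible coefficients of x ^ d in elements of P of degree at most d; as
  coefficients are not unique, only the existence of a lower part w is demanded.\<close>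

lemma submod_leading:
  assumes N: "submod G N" and P: "submod G P"
  shows "submod G {n \<in> N. \<exists>w\<in>adjoin x N d. x ^ d *\<^sub>m n + w \<in> P}"
  unfolding submod_def
proof (intro conjI ballI)
  show "0 \<in> {n \<in> N. \<exists>w\<in>adjoin x N d. x ^ d *\<^sub>m n + w \<in> P}"
    using submodD(1)[OF N] submodD(1)[OF P] submodD(1)[OF submod_adjoin[OF N]]
    by (auto intro!: bexI[of _ 0])
next
  fix a b assume "a \<in> {n \<in> N. \<exists>w\<in>adjoin x N d. x ^ d *\<^sub>m n + w \<in> P}"
    "b \<in> {n \<in> N. \<exists>w\<in>adjoin x N d. x ^ d *\<^sub>m n + w \<in> P}"
  then obtain v w where *: "a \<in> N" "b \<in> N" "v \<in> adjoin x N d" "w \<in> adjoin x N d"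
      "x ^ d *\<^sub>m a + v \<in> P" "x ^ d *\<^sub>m b + w \<in> P"
    by auto
  have "x ^ d *\<^sub>m (a + b) + (v + w) \<in> P"
    using submodD(2)[OF P *(5,6)] by (simp add: scale_right_distrib algebra_simps)
  then show "a + b \<in> {n \<in> N. \<exists>w\<in>adjoin x N d. x ^ d *\<^sub>m n + w \<in> P}"
    using * submodD(2)[OF N] submodD(2)[OF submod_adjoin[OF N]] by blast
next
  fix g a assume g: "g \<in> G" and "a \<in> {n \<in> N. \<exists>w\<in>adjoin x N d. x ^ d *\<^sub>m n + w \<in> P}"
  then obtain v where *: "a \<in> N" "v \<in> adjoin x N d" "x ^ d *\<^sub>m a + v \<in> P"
    by auto
  have "x ^ d *\<^sub>m (g *\<^sub>m a) + g *\<^sub>m v \<in> P"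
    using submodD(3)[OF P g *(3)] by (simp add: scale_right_distrib mult.commute)
  then show "g *\<^sub>m a \<in> {n \<in> N. \<exists>w\<in>adjoin x N d. x ^ d *\<^sub>m n + w \<in> P}"
    using * g submodD(3)[OF N] submodD(3)[OF submod_adjoin[OF N]] by blast
qed

text \<open>Hilbert's basis theorem: the modules of leading coefficients of degree \<open>d\<close> increase with \<open>d\<close>,
  so finitely many of them suffice to reduce degrees.\<close>

lemma noeth_adjoin:
  assumes G: "- 1 \<in> G" and N: "submod G N" and noeth: "noeth G N"
  shows "noeth (insert x G) (\<Union>d. adjoin x N d)"
  unfolding noeth_def
proof (intro allI impI, elim conjE)
  fix P assume P: "submod (insert x G) P" and PN: "P \<subseteq> (\<Union>d. adjoin x N d)"
  have PG: "submod G P" using P by (rule submod_subset) auto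
  \<comment> \<open>L is defined for all Q because finite generation is tested against arbitrary
    submodules Q, which have to be shown to have all leading coefficients of P.\<close>
  define L where "L Q d = {n \<in> N. \<exists>w\<in>adjoin x N d. x ^ d *\<^sub>m n + w \<in> Q}" for Q d
  have L_shift: "L Q d \<subseteq> L Q (k + d)" if Q: "submod (insert x G) Q" for Q d k
  proof
    fix n assume "n \<in> L Q d"
    then obtain w where w: "n \<in> N" "w \<in> adjoin x N d" "x ^ d *\<^sub>m n + w \<in> Q"
      by (auto simp: L_def)
    have "x ^ k *\<^sub>m (x ^ d *\<^sub>m n + w) \<in> Q"
      using w(3) submodD(3)[OF Q] by (induction k) (auto simp flip: scale_scale)
    then have "x ^ (k + d) *\<^sub>m n + x ^ k *\<^sub>m w \<in> Q"
      by (simp add: scale_right_distrib power_add)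
    then show "n \<in> L Q (k + d)"
      using w adjoin_scale_power[OF N] by (auto simp: L_def)
  qed
  have L_mono: "L P d \<subseteq> L P e" if "d \<le> e" for d e
    using L_shift[OF P, of d "e - d"] that by simp
  have L_submod: "submod G (L Q d)" if "submod G Q" for Q d
    unfolding L_def using N that by (rule submod_leading)
  have "submod G (\<Union>d. L P d)"
    unfolding submod_def
  proof (intro conjI ballI)
    show "0 \<in> (\<Union>d. L P d)" using submodD(1)[OF L_submod[OF PG]] by blast
    fix a b assume "a \<in> (\<Union>d. L P d)" "b \<in> (\<Union>d. L P d)"
    then obtain d e where "a \<in> L P d" "b \<in> L P e" by auto
    then have "a \<in> L P (max d e)" "b \<in> L P (max d e)"
      using L_mono by (meson max.cobounded1 max.cobounded2 subsetD)+
    then show "a + b \<in> (\<Union>d. L P d)" using submodD(2)[OF L_submod[OF PG]] by blast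
  next
    fix g a assume "g \<in> G" "a \<in> (\<Union>d. L P d)"
    then show "g *\<^sub>m a \<in> (\<Union>d. L P d)" using submodD(3)[OF L_submod[OF PG]] by blast
  qed
  moreover have "(\<Union>d. L P d) \<subseteq> N" by (auto simp: L_def)
  ultimately have "fin_gen G (\<Union>d. L P d)" using noeth by (simp add: noeth_def)
  then obtain B where B: "finite B" "B \<subseteq> (\<Union>d. L P d)"
      "\<forall>Q. submod G Q \<and> B \<subseteq> Q \<longrightarrow> (\<Union>d. L P d) \<subseteq> Q"
    by (rule fin_genE)
  \<comment> \<open>The modules L P d increase with d, so the finitely many generators of their
    union already lie in one of them.\<close>
  have "\<exists>D. B \<subseteq> L P D"
    using B(1,2)
  proof (induction B rule: finite_induct)
    case (insert b B)
    then obtain D e where "B \<subseteq> L P D" "b \<in> L P e" by auto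
    then have "insert b B \<subseteq> L P (max D e)"
      using L_mono by (meson insert_subset max.cobounded1 max.cobounded2 order_trans subsetD)
    then show ?case by blast
  qed auto
  then obtain D where D: "(\<Union>d. L P d) \<subseteq> L P D" using B(3) L_submod[OF PG] by blast
  \<comment> \<open>Generators of the leading coefficients in degree d are lifted to elements of P;
    a submodule containing the lifts has all leading coefficients of P in degree d.\<close>
  have "\<exists>C. finite C \<and> C \<subseteq> P \<and> (\<forall>Q. submod G Q \<and> C \<subseteq> Q \<longrightarrow> L P d \<subseteq> L Q d)" for d
  proof -
    have "fin_gen G (L P d)"
      using noeth L_submod[OF PG] unfolding noeth_def L_def by blast
    then obtain B where B: "finite B" "B \<subseteq> L P d" "\<forall>Q. submod G Q \<and> B \<subseteq> Q \<longrightarrow> L P d \<subseteq> Q"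
      by (rule fin_genE)
    have "\<forall>b\<in>B. \<exists>w. w \<in> adjoin x N d \<and> x ^ d *\<^sub>m b + w \<in> P"
      using B(2) by (auto simp: L_def)
    then obtain w where w: "\<And>b. b \<in> B \<Longrightarrow> w b \<in> adjoin x N d \<and> x ^ d *\<^sub>m b + w b \<in> P"
      by metis
    define C where "C = (\<lambda>b. x ^ d *\<^sub>m b + w b) ` B"
    have "L P d \<subseteq> L Q d" if Q: "submod G Q" "C \<subseteq> Q" for Q
    proof -
      have "b \<in> L Q d" if "b \<in> B" for b
      proof -
        have "x ^ d *\<^sub>m b + w b \<in> Q" using Q(2) that by (auto simp: C_def)
        then show ?thesis using w[OF that] B(2) that unfolding L_def by blast
      qed
      then show ?thesis using B(3)[rule_format, of "L Q d"] L_submod[OF Q(1)] by blast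
    qed
    then show ?thesis using B(1) w by (intro exI[of _ C]) (auto simp: C_def)
  qed
  then obtain C where C: "\<And>d. finite (C d)" "\<And>d. C d \<subseteq> P"
      "\<And>d Q. submod G Q \<Longrightarrow> C d \<subseteq> Q \<Longrightarrow> L P d \<subseteq> L Q d"
    by metis
  \<comment> \<open>Division with remainder: an element of Q with the same leading coefficient is
    subtracted, and the degree drops. The difference stays in P because Q lies in P.\<close>
  have "P \<inter> adjoin x N d \<subseteq> Q"
    if Q: "submod (insert x G) Q" "(\<Union>d\<le>D. C d) \<subseteq> Q" "Q \<subseteq> P" for Q d
  proof (induction d)
    case 0
    then show ?case using submodD(1)[OF Q(1)] by auto
  next
    case (Suc d)
    have QG: "submod G Q" using Q(1) by (rule submod_subset) auto
    show ?case
    proof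
      fix a assume a: "a \<in> P \<inter> adjoin x N (Suc d)"
      then obtain n w where n: "a = x ^ d *\<^sub>m n + w" "n \<in> N" "w \<in> adjoin x N d" by auto
      then have nL: "n \<in> L P d" using a by (auto simp: L_def)
      have "n \<in> L Q d"
      proof (cases "d \<le> D")
        case True
        then show ?thesis using C(3)[OF QG, of d] Q(2) nL by blast
      next
        case False
        \<comment> \<open>Above degree D an element of Q with leading coefficient n is taken in
          degree D and multiplied by x ^ (d - D).\<close>
        have "n \<in> L Q D" using C(3)[OF QG, of D] Q(2) D nL by blast
        then show ?thesis using L_shift[OF Q(1), of D "d - D"] False by auto
      qed
      then obtain v where v: "v \<in> adjoin x N d" "x ^ d *\<^sub>m n + v \<in> Q" by (auto simp: L_def)
      have "w - v \<in> P"
        using submod_diff[OF PG G, of a "x ^ d *\<^sub>m n + v"] a v(2) Q(3) n(1) by auto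
      moreover have "w - v \<in> adjoin x N d"
        using submod_diff[OF submod_adjoin[OF N] G] n(3) v(1) by blast
      ultimately have "w - v \<in> Q" using Suc.IH by blast
      then have "(x ^ d *\<^sub>m n + v) + (w - v) \<in> Q" using submodD(2)[OF QG v(2)] by blast
      then show "a \<in> Q" using n(1) by simp
    qed
  qed
  note reduce = this
  have "P \<subseteq> Q" if Q: "submod (insert x G) Q" "(\<Union>d\<le>D. C d) \<subseteq> Q" for Q
  proof -
    \<comment> \<open>The division requires a submodule of P, so it is applied to the
      intersection.\<close>
    have "submod (insert x G) (P \<inter> Q)" using P Q(1) by (auto simp: submod_def)
    moreover have "(\<Union>d\<le>D. C d) \<subseteq> P \<inter> Q" using C(2) Q(2) by auto
    ultimately have "P \<inter> adjoin x N d \<subseteq> P \<inter> Q" for d by (intro reduce) auto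
    then show ?thesis using PN by fast
  qed
  then show "fin_gen (insert x G) P"
    unfolding fin_gen_def
  proof (intro exI conjI)
    show "finite (\<Union>d\<le>D. C d)" using C(1) by blast
    show "(\<Union>d\<le>D. C d) \<subseteq> P" using C(2) by blast
  qed blast
qed

end

text \<open>Vectors with \<open>k\<close> entries are represented by univariate polynomials of degree less than \<open>k\<close>.\<close>

interpretation vec: scalar_module "Polynomial.smult :: 'a::comm_ring_1 \<Rightarrow> 'a poly \<Rightarrow> 'a poly"
  by unfold_locales (simp_all add: smult_add_right smult_add_left)

text \<open>Linear algebra over the complex numbers, by induction on the number of entries: besides
  generators of the vectors with last entry 0, one vector b with nonzero last entry
  suffices.\<close>

lemma noeth_const:
  "vec.noeth (range const) {p :: 'v mpol poly. (\<forall>j. coeff p j \<in> range const) \<and> (\<forall>j\<ge>k. coeff p j = 0)}"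
proof (induction k)
  case 0
  have "{p :: 'v mpol poly. (\<forall>j. coeff p j \<in> range const) \<and> (\<forall>j\<ge>0. coeff p j = 0)} \<subseteq> {0}"
    by (auto intro!: poly_eqI)
  then show ?case
    unfolding vec.noeth_def vec.fin_gen_def
    by (intro allI impI exI[of _ "{}"] conjI) (auto dest: vec.submodD(1))
next
  case (Suc k)
  show ?case
    unfolding vec.noeth_def
  proof (intro allI impI, elim conjE)
    fix P :: "'v mpol poly set"
    assume P: "vec.submod (range const) P"
      and sub: "P \<subseteq> {p. (\<forall>j. coeff p j \<in> range const) \<and> (\<forall>j\<ge>Suc k. coeff p j = 0)}"
    let ?P = "P \<inter> {p. (\<forall>j. coeff p j \<in> range const) \<and> (\<forall>j\<ge>k. coeff p j = 0)}"
    have "?P = P \<inter> {p. coeff p k = 0}"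
    proof -
      have "\<forall>j\<ge>k. coeff p j = 0" if "p \<in> P" "coeff p k = 0" for p
      proof (intro allI impI)
        fix j assume "k \<le> j"
        then show "coeff p j = 0" using that sub by (cases "j = k") auto
      qed
      then show ?thesis using sub by blast
    qed
    moreover have "vec.submod (range const) (P \<inter> {p. coeff p k = 0})"
      using P by (auto simp: vec.submod_def)
    ultimately have "vec.submod (range const) ?P" by simp
    then have "vec.fin_gen (range const) ?P" using Suc.IH by (simp add: vec.noeth_def)
    then obtain B where B: "finite B" "B \<subseteq> ?P"
        "\<forall>Q. vec.submod (range const) Q \<and> B \<subseteq> Q \<longrightarrow> ?P \<subseteq> Q"
      by (rule vec.fin_genE)
    note P_eq = \<open>?P = P \<inter> {p. coeff p k = 0}\<close>
    show "vec.fin_gen (range const) P"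
    proof (cases "P \<subseteq> ?P")
      case True
      then show ?thesis using B unfolding vec.fin_gen_def by (intro exI[of _ B]) blast
    next
      case False
      then obtain b where b: "b \<in> P" "coeff b k \<noteq> 0" using P_eq by auto
      have "coeff b k \<in> range const" using b(1) sub by blast
      then obtain c where c: "coeff b k = const c" by blast
      have "c \<noteq> 0" using b(2) c by auto
      then have inv: "const (1 / c) * const c = (1 :: 'v mpol)"
        by (simp flip: poly_const.mult)
      have "P \<subseteq> Q" if Q: "vec.submod (range const) Q" "insert b B \<subseteq> Q" for Q
      proof
        fix p assume p: "p \<in> P"
        then have "coeff p k \<in> range const" using sub by blast
        then obtain d where d: "coeff p k = const d" by blast
        have m1: "- 1 \<in> (range const :: 'v mpol set)"
          by (rule range_eqI[of _ _ "- 1"]) (simp add: const_def single_uminus)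
        \<comment> \<open>The multiple of b whose last entry agrees with that of p.\<close>
        let ?b = "Polynomial.smult (const d) (Polynomial.smult (const (1 / c)) b)"
        have "?b \<in> P" using vec.submodD(3)[OF P] b(1) by blast
        then have "p - ?b \<in> P" using vec.submod_diff[OF P m1 p] by blast
        moreover have "coeff (p - ?b) k = 0"
          using c d inv by (simp add: mult.assoc)
        ultimately have "p - ?b \<in> Q" using B(3)[rule_format, of Q] Q P_eq by blast
        moreover have "?b \<in> Q" using vec.submodD(3)[OF Q(1)] Q(2) by blast
        ultimately have "p - ?b + ?b \<in> Q" using vec.submodD(2)[OF Q(1)] by blast
        then show "p \<in> Q" by simp
      qed
      then show ?thesis
        unfolding vec.fin_gen_def using B(1,2) b(1) by (intro exI[of _ "insert b B"]) auto
    qed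
  qed
qed

text \<open>Constants and variables generate the polynomial ring, so closure under them already
  gives closure under all scalars.\<close>

lemma submod_UNIV_if_vars:
  fixes N :: "'v mpol poly set"
  assumes "vec.submod (range const \<union> range var) N"
  shows "vec.submod UNIV N"
proof -
  have "\<forall>a\<in>N. Polynomial.smult h a \<in> N" for h
  proof (induction h rule: mpol_induct)
    case (const c)
    then show ?case using vec.submodD(3)[OF assms] by blast
  next
    case (var v)
    then show ?case using vec.submodD(3)[OF assms] by blast
  next
    case (add f g)
    then show ?case using vec.submodD(2)[OF assms] by (auto simp: smult_add_left)
  next
    case (mult f g)
    then show ?case by (metis smult_smult)
  qed
  then show ?thesis using assms by (auto simp: vec.submod_def)
qed

text \<open>The basis theorem is applied once for each variable, starting from vectors with constant
  entries. The standard basis vectors are carried along, so that the final module contains all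
  vectors with k entries.\<close>

lemma submodule_finitely_generated:
  fixes P :: "'v::finite mpol poly set"
  assumes P: "vec.subspace P" and k: "\<And>p j. p \<in> P \<Longrightarrow> j \<ge> k \<Longrightarrow> coeff p j = 0"
  obtains B where "finite B" "P = vec.span B"
proof -
  have m1: "- 1 \<in> (range const :: 'v mpol set)"
    by (rule range_eqI[of _ _ "- 1"]) (simp add: const_def single_uminus)
  have "\<exists>N. vec.submod (range const \<union> var ` S) N \<and> vec.noeth (range const \<union> var ` S) N \<and>
      (\<forall>j<k. monom 1 j \<in> N)" for S :: "'v set"
  proof (induction S rule: finite_induct[OF finite])
    case 1
    let ?N = "{p :: 'v mpol poly. (\<forall>j. coeff p j \<in> range const) \<and> (\<forall>j\<ge>k. coeff p j = 0)}"
    have "0 \<in> (range const :: 'v mpol set)" by (metis const_0 rangeI)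
    moreover have "1 \<in> (range const :: 'v mpol set)" by (metis const_1 rangeI)
    moreover have "f + g \<in> range const" "f * g \<in> range const"
      if "f \<in> range const" "g \<in> range const" for f g :: "'v mpol"
      using that by (auto simp flip: poly_const.add poly_const.mult)
    ultimately have "vec.submod (range const) ?N" "\<forall>j<k. monom 1 j \<in> ?N"
      by (auto simp: vec.submod_def)
    then show ?case using noeth_const[where 'v='v, of k] by auto
  next
    case (2 v S)
    then obtain N where N: "vec.submod (range const \<union> var ` S) N"
        "vec.noeth (range const \<union> var ` S) N" "\<forall>j<k. monom 1 j \<in> N"
      by blast
    have "monom 1 j \<in> vec.adjoin (var v) N (Suc 0)" if "j < k" for j
      using N(3) that by auto
    then have "\<forall>j<k. monom 1 j \<in> (\<Union>d. vec.adjoin (var v) N d)" by blast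
    moreover have "range const \<union> var ` insert v S = insert (var v) (range const \<union> var ` S)"
      by auto
    ultimately show ?case
      using vec.submod_adjoin_all[OF N(1), of "var v"]
        vec.noeth_adjoin[OF _ N(1,2), of "var v"] m1 by auto
  qed
  from this[of UNIV] obtain N :: "'v mpol poly set" where N: "vec.submod (range const \<union> range var) N"
      "vec.noeth (range const \<union> range var) N" "\<forall>j<k. monom 1 j \<in> N"
    by metis
  have NU: "vec.submod UNIV N" using submod_UNIV_if_vars[OF N(1)] .
  have "p \<in> N" if "p \<in> P" for p
  proof -
    have "p = (\<Sum>j<k. Polynomial.smult (coeff p j) (monom 1 j))"
      using k[OF that]
      by (intro poly_eqI) (auto simp: coeff_sum if_distrib[of "(*) _"] not_less cong: if_cong)
    also have "\<dots> \<in> N"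
    proof -
      have "(\<Sum>j\<in>J. Polynomial.smult (coeff p j) (monom 1 j)) \<in> N" if "finite J" "J \<subseteq> {..<k}" for J
        using that vec.submodD[OF NU] N(3) by (induction J rule: finite_induct) auto
      then show ?thesis by blast
    qed
    finally show ?thesis .
  qed
  moreover have "vec.submod (range const \<union> range var) P"
    using P by (auto simp: vec.submod_def vec.subspace_def)
  ultimately have "vec.fin_gen (range const \<union> range var) P"
    using N(2) unfolding vec.noeth_def by blast
  then obtain B where B: "finite B" "B \<subseteq> P"
      "\<forall>Q. vec.submod (range const \<union> range var) Q \<and> B \<subseteq> Q \<longrightarrow> P \<subseteq> Q"
    by (rule vec.fin_genE)
  have "vec.submod (range const \<union> range var) (vec.span B)"
    using vec.subspace_span[of B] by (auto simp: vec.submod_def vec.subspace_def)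
  then have "P \<subseteq> vec.span B" using B(3) vec.span_superset by blast
  moreover have "vec.span B \<subseteq> P" using B(2) P by (rule vec.span_minimal)
  ultimately show ?thesis using that B(1) by blast
qed

section \<open>Coherence and logarithmic connections\<close>

context mpol_module
begin

lemma section_local:
  assumes "s \<in> sections M V" "x \<in> V"
  obtains W m f where "zariski_open W" "x \<in> W" "W \<subseteq> V" "m \<in> carrier M"
    "\<And>y. y \<in> W \<Longrightarrow> eval y f \<noteq> 0" "\<And>y. y \<in> W \<Longrightarrow> s y = germ M y m f"
  using assms unfolding sections_def by blast

lemma sections_local:
  assumes V: "zariski_open V" "x \<in> V" and s: "\<forall>j<k::nat. s j \<in> sections M V"
  obtains W m f where "zariski_open W" "x \<in> W" "W \<subseteq> V"
    "\<forall>j<k. m j \<in> carrier M \<and> (\<forall>y\<in>W. eval y (f j) \<noteq> 0 \<and> s j y = germ M y (m j) (f j))"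
proof -
  have "\<forall>j\<in>{..<k}. \<exists>W m f. zariski_open W \<and> x \<in> W \<and> W \<subseteq> V \<and> m \<in> carrier M \<and>
      (\<forall>y\<in>W. eval y f \<noteq> 0 \<and> s j y = germ M y m f)"
    using s V(2) unfolding sections_def by blast
  then obtain W m f where *: "\<forall>j\<in>{..<k}. zariski_open (W j) \<and> x \<in> W j \<and> W j \<subseteq> V \<and>
      m j \<in> carrier M \<and> (\<forall>y\<in>W j. eval y (f j) \<noteq> 0 \<and> s j y = germ M y (m j) (f j))"
    unfolding bchoice_iff by blast
  show ?thesis
    by (rule that[of "V \<inter> (\<Inter>j\<in>{..<k}. W j)" m f], rule zariski_open_finite_INT)
       (use * V in auto)
qed

lemma finsum_lessThan_smult_add:
  assumes "\<And>j. j < k \<Longrightarrow> m j \<in> carrier M"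
  shows "finsum M (\<lambda>j. (r j + r' j) \<odot> m j) {..<k::nat} =
    finsum M (\<lambda>j. r j \<odot> m j) {..<k} \<oplus> finsum M (\<lambda>j. r' j \<odot> m j) {..<k}"
proof -
  have "finsum M (\<lambda>j. (r j + r' j) \<odot> m j) {..<k} = finsum M (\<lambda>j. r j \<odot> m j \<oplus> r' j \<odot> m j) {..<k}"
    using assms by (intro finsum_cong') (auto simp: smult_add_left)
  also have "\<dots> = finsum M (\<lambda>j. r j \<odot> m j) {..<k} \<oplus> finsum M (\<lambda>j. r' j \<odot> m j) {..<k}"
    using assms by (intro finsum_addf) auto
  finally show ?thesis .
qed

lemma finsum_lessThan_smult_mult:
  assumes "\<And>j. j < k \<Longrightarrow> m j \<in> carrier M"
  shows "finsum M (\<lambda>j. (h * r j) \<odot> m j) {..<k::nat} = h \<odot> finsum M (\<lambda>j. r j \<odot> m j) {..<k}"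
proof -
  have "finsum M (\<lambda>j. (h * r j) \<odot> m j) {..<k} = finsum M (\<lambda>j. h \<odot> (r j \<odot> m j)) {..<k}"
    using assms by (intro finsum_cong') (auto simp: smult_assoc)
  also have "\<dots> = h \<odot> finsum M (\<lambda>j. r j \<odot> m j) {..<k}"
    using assms by (intro smult_finsum[symmetric]) auto
  finally show ?thesis .
qed

text \<open>The relations form a submodule of a free module of rank k; a relation r is encoded as
  the univariate polynomial with coefficients r j.\<close>

lemma relation_module_finitely_generated:
  assumes m: "\<And>j. j < k \<Longrightarrow> m j \<in> carrier M"
  obtains e :: nat and R where
    "\<forall>i<e. finsum M (\<lambda>j. R i j \<odot> m j) {..<k::nat} = \<zero>"
    "\<forall>r. finsum M (\<lambda>j. r j \<odot> m j) {..<k} = \<zero> \<longrightarrow> (\<exists>d. \<forall>j<k. r j = (\<Sum>i<e. d i * R i j))"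
proof -
  define P where "P = {p. (\<forall>j\<ge>k. coeff p j = 0) \<and> finsum M (\<lambda>j. coeff p j \<odot> m j) {..<k} = \<zero>}"
  have "vec.subspace P"
    unfolding vec.subspace_def
  proof (intro conjI ballI allI)
    have "finsum M (\<lambda>j. 0 \<odot> m j) {..<k} = finsum M (\<lambda>j. \<zero>) {..<k}"
      using m by (intro finsum_cong') auto
    then show "0 \<in> P" by (simp add: P_def)
  qed (use m in \<open>auto simp: P_def finsum_lessThan_smult_add finsum_lessThan_smult_mult\<close>)
  moreover have "coeff p j = 0" if "p \<in> P" "j \<ge> k" for p j
    using that by (simp add: P_def)
  ultimately obtain B where B: "finite B" "P = vec.span B"
    by (rule submodule_finitely_generated)
  obtain b :: "nat \<Rightarrow> _" where b: "bij_betw b {..<card B} B"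
    using ex_bij_betw_nat_finite[OF B(1)] by (auto simp: atLeast0LessThan)
  define R where "R i j = coeff (b i) j" for i j
  have "b i \<in> P" if "i < card B" for i
    using b that B(2) vec.span_base[of "b i" B] by (auto simp: bij_betw_def)
  then have 1: "finsum M (\<lambda>j. R i j \<odot> m j) {..<k} = \<zero>" if "i < card B" for i
    using that by (auto simp: P_def R_def)
  have 2: "\<exists>d. \<forall>j<k. r j = (\<Sum>i<card B. d i * R i j)"
    if r: "finsum M (\<lambda>j. r j \<odot> m j) {..<k} = \<zero>" for r
  proof -
    define p where "p = (\<Sum>j<k. monom (r j) j)"
    have p: "coeff p j = (if j < k then r j else 0)" for j
      by (auto simp: p_def coeff_sum if_distrib cong: if_cong)
    have "finsum M (\<lambda>j. coeff p j \<odot> m j) {..<k} = finsum M (\<lambda>j. r j \<odot> m j) {..<k}"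
      using m by (intro finsum_cong') (auto simp: p)
    then have "p \<in> P" using r by (simp add: P_def p)
    then obtain u where u: "p = (\<Sum>v\<in>B. Polynomial.smult (u v) v)"
      using B by (auto simp: vec.span_finite)
    have "p = (\<Sum>i<card B. Polynomial.smult (u (b i)) (b i))"
      unfolding u by (rule sum.reindex_bij_betw[OF b, symmetric])
    then have "coeff p j = (\<Sum>i<card B. u (b i) * R i j)" for j
      by (simp add: coeff_sum R_def)
    then show ?thesis by (intro exI[of _ "\<lambda>i. u (b i)"]) (metis p)
  qed
  show ?thesis using that[of "card B" R] 1 2 by blast
qed

text \<open>All summands are brought to the common denominator, the product of all h i * f i; the
  numerator j collects the factors with i different from j.\<close>

lemma finsum_germ_smult:
  assumes s: "\<And>j. j < k \<Longrightarrow> m j \<in> carrier M \<and> eval y (f j) \<noteq> 0 \<and> s j y = germ M y (m j) (f j)"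
    and h: "\<And>j. j < k \<Longrightarrow> eval y (h j) \<noteq> 0"
  shows "finsum (stalk M y) (\<lambda>j. germ poly_module y (u j) (h j) \<odot>\<^bsub>stalk M y\<^esub> s j y) {..<k::nat} =
    germ M y (finsum M (\<lambda>j. ((\<Prod>i\<in>{..<k} - {j}. h i * f i) * u j) \<odot> m j) {..<k})
      (\<Prod>i<k. h i * f i)"
proof -
  have nz: "eval y (\<Prod>i<k. h i * f i) \<noteq> 0" "\<And>j. eval y (\<Prod>i\<in>{..<k} - {j}. h i * f i) \<noteq> 0"
    using s h by (auto simp: eval_prod)
  have "finsum (stalk M y) (\<lambda>j. germ poly_module y (u j) (h j) \<odot>\<^bsub>stalk M y\<^esub> s j y) {..<k} =
      finsum (stalk M y) (\<lambda>j. germ M y (((\<Prod>i\<in>{..<k} - {j}. h i * f i) * u j) \<odot> m j)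
        (\<Prod>i<k. h i * f i)) {..<k}"
  proof (intro abelian_monoid.finsum_cong'[OF abelian_monoid_stalk] refl funcsetI)
    fix j assume "j \<in> {..<k}"
    then have j: "j < k" by simp
    have "germ poly_module y (u j) (h j) \<odot>\<^bsub>stalk M y\<^esub> s j y = germ M y (u j \<odot> m j) (h j * f j)"
      using s[OF j] h[OF j] by (simp add: stalk_smult)
    also have "\<dots> = germ M y ((\<Prod>i\<in>{..<k} - {j}. h i * f i) \<odot> (u j \<odot> m j))
        ((\<Prod>i\<in>{..<k} - {j}. h i * f i) * (h j * f j))"
      using s[OF j] h[OF j] nz(2) by (intro germ_cancel[symmetric]) auto
    also have "(\<Prod>i\<in>{..<k} - {j}. h i * f i) * (h j * f j) = (\<Prod>i<k. h i * f i)"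
      using j prod.remove[of "{..<k}" j "\<lambda>i. h i * f i"] by (simp add: mult.commute)
    finally show "germ poly_module y (u j) (h j) \<odot>\<^bsub>stalk M y\<^esub> s j y =
        germ M y (((\<Prod>i\<in>{..<k} - {j}. h i * f i) * u j) \<odot> m j) (\<Prod>i<k. h i * f i)"
      using s[OF j] by (simp add: smult_assoc)
  next
    fix j assume "j \<in> {..<k}"
    then show "germ M y (((\<Prod>i\<in>{..<k} - {j}. h i * f i) * u j) \<odot> m j) (\<Prod>i<k. h i * f i)
        \<in> carrier (stalk M y)"
      using s nz(1) by auto
  qed
  also have "\<dots> = germ M y (finsum M (\<lambda>j. ((\<Prod>i\<in>{..<k} - {j}. h i * f i) * u j) \<odot> m j) {..<k})
      (\<Prod>i<k. h i * f i)"
    using s nz(1) by (intro finsum_germ) auto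
  finally show ?thesis .
qed

text \<open>Locally s j = m j / f j, so relations between the s j come from relations between the m
  j, with coefficients rescaled by f j, and the latter are finitely generated.\<close>

lemma relations_finite_type:
  assumes V: "zariski_open V" and s: "\<forall>j<k. s j \<in> sections M V"
  shows "relations_finite_type_on M V k s"
  unfolding relations_finite_type_on_def
proof
  fix x assume "x \<in> V"
  with V obtain W m f where W: "zariski_open W" "x \<in> W" "W \<subseteq> V"
    and mf: "\<forall>j<k. m j \<in> carrier M \<and> (\<forall>y\<in>W. eval y (f j) \<noteq> 0 \<and> s j y = germ M y (m j) (f j))"
    using s by (rule sections_local)
  have m: "m j \<in> carrier M" if "j < k" for j using mf that by blast
  have f: "eval y (f j) \<noteq> 0" "s j y = germ M y (m j) (f j)" if "j < k" "y \<in> W" for j y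
    using mf that by blast+
  obtain e :: nat and R where R: "\<forall>i<e. finsum M (\<lambda>j. R i j \<odot> m j) {..<k} = \<zero>"
    "\<forall>r. finsum M (\<lambda>j. r j \<odot> m j) {..<k} = \<zero> \<longrightarrow> (\<exists>d. \<forall>j<k. r j = (\<Sum>i<e. d i * R i j))"
    by (rule relation_module_finitely_generated[OF m])
  \<comment> \<open>The factor f j cancels the denominator of s j.\<close>
  define S where "S i j = (\<lambda>y\<in>W. germ poly_module y (R i j * f j) 1)" for i j
  have sec: "S i j \<in> sections poly_module W" for i j
    unfolding S_def using W(1) by (intro pm.germ_section) auto
  have rel: "germ_relation M y k s (\<lambda>j. S i j y)" if i: "i < e" and y: "y \<in> W" for i y
  proof -
    have "finsum (stalk M y) (\<lambda>j. S i j y \<odot>\<^bsub>stalk M y\<^esub> s j y) {..<k} =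
        finsum (stalk M y) (\<lambda>j. germ M y (R i j \<odot> m j) 1) {..<k}"
    proof (intro abelian_monoid.finsum_cong'[OF abelian_monoid_stalk] refl funcsetI)
      fix j assume "j \<in> {..<k}"
      then have j: "j < k" by simp
      have "germ M y (f j \<odot> (R i j \<odot> m j)) (f j * 1) = germ M y (R i j \<odot> m j) 1"
        using m[OF j] f(1)[OF j y] by (intro germ_cancel) auto
      then show "S i j y \<odot>\<^bsub>stalk M y\<^esub> s j y = germ M y (R i j \<odot> m j) 1"
        using m[OF j] f[OF j y] y by (simp add: S_def stalk_smult smult_assoc mult.commute)
    qed (use m in auto)
    also have "\<dots> = germ M y (finsum M (\<lambda>j. R i j \<odot> m j) {..<k}) 1"
      using m by (intro finsum_germ) auto
    finally show ?thesis
      using R(1) i y by (simp add: germ_relation_def stalk_zero S_def)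
  qed
  have gen: "\<exists>d. (\<forall>i<e. d i \<in> carrier (stalk poly_module y)) \<and>
      (\<forall>j<k. c j = finsum (stalk poly_module y) (\<lambda>i. d i \<odot>\<^bsub>stalk poly_module y\<^esub> S i j y) {..<e})"
    if y: "y \<in> W" and c: "germ_relation M y k s c" for y c
  proof -
    have "\<forall>j\<in>{..<k}. \<exists>u h. eval y h \<noteq> 0 \<and> c j = germ poly_module y u h"
    proof
      fix j assume "j \<in> {..<k}"
      then have "c j \<in> carrier (stalk poly_module y)" using c by (auto simp: germ_relation_def)
      then obtain u h where "eval y h \<noteq> 0" "c j = germ poly_module y u h"
        by (rule pm.stalk_carrierE)
      then show "\<exists>u h. eval y h \<noteq> 0 \<and> c j = germ poly_module y u h" by blast
    qed
    then obtain u h where "\<forall>j\<in>{..<k}. eval y (h j) \<noteq> 0 \<and> c j = germ poly_module y (u j) (h j)"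
      unfolding bchoice_iff by blast
    then have uh: "eval y (h j) \<noteq> 0 \<and> c j = germ poly_module y (u j) (h j)" if "j < k" for j
      using that by blast
    define E where "E = (\<Prod>i<k. h i * f i)"
    define E' where "E' j = (\<Prod>i\<in>{..<k} - {j}. h i * f i)" for j
    have E: "eval y E \<noteq> 0" using uh f y by (auto simp: E_def)
    have EE': "E = E' j * (h j * f j)" if "j < k" for j
      unfolding E_def E'_def using that prod.remove[of "{..<k}" j "\<lambda>i. h i * f i"]
      by (simp add: mult.commute)
    have "germ M y \<zero> 1 = finsum (stalk M y) (\<lambda>j. c j \<odot>\<^bsub>stalk M y\<^esub> s j y) {..<k}"
      using c by (simp add: germ_relation_def stalk_zero)
    also have "\<dots> = finsum (stalk M y) (\<lambda>j. germ poly_module y (u j) (h j) \<odot>\<^bsub>stalk M y\<^esub> s j y) {..<k}"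
      using uh m f y
      by (intro abelian_monoid.finsum_cong'[OF abelian_monoid_stalk]) (auto simp: stalk_smult)
    also have "\<dots> = germ M y (finsum M (\<lambda>j. (E' j * u j) \<odot> m j) {..<k}) E"
      unfolding E_def E'_def using m f y uh by (intro finsum_germ_smult) auto
    \<comment> \<open>Vanishing in the stalk only means that some H with nonzero value at y
      annihilates the numerator.\<close>
    finally have "\<exists>H. eval y H \<noteq> 0 \<and>
        (H * E) \<odot> \<zero> = (H * 1) \<odot> finsum M (\<lambda>j. (E' j * u j) \<odot> m j) {..<k}"
      using E m by (subst (asm) germ_eq_iff) auto
    then obtain H where H: "eval y H \<noteq> 0" "H \<odot> finsum M (\<lambda>j. (E' j * u j) \<odot> m j) {..<k} = \<zero>"
      by auto
    have "finsum M (\<lambda>j. (H * (E' j * u j)) \<odot> m j) {..<k} = \<zero>"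
      using finsum_lessThan_smult_mult[of k m H "\<lambda>j. E' j * u j"] m H by simp
    then obtain d where "\<forall>j<k. H * (E' j * u j) = (\<Sum>i<e. d i * R i j)"
      using R(2)[THEN spec, of "\<lambda>j. H * (E' j * u j)"] by blast
    then have d: "H * (E' j * u j) = (\<Sum>i<e. d i * R i j)" if "j < k" for j using that by blast
    \<comment> \<open>Dividing by H * E undoes the multiplication by H and E' j, since E = E' j * (h
      j * f j).\<close>
    define D where "D i = germ poly_module y (d i) (H * E)" for i
    have "c j = finsum (stalk poly_module y) (\<lambda>i. D i \<odot>\<^bsub>stalk poly_module y\<^esub> S i j y) {..<e}"
      if j: "j < k" for j
    proof -
      have "finsum (stalk poly_module y) (\<lambda>i. D i \<odot>\<^bsub>stalk poly_module y\<^esub> S i j y) {..<e} =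
          finsum (stalk poly_module y) (\<lambda>i. germ poly_module y (d i * (R i j * f j)) (H * E)) {..<e}"
        using y H(1) E
        by (intro abelian_monoid.finsum_cong'[OF pm.abelian_monoid_stalk] refl funcsetI)
           (auto simp: D_def S_def pm.stalk_smult)
      also have "\<dots> = germ poly_module y (\<Sum>i<e. d i * (R i j * f j)) (H * E)"
        using H(1) E by (subst pm.finsum_germ) (auto simp: finsum_poly_module)
      also have "(\<Sum>i<e. d i * (R i j * f j)) = H * (E' j * u j) * f j"
        unfolding d[OF j] sum_distrib_right by (simp add: mult.assoc)
      also have "germ poly_module y (H * (E' j * u j) * f j) (H * E) = germ poly_module y (u j) (h j)"
        using H(1) E uh[OF j]
        by (subst pm.germ_eq_iff) (auto simp: EE'[OF j] ac_simps intro!: exI[of _ 1])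
      finally show ?thesis using uh[OF j] by simp
    qed
    then show ?thesis using H(1) E by (intro exI[of _ D]) (auto simp: D_def)
  qed
  show "\<exists>W (e::nat) R. zariski_open W \<and> x \<in> W \<and> W \<subseteq> V \<and>
     (\<forall>i<e. (\<forall>j<k. R i j \<in> sections poly_module W) \<and>
            (\<forall>y\<in>W. germ_relation M y k s (\<lambda>j. R i j y))) \<and>
     (\<forall>y\<in>W. \<forall>c. germ_relation M y k s c \<longrightarrow>
        (\<exists>d. (\<forall>i<e. d i \<in> carrier (stalk poly_module y)) \<and>
             (\<forall>j<k. c j = finsum (stalk poly_module y)
                             (\<lambda>i. d i \<odot>\<^bsub>stalk poly_module y\<^esub> R i j y) {..<e})))"
    using W sec rel gen by (intro exI[of _ W] exI[of _ e] exI[of _ S]) blast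
qed

text \<open>Over a Noetherian ring relations between sections are always of finite type, so only
  generators have to be provided.\<close>

lemma coherent_onI: "finite_type_on M X \<Longrightarrow> coherent_on M X"
  unfolding coherent_on_def using relations_finite_type by blast

end

section \<open>Derivations of a module, extended to fractions by the quotient rule\<close>

definition germ_der ::
    "('v::finite mpol, 'b) module \<Rightarrow> ('v mpol \<Rightarrow> 'v mpol) \<Rightarrow> ('b \<Rightarrow> 'b) \<Rightarrow> ('v \<Rightarrow> complex) \<Rightarrow>
     ('b \<times> 'v mpol) set \<Rightarrow> ('b \<times> 'v mpol) set" where
  "germ_der M D \<delta> x s = (\<Union>(m, f)\<in>s.
     germ M x ((f \<odot>\<^bsub>M\<^esub> \<delta> m) \<oplus>\<^bsub>M\<^esub> ((- D f) \<odot>\<^bsub>M\<^esub> m)) (f * f))"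

locale mpol_module_derivation = mpol_module M
  for M :: "('v::finite mpol, 'b) module" (structure) +
  fixes D :: "'v mpol \<Rightarrow> 'v mpol" and \<delta> :: "'b \<Rightarrow> 'b"
  assumes D_mult: "D (f * g) = f * D g + D f * g"
    and \<delta>_closed [simp, intro]: "m \<in> carrier M \<Longrightarrow> \<delta> m \<in> carrier M"
    and \<delta>_add: "m \<in> carrier M \<Longrightarrow> n \<in> carrier M \<Longrightarrow> \<delta> (m \<oplus> n) = \<delta> m \<oplus> \<delta> n"
    and \<delta>_smult: "m \<in> carrier M \<Longrightarrow> \<delta> (h \<odot> m) = h \<odot> \<delta> m \<oplus> D h \<odot> m"
begin

text \<open>A bookkeeping device: identities in M between \<delta> m, m, \<delta> n and n become
  ring identities between four coefficients.\<close>

definition comb :: "'b \<Rightarrow> 'b \<Rightarrow> 'v mpol \<Rightarrow> 'v mpol \<Rightarrow> 'v mpol \<Rightarrow> 'v mpol \<Rightarrow> 'b" where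
  "comb m n a b c d = a \<odot> \<delta> m \<oplus> b \<odot> m \<oplus> (c \<odot> \<delta> n \<oplus> d \<odot> n)"

lemma comb_closed [simp, intro]:
  "m \<in> carrier M \<Longrightarrow> n \<in> carrier M \<Longrightarrow> comb m n a b c d \<in> carrier M"
  by (simp add: comb_def)

lemma comb_add:
  assumes "m \<in> carrier M" "n \<in> carrier M"
  shows "comb m n a b c d \<oplus> comb m n a' b' c' d' = comb m n (a + a') (b + b') (c + c') (d + d')"
  unfolding comb_def using assms by (simp add: smult_add_left a_ac)

lemma comb_smult:
  assumes "m \<in> carrier M" "n \<in> carrier M"
  shows "h \<odot> comb m n a b c d = comb m n (h * a) (h * b) (h * c) (h * d)"
  unfolding comb_def using assms by (simp add: smult_add_right smult_assoc)

text \<open>The quotient rule respects equality of fractions: \<delta> is applied to the relation (h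
  * g) m = (h * f) n, which gives \<open>d\<close>, while multiples of the relation itself give
  \<open>e\<close>.\<close>

lemma germ_der_germ:
  assumes m: "m \<in> carrier M" "eval x f \<noteq> 0"
  shows "germ_der M D \<delta> x (germ M x m f) = germ M x (f \<odot> \<delta> m \<oplus> (- D f) \<odot> m) (f * f)"
proof -
  have "germ M x (g \<odot> \<delta> n \<oplus> (- D g) \<odot> n) (g * g) = germ M x (f \<odot> \<delta> m \<oplus> (- D f) \<odot> m) (f * f)"
    if ng: "(n, g) \<in> germ M x m f" for n g
  proof -
    obtain h where n: "n \<in> carrier M" "eval x g \<noteq> 0" "eval x h \<noteq> 0"
      and eq: "(h * g) \<odot> m = (h * f) \<odot> n"
      using ng m by (auto simp: mem_germ_iff)
    note mn = m(1) n(1)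
    have "\<delta> ((h * g) \<odot> m) = \<delta> ((h * f) \<odot> n)" using eq by simp
    then have d: "comb m n (h * g) (D (h * g)) 0 0 = comb m n 0 0 (h * f) (D (h * f))"
      using mn by (simp add: \<delta>_smult comb_def)
    have e: "comb m n 0 (k * h * g) 0 0 = comb m n 0 0 0 (k * h * f)" for k
      using arg_cong[OF eq, of "\<lambda>u. k \<odot> u"] mn by (simp add: comb_def smult_assoc mult.assoc)
    \<comment> \<open>The coefficient of \<delta> m dictates the factor h * f * g in front of
      \<open>d\<close>; the multiple of \<open>e\<close> is then the one that corrects the
      coefficient of m.\<close>
    have "comb m n (h * h * g * g * f) (- (h * h * g * g * D f)) 0 0 =
        (h * f * g) \<odot> comb m n (h * g) (D (h * g)) 0 0 \<oplus>
        comb m n 0 ((- (g * D h * f) - h * D g * f - g * h * D f) * h * g) 0 0"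
      using mn by (simp add: comb_smult comb_add D_mult algebra_simps)
    also have "\<dots> = (h * f * g) \<odot> comb m n 0 0 (h * f) (D (h * f)) \<oplus>
        comb m n 0 0 0 ((- (g * D h * f) - h * D g * f - g * h * D f) * h * f)"
      unfolding d e ..
    also have "\<dots> = comb m n 0 0 (h * h * f * f * g) (- (h * h * f * f * D g))"
      using mn by (simp add: comb_smult comb_add D_mult algebra_simps)
    finally have "(h * h * (f * f)) \<odot> (g \<odot> \<delta> n \<oplus> (- D g) \<odot> n) =
        (h * h * (g * g)) \<odot> (f \<odot> \<delta> m \<oplus> (- D f) \<odot> m)"
      using mn by (simp add: comb_def smult_add_right smult_assoc ac_simps del: smult_minus)
    then show ?thesis
      using m n by (subst germ_eq_iff) (auto intro!: exI[of _ "h * h"] simp del: smult_minus)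
  qed
  then show ?thesis
    unfolding germ_der_def by (rule UN_pair_const[OF mem_germ[OF m]])
qed

lemma germ_der_add:
  assumes "s \<in> carrier (stalk M x)" "t \<in> carrier (stalk M x)"
  shows "germ_der M D \<delta> x (s \<oplus>\<^bsub>stalk M x\<^esub> t) =
    germ_der M D \<delta> x s \<oplus>\<^bsub>stalk M x\<^esub> germ_der M D \<delta> x t"
proof -
  obtain m f n g where m: "m \<in> carrier M" "eval x f \<noteq> 0" "s = germ M x m f"
    and n: "n \<in> carrier M" "eval x g \<noteq> 0" "t = germ M x n g"
    using assms by (metis stalk_carrierE)
  note mn = m(1) n(1)
  have "(f * g) \<odot> \<delta> (g \<odot> m \<oplus> f \<odot> n) \<oplus> (- D (f * g)) \<odot> (g \<odot> m \<oplus> f \<odot> n) =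
      (f * g) \<odot> (comb m n g (D g) f (D f)) \<oplus> (- D (f * g)) \<odot> comb m n 0 g 0 f"
    using mn by (simp add: \<delta>_add \<delta>_smult comb_def del: smult_minus)
  also have "\<dots> = (g * g) \<odot> comb m n f (- D f) 0 0 \<oplus> (f * f) \<odot> comb m n 0 0 g (- D g)"
    using mn by (simp add: comb_smult comb_add D_mult algebra_simps del: smult_minus)
  also have "\<dots> = (g * g) \<odot> (f \<odot> \<delta> m \<oplus> (- D f) \<odot> m) \<oplus> (f * f) \<odot> (g \<odot> \<delta> n \<oplus> (- D g) \<odot> n)"
    using mn by (simp add: comb_def del: smult_minus)
  finally show ?thesis
    using m n by (simp add: stalk_add germ_der_germ ac_simps del: smult_minus)
qed

lemma germ_der_smult:
  assumes "s \<in> carrier (stalk M x)" "eval x h \<noteq> 0"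
  shows "germ_der M D \<delta> x (germ poly_module x u h \<odot>\<^bsub>stalk M x\<^esub> s) =
    (germ poly_module x u h \<odot>\<^bsub>stalk M x\<^esub> germ_der M D \<delta> x s) \<oplus>\<^bsub>stalk M x\<^esub>
    (germ poly_module x (h * D u - D h * u) (h * h) \<odot>\<^bsub>stalk M x\<^esub> s)"
proof -
  obtain m f where m: "m \<in> carrier M" "eval x f \<noteq> 0" "s = germ M x m f"
    using assms by (metis stalk_carrierE)
  \<comment> \<open>The numerators of the two sides. In the sum on the right the denominators are
    multiplied, so that ?b carries an additional factor h * f.\<close>
  let ?a = "(h * f) \<odot> \<delta> (u \<odot> m) \<oplus> (- D (h * f)) \<odot> (u \<odot> m)"
  let ?b = "(h * h * f) \<odot> (u \<odot> (f \<odot> \<delta> m \<oplus> (- D f) \<odot> m)) \<oplus>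
      (h * (f * f)) \<odot> ((h * D u - D h * u) \<odot> m)"
  have "?a = (h * f) \<odot> comb m m u (D u) 0 0 \<oplus> (- D (h * f)) \<odot> comb m m 0 u 0 0"
    using m by (simp add: \<delta>_smult comb_def del: smult_minus)
  also have "\<dots> = comb m m (h * f * u) (h * f * D u - D (h * f) * u) 0 0"
    using m by (simp add: comb_smult comb_add algebra_simps del: smult_minus)
  finally have a: "?a = \<dots>" .
  have "?b = (h * h * f) \<odot> (u \<odot> comb m m f (- D f) 0 0) \<oplus>
      (h * (f * f)) \<odot> comb m m 0 (h * D u - D h * u) 0 0"
    using m by (simp add: comb_def del: smult_minus)
  also have "\<dots> = (h * f) \<odot> comb m m (h * f * u) (h * f * D u - D (h * f) * u) 0 0"
    using m by (simp add: comb_smult comb_add D_mult algebra_simps del: smult_minus)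
  finally have b: "?b = (h * f) \<odot> ?a" unfolding a .
  have "germ M x ?a (h * f * (h * f)) = germ M x ((h * f) \<odot> ?a) ((h * f) * (h * f * (h * f)))"
    using m assms(2) by (intro germ_cancel[symmetric]) (auto simp del: smult_minus)
  then show ?thesis
    using m assms(2) unfolding b[symmetric]
    by (simp add: stalk_add stalk_smult germ_der_germ ac_simps del: smult_minus)
qed

end

lemma mpol_module_derivation_log_der:
  "mpol_module_derivation poly_module (log_der v) (log_der v)"
  by (intro mpol_module_derivation.intro mpol_module_poly_module mpol_module_derivation_axioms.intro)
     (simp_all add: log_der_mult poly_module_def)

lemma log_differential_germ:
  assumes "x \<in> V" "\<phi> x = germ poly_module x u h" "eval x h \<noteq> 0"
  shows "log_differential V \<phi> v x = germ poly_module x (h * log_der v u - log_der v h * u) (h * h)"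
proof -
  have "log_differential V \<phi> v x = germ_der poly_module (log_der v) (log_der v) x (\<phi> x)"
    using assms(1) by (simp add: log_differential_def germ_der_def poly_module_def)
  then show ?thesis
    using mpol_module_derivation.germ_der_germ[OF mpol_module_derivation_log_der, of u x h v] assms
    by (simp add: poly_module_def)
qed

text \<open>Near each point a section is a single fraction m/f, and the quotient rule produces a
  single fraction again; additivity and the Leibniz rule are checked in the stalks.\<close>

lemma log_connection_germ_der:
  fixes M :: "('r::finite option mpol, 'b) module"
  assumes der: "\<And>v. mpol_module_derivation M (log_der v) (\<delta> v)"
  shows "log_connection M X (\<lambda>V s v. \<lambda>x\<in>V. germ_der M (log_der v) (\<delta> v) x (s x))"
proof -
  interpret mpol_module_derivation M "log_der v" "\<delta> v" for v by (rule der)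
  have stalk: "s x \<in> carrier (stalk M x)" if "s \<in> sections M V" "x \<in> V" for s V x
    using that by (rule section_local) auto
  define nabla where "nabla V s v = (\<lambda>x\<in>V. germ_der M (log_der v) (\<delta> v) x (s x))" for V s v
  have A: "nabla V s v \<in> sections M V" if s: "s \<in> sections M V" for V s v
  proof -
    have "\<exists>W m f. zariski_open W \<and> x \<in> W \<and> W \<subseteq> V \<and> m \<in> carrier M \<and>
       (\<forall>y\<in>W. eval y f \<noteq> 0 \<and> nabla V s v y = germ M y m f)" if x: "x \<in> V" for x
    proof -
      obtain W m f where W: "zariski_open W" "x \<in> W" "W \<subseteq> V" "m \<in> carrier M"
        and f: "\<And>y. y \<in> W \<Longrightarrow> eval y f \<noteq> 0" "\<And>y. y \<in> W \<Longrightarrow> s y = germ M y m f"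
        using section_local[OF s x] by blast
      have "nabla V s v y = germ M y (f \<odot>\<^bsub>M\<^esub> \<delta> v m \<oplus>\<^bsub>M\<^esub> (- log_der v f) \<odot>\<^bsub>M\<^esub> m) (f * f)"
        if "y \<in> W" for y
        using W(3,4) f[OF that] that germ_der_germ[of m y f v] by (auto simp: nabla_def)
      then show ?thesis
        using W f(1)
        by (intro exI[of _ W] exI[of _ "f \<odot>\<^bsub>M\<^esub> \<delta> v m \<oplus>\<^bsub>M\<^esub> (- log_der v f) \<odot>\<^bsub>M\<^esub> m"]
            exI[of _ "f * f"]) (auto simp del: smult_minus)
    qed
    then show ?thesis unfolding sections_def by (auto simp: nabla_def)
  qed
  have B: "nabla W (restrict s W) v = restrict (nabla V s v) W" if "W \<subseteq> V" for V W s v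
    using that by (auto simp: nabla_def fun_eq_iff)
  have C: "nabla V (sec_add M V s t) v = sec_add M V (nabla V s v) (nabla V t v)"
    if "s \<in> sections M V" "t \<in> sections M V" for V s t v
    using that stalk by (auto simp: nabla_def sec_add_def fun_eq_iff germ_der_add)
  have E: "nabla V (sec_smult M V \<phi> s) v =
      sec_add M V (sec_smult M V \<phi> (nabla V s v)) (sec_smult M V (log_differential V \<phi> v) s)"
    if s: "s \<in> sections M V" and \<phi>: "\<phi> \<in> sections poly_module V" for V \<phi> s v
  proof
    fix x
    show "nabla V (sec_smult M V \<phi> s) v x =
      sec_add M V (sec_smult M V \<phi> (nabla V s v)) (sec_smult M V (log_differential V \<phi> v) s) x"
    proof (cases "x \<in> V")
      case x: True
      obtain u h where h: "eval x h \<noteq> 0" "\<phi> x = germ poly_module x u h"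
        using pm.section_local[OF \<phi> x] by metis
      show ?thesis
        using germ_der_smult[OF stalk[OF s x] h(1), of v u] x h log_differential_germ[of x V \<phi> u h v]
        by (simp add: nabla_def sec_smult_def sec_add_def)
    qed (simp add: nabla_def sec_add_def)
  qed
  have "log_connection M X nabla"
    unfolding log_connection_def
  proof (intro allI impI ballI conjI)
    fix V s v W assume "s \<in> sections M V" "zariski_open W \<and> W \<subseteq> V"
    then show "nabla W (restrict s W) v = restrict (nabla V s v) W" by (intro B) simp
  qed (auto intro: A C E)
  then show ?thesis by (simp add: nabla_def[abs_def])
qed

section \<open>The quotient of the ring of differential operators by a left ideal\<close>

lemma Rtilde_add_arg: "T \<in> Rtilde \<Longrightarrow> T (f + g) = T f + T g"
  by (induction arbitrary: f g rule: Rtilde.induct) (simp_all add: distrib_left)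

lemma Rtilde_0_arg: "T \<in> Rtilde \<Longrightarrow> T 0 = 0"
  using Rtilde_add_arg[of T 0 0] by simp

lemma Rtilde_smult: "P \<in> Rtilde \<Longrightarrow> (\<lambda>f. h * P f) \<in> Rtilde"
  using Rtilde.comp[OF Rtilde.mul[of h], of P] by (simp add: o_def)

lemma Rtilde_id: "(id :: 'r oper) \<in> Rtilde"
proof -
  have "(*) 1 = (id :: 'r oper)" by (rule ext) simp
  then show ?thesis using Rtilde.mul[of "1 :: 'r option mpol"] by simp
qed

lemma Rtilde_zero: "(\<lambda>f. 0 :: 'r option mpol) \<in> Rtilde"
proof -
  have "(*) 0 = (\<lambda>f. 0 :: 'r option mpol)" by (rule ext) simp
  then show ?thesis using Rtilde.mul[of "0 :: 'r option mpol"] by simp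
qed

lemma Rtilde_uminus: "P \<in> Rtilde \<Longrightarrow> (\<lambda>f. - P f) \<in> Rtilde"
  using Rtilde_smult[of P "- 1"] by simp

lemma Rtilde_sum: "(\<And>a. a \<in> S \<Longrightarrow> P a \<in> Rtilde) \<Longrightarrow> (\<lambda>f. \<Sum>a\<in>S. P a f) \<in> Rtilde"
  by (induction S rule: infinite_finite_induct) (auto intro: Rtilde_zero Rtilde.add)

lemma left_ideal_comp: "P \<in> left_ideal G \<Longrightarrow> T \<in> Rtilde \<Longrightarrow> T \<circ> P \<in> left_ideal G"
proof (induction rule: left_ideal.induct)
  case zero
  then show ?case using left_ideal.zero by (simp add: o_def Rtilde_0_arg)
next
  case (gen S P)
  then have "(T \<circ> S) \<circ> P \<in> left_ideal G" by (intro left_ideal.gen Rtilde.comp)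
  then show ?case unfolding comp_assoc .
next
  case (add P Q)
  then have "(\<lambda>f. (T \<circ> P) f + (T \<circ> Q) f) \<in> left_ideal G" by (intro left_ideal.add)
  then show ?case using add.prems by (simp add: o_def Rtilde_add_arg)
qed

lemma left_ideal_smult: "P \<in> left_ideal G \<Longrightarrow> (\<lambda>f. h * P f) \<in> left_ideal G"
  using left_ideal_comp[OF _ Rtilde.mul[of h], of P] by (simp add: o_def)

lemma left_ideal_uminus: "P \<in> left_ideal G \<Longrightarrow> (\<lambda>f. - P f) \<in> left_ideal G"
  using left_ideal_smult[of P G "- 1"] by simp

abbreviation op_class :: "'r oper set \<Rightarrow> 'r oper \<Rightarrow> 'r oper set" where
  "op_class G \<equiv> residue_class (left_ideal G)"

abbreviation operator_quotient :: "'r oper set \<Rightarrow> ('r option mpol, 'r oper set) module" where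
  "operator_quotient G \<equiv> Rtilde_quotient (left_ideal G)"

lemma residue_class_eqI:
  assumes "(\<lambda>f. P f - Q f) \<in> left_ideal G"
  shows "op_class G P = op_class G Q"
proof -
  have *: "op_class G P \<subseteq> op_class G Q"
    if "(\<lambda>f. P f - Q f) \<in> left_ideal G" for P Q
  proof
    fix S assume S: "S \<in> op_class G P"
    then have "(\<lambda>f. (S f - P f) + (P f - Q f)) \<in> left_ideal G"
      using that by (intro left_ideal.add) (auto simp: residue_class_def)
    then show "S \<in> op_class G Q"
      using S by (simp add: residue_class_def)
  qed
  have "(\<lambda>f. Q f - P f) \<in> left_ideal G" using left_ideal_uminus[OF assms] by simp
  then show ?thesis using * assms by blast
qed

lemma residue_class_self: "P \<in> Rtilde \<Longrightarrow> P \<in> op_class G P"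
  by (simp add: residue_class_def left_ideal.zero)

lemma UN_const_class:
  assumes "x \<in> S" "\<And>y. y \<in> S \<Longrightarrow> T y = C"
  shows "(\<Union>y\<in>S. T y) = C"
  using assms by auto

lemma residue_class_smult:
  assumes "P \<in> Rtilde"
  shows "h \<odot>\<^bsub>operator_quotient G\<^esub> op_class G P =
    op_class G (\<lambda>f. h * P f)"
proof -
  have "op_class G (\<lambda>f. h * S f) = op_class G (\<lambda>f. h * P f)"
    if "S \<in> op_class G P" for S
    using that left_ideal_smult[of "\<lambda>f. S f - P f" G h]
    by (intro residue_class_eqI) (simp add: residue_class_def right_diff_distrib)
  then have "(\<Union>S\<in>op_class G P. op_class G (\<lambda>f. h * S f)) =
      op_class G (\<lambda>f. h * P f)"
    by (rule UN_const_class[OF residue_class_self[OF assms]])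
  then show ?thesis by (simp only: Rtilde_quotient_def module.simps)
qed

lemma residue_class_add:
  assumes "P \<in> Rtilde" "Q \<in> Rtilde"
  shows "op_class G P \<oplus>\<^bsub>operator_quotient G\<^esub>
    op_class G Q = op_class G (\<lambda>f. P f + Q f)"
proof -
  have *: "op_class G (\<lambda>f. S f + T f) = op_class G (\<lambda>f. P f + Q f)"
    if "S \<in> op_class G P" "T \<in> op_class G Q" for S T
    using that left_ideal.add[of "\<lambda>f. S f - P f" G "\<lambda>f. T f - Q f"]
    by (intro residue_class_eqI) (simp add: residue_class_def algebra_simps)
  have "(\<Union>T\<in>op_class G Q. op_class G (\<lambda>f. S f + T f)) =
      op_class G (\<lambda>f. P f + Q f)" if "S \<in> op_class G P" for S
    by (rule UN_const_class[OF residue_class_self[OF assms(2)] *[OF that]])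
  then have "(\<Union>S\<in>op_class G P. \<Union>T\<in>op_class G Q.
      op_class G (\<lambda>f. S f + T f)) = op_class G (\<lambda>f. P f + Q f)"
    by (rule UN_const_class[OF residue_class_self[OF assms(1)]])
  then show ?thesis by (simp only: Rtilde_quotient_def ring.simps)
qed

lemma left_action_residue_class:
  assumes "T \<in> Rtilde" "P \<in> Rtilde"
  shows "left_action (left_ideal G) T (op_class G P) =
    op_class G (T \<circ> P)"
proof -
  have "op_class G (T \<circ> S) = op_class G (T \<circ> P)"
    if "S \<in> op_class G P" for S
  proof (rule residue_class_eqI)
    have "T (S f - P f) = T (S f) - T (P f)" for f
      using Rtilde_add_arg[OF assms(1), of "S f - P f" "P f"] by simp
    then show "(\<lambda>f. (T \<circ> S) f - (T \<circ> P) f) \<in> left_ideal G"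
      using that left_ideal_comp[of "\<lambda>f. S f - P f" G T] assms(1)
      by (simp add: residue_class_def o_def)
  qed
  then show ?thesis
    unfolding left_action_def by (rule UN_const_class[OF residue_class_self[OF assms(2)]])
qed

lemma Rtilde_quotient_carrier:
  "carrier (Rtilde_quotient I) = residue_class I ` Rtilde"
  "\<zero>\<^bsub>Rtilde_quotient I\<^esub> = residue_class I (\<lambda>f. 0)"
  by (simp_all add: Rtilde_quotient_def)

lemma mpol_module_Rtilde_quotient: "mpol_module (operator_quotient G)"
proof (intro mpol_module.intro mpol_module_axioms.intro abelian_groupI)
  fix C assume "C \<in> carrier (operator_quotient G)"
  then obtain P where P: "P \<in> Rtilde" "C = op_class G P"
    by (auto simp: Rtilde_quotient_carrier)
  show "\<exists>y\<in>carrier (operator_quotient G). y \<oplus>\<^bsub>operator_quotient G\<^esub> C =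
      \<zero>\<^bsub>operator_quotient G\<^esub>"
    using P Rtilde_uminus[OF P(1)]
    by (intro bexI[of _ "op_class G (\<lambda>f. - P f)"])
       (auto simp: Rtilde_quotient_carrier residue_class_add)
qed (auto simp: Rtilde_quotient_carrier residue_class_add residue_class_smult Rtilde_smult
      Rtilde_zero Rtilde.add algebra_simps)

text \<open>The commutator of the operator \<open>log_der v\<close> with multiplication by h is
  multiplication by \<open>log_der v h\<close>; hence left multiplication satisfies the Leibniz
  rule.\<close>

lemma mpol_module_derivation_Rtilde_quotient:
  "mpol_module_derivation (operator_quotient G) (log_der v)
     (left_action (left_ideal G) (log_der v))"
proof (intro mpol_module_derivation.intro mpol_module_Rtilde_quotient
    mpol_module_derivation_axioms.intro)
  show "log_der v (f * g) = f * log_der v g + log_der v f * g" for f g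
    by (rule log_der_mult)
qed (auto simp: Rtilde_quotient_carrier residue_class_add residue_class_smult Rtilde_smult
      Rtilde.add Rtilde.comp Rtilde.der left_action_residue_class o_def log_der_mult
      Rtilde.comp[unfolded o_def])

text \<open>On a stalk the action of the partial derivative is \<open>germ_der\<close> divided by
  \<open>log_weight v\<close>, which is invertible on Y; multiplication by the weight restores
  \<open>germ_der\<close>.\<close>

lemma extends_dmodule_structure_germ_der:
  assumes Y: "\<And>x v. x \<in> Y \<Longrightarrow> x v \<noteq> 0"
  shows "extends_dmodule_structure (left_ideal G) Y (\<lambda>V s v. \<lambda>x\<in>V.
    germ_der (operator_quotient G) (log_der v) (left_action (left_ideal G) (log_der v))
      x (s x))"
  unfolding extends_dmodule_structure_def
proof (intro allI impI ballI, elim conjE)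
  fix V s v x
  let ?M = "operator_quotient G" and ?\<delta> = "left_action (left_ideal G) (log_der v)"
  let ?w = "log_weight v"
  interpret mpol_module_derivation ?M "log_der v" ?\<delta>
    by (rule mpol_module_derivation_Rtilde_quotient)
  assume V: "V \<subseteq> Y" and s: "s \<in> sections ?M V" and x: "x \<in> V"
  have w: "eval x ?w \<noteq> 0" using Y[of x] V x by (cases v) auto
  obtain C f where C: "C \<in> carrier ?M" "eval x f \<noteq> 0" "s x = germ ?M x C f"
    using section_local[OF s x] by metis
  define num where "num C f = (f \<odot>\<^bsub>?M\<^esub> ?\<delta> C) \<oplus>\<^bsub>?M\<^esub> ((- log_der v f) \<odot>\<^bsub>?M\<^esub> C)" for C f
  have num: "num C' f' \<in> carrier ?M" if "C' \<in> carrier ?M" for C' f'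
    using that by (simp add: num_def del: smult_minus)
  \<comment> \<open>Independence of the representative is inherited from \<open>germ_der\<close>,
    after division by the weight.\<close>
  have "germ ?M x (num C' f') (?w * f' * f') = germ ?M x (num C f) (?w * f * f)"
    if C': "(C', f') \<in> germ ?M x C f" for C' f'
  proof -
    have C'': "C' \<in> carrier ?M" "eval x f' \<noteq> 0" using C C' by (auto simp: mem_germ_iff)
    have "germ ?M x C' f' = germ ?M x C f" using germ_eq_if_mem[OF C(1,2) C'] .
    then have "germ ?M x (num C' f') (f' * f') = germ ?M x (num C f) (f * f)"
      using germ_der_germ[OF C(1,2)] germ_der_germ[OF C''] by (simp add: num_def)
    then have "germ poly_module x 1 ?w \<odot>\<^bsub>stalk ?M x\<^esub> germ ?M x (num C' f') (f' * f') =
        germ poly_module x 1 ?w \<odot>\<^bsub>stalk ?M x\<^esub> germ ?M x (num C f) (f * f)" by simp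
    then show ?thesis
      using w C C'' num by (simp add: stalk_smult mult.assoc)
  qed
  then have "dmodule_partial (left_ideal G) v x (s x) = germ ?M x (num C f) (?w * f * f)"
    unfolding dmodule_partial_def Let_def C(3) num_def
    by (rule UN_pair_const[OF mem_germ[OF C(1,2)]])
  then have "germ poly_module x ?w 1 \<odot>\<^bsub>stalk ?M x\<^esub> dmodule_partial (left_ideal G) v x (s x) =
      germ ?M x (?w \<odot>\<^bsub>?M\<^esub> num C f) (?w * (f * f))"
    using w C num by (simp add: stalk_smult mult.assoc)
  also have "\<dots> = germ ?M x (num C f) (f * f)"
    using w C num by (intro germ_cancel) auto
  also have "\<dots> = germ_der ?M (log_der v) ?\<delta> x (s x)"
    using germ_der_germ[OF C(1,2)] C(3) by (simp add: num_def)
  finally show "(\<lambda>x\<in>V. germ_der ?M (log_der v) ?\<delta> x (s x)) x =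
      germ poly_module x ?w 1 \<odot>\<^bsub>stalk ?M x\<^esub> dmodule_partial (left_ideal G) v x (s x)"
    using x by simp
qed

section \<open>The order filtration\<close>

definition Dop :: "('r::finite \<Rightarrow> int ^ 'm) \<Rightarrow> 'm \<Rightarrow> 'r oper" where
  "Dop pd i f = (\<Sum>a\<in>UNIV. of_int (pd a $ i) * log_der (Some a) f)"

text \<open>Multisets index the monomials because the D_i commute; the order of a monomial is the
  size of its multiset.\<close>

definition Dmon :: "('r::finite \<Rightarrow> int ^ 'm) \<Rightarrow> 'm multiset \<Rightarrow> 'r oper" where
  "Dmon pd s = fold_mset (\<lambda>i T. Dop pd i \<circ> T) id s"

lemma Dop_add: "Dop pd i (f + g) = Dop pd i f + Dop pd i g"
  by (simp add: Dop_def distrib_left sum.distrib)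

lemma Dop_mult: "Dop pd i (f * g) = f * Dop pd i g + Dop pd i f * g"
  by (simp add: Dop_def log_der_mult distrib_left sum.distrib sum_distrib_left sum_distrib_right
      ac_simps)

lemma Dop_in_Rtilde: "Dop pd i \<in> Rtilde"
  unfolding Dop_def by (intro Rtilde_sum Rtilde_smult Rtilde.der)

lemma Dop_0 [simp]: "Dop pd i 0 = 0"
  by (simp add: Dop_def)

lemma Dop_uminus: "Dop pd i (- f) = - Dop pd i f"
  by (simp add: Dop_def sum_negf)

lemma Dop_diff: "Dop pd i (f - g) = Dop pd i f - Dop pd i g"
  using Dop_add[of pd i f "- g"] by (simp add: Dop_uminus)

lemma Dop_sum: "Dop pd i (sum f S) = (\<Sum>x\<in>S. Dop pd i (f x))"
  by (induction S rule: infinite_finite_induct) (simp_all add: Dop_add)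

lemma Dop_zvar [simp]: "Dop pd i zvar = 0"
  by (simp add: Dop_def log_der_var)

lemma Dop_of_nat [simp]: "Dop pd i (of_nat n) = 0"
  by (simp add: Dop_def)

lemma Dop_of_int [simp]: "Dop pd i (of_int n) = 0"
  by (simp add: Dop_def)

lemma Dop_log_der_commute: "Dop pd i (log_der (Some a) f) = log_der (Some a) (Dop pd i f)"
  by (simp add: Dop_def log_der_sum log_der_mult log_der_commute[of _ a])

lemma Dop_commute: "Dop pd i (Dop pd j f) = Dop pd j (Dop pd i f)"
  unfolding Dop_def[of pd j] by (simp add: Dop_sum Dop_mult Dop_log_der_commute)

lemma Dmon_empty [simp]: "Dmon pd {#} = id"
  by (simp add: Dmon_def)

lemma Dmon_add_mset [simp]: "Dmon pd (add_mset i s) = Dop pd i \<circ> Dmon pd s"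
proof -
  interpret comp_fun_commute "\<lambda>i T. Dop pd i \<circ> T"
    by unfold_locales (simp add: fun_eq_iff Dop_commute)
  show ?thesis by (simp add: Dmon_def)
qed

lemma Dmon_union: "Dmon pd (s + t) = Dmon pd s \<circ> Dmon pd t"
  by (induction s) (simp_all add: comp_assoc)

lemma Dmon_in_Rtilde: "Dmon pd s \<in> Rtilde"
  by (induction s)
     (simp_all only: Dmon_empty Dmon_add_mset Rtilde_id Rtilde.comp Dop_in_Rtilde)

lemma Dmon_Dop_commute: "Dmon pd s (Dop pd i f) = Dop pd i (Dmon pd s f)"
  by (induction s) (simp_all add: Dop_commute)

lemma Dmon_add_arg: "Dmon pd s (f + g) = Dmon pd s f + Dmon pd s g"
  by (rule Rtilde_add_arg[OF Dmon_in_Rtilde])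

lemma Dmon_diff_arg: "Dmon pd s (f - g) = Dmon pd s f - Dmon pd s g"
  using Dmon_add_arg[of pd s "f - g" g] by simp

text \<open>Operators of order strictly less than d, with coefficients on the left. No power of z^2
  d_z occurs, as it is to be eliminated modulo the Euler operator.\<close>

inductive_set Low :: "('r::finite \<Rightarrow> int ^ 'm) \<Rightarrow> nat \<Rightarrow> 'r oper set" for pd d where
  zero: "(\<lambda>f. 0) \<in> Low pd d"
| gen: "size s < d \<Longrightarrow> (\<lambda>f. h * Dmon pd s f) \<in> Low pd d"
| add: "P \<in> Low pd d \<Longrightarrow> Q \<in> Low pd d \<Longrightarrow> (\<lambda>f. P f + Q f) \<in> Low pd d"

lemma Low_mono: "P \<in> Low pd d \<Longrightarrow> d \<le> e \<Longrightarrow> P \<in> Low pd e"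
  by (induction rule: Low.induct) (auto intro: Low.intros)

lemma Low_smult: "P \<in> Low pd d \<Longrightarrow> (\<lambda>f. h * P f) \<in> Low pd d"
proof (induction rule: Low.induct)
  case (gen s k)
  then show ?case using Low.gen[of s d "h * k" pd] by (simp add: mult.assoc)
qed (auto simp: distrib_left intro: Low.zero Low.add)

lemma Low_uminus: "P \<in> Low pd d \<Longrightarrow> (\<lambda>f. - P f) \<in> Low pd d"
  using Low_smult[of P pd d "- 1"] by simp

lemma Low_diff: "P \<in> Low pd d \<Longrightarrow> Q \<in> Low pd d \<Longrightarrow> (\<lambda>f. P f - Q f) \<in> Low pd d"
  using Low.add[OF _ Low_uminus, of P pd d Q] by simp

lemma Low_Dmon: "size s < d \<Longrightarrow> Dmon pd s \<in> Low pd d"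
  using Low.gen[of s d 1 pd] by simp

lemma Low_Dop: "P \<in> Low pd d \<Longrightarrow> (\<lambda>f. Dop pd i (P f)) \<in> Low pd (Suc d)"
proof (induction rule: Low.induct)
  case zero
  then show ?case using Low.zero by simp
next
  case (gen s h)
  have "(\<lambda>f. h * Dmon pd (add_mset i s) f + Dop pd i h * Dmon pd s f) \<in> Low pd (Suc d)"
    using gen by (intro Low.add Low.gen) auto
  then show ?case by (simp add: Dop_mult)
next
  case (add P Q)
  then show ?case using Low.add by (simp add: Dop_add)
qed

lemma Low_Dmon_comp: "P \<in> Low pd d \<Longrightarrow> (\<lambda>f. Dmon pd s (P f)) \<in> Low pd (size s + d)"
proof (induction s)
  case (add i s)
  then show ?case using Low_Dop[of "\<lambda>f. Dmon pd s (P f)" pd "size s + d" i] by simp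
qed simp

text \<open>The commutator of D_i with a function h is the function D_i(h), so moving a factor past
  h leaves only terms of smaller order.\<close>

lemma Dmon_smult:
  "(\<lambda>f. Dmon pd s (h * Dmon pd t f) - h * Dmon pd (s + t) f) \<in> Low pd (size s + size t)"
proof (induction s)
  case empty
  then show ?case using Low.zero by simp
next
  case (add i s)
  have "(\<lambda>f. Dop pd i (Dmon pd s (h * Dmon pd t f) - h * Dmon pd (s + t) f) +
      Dop pd i h * Dmon pd (s + t) f) \<in> Low pd (Suc (size s + size t))"
    using add by (intro Low.add Low_Dop Low.gen) auto
  then show ?case by (simp add: Dop_diff Dop_mult)
qed

section \<open>Leading monomials of the products in the box operators\<close>

definition leads :: "('r::finite \<Rightarrow> int ^ 'm) \<Rightarrow> 'r oper \<Rightarrow> 'm multiset \<Rightarrow> bool" where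
  "leads pd Q s \<longleftrightarrow> (\<lambda>f. Q f - Dmon pd s f) \<in> Low pd (size s)"

lemma box_factor_Dop: "box_factor pd i \<nu> f = Dop pd i f - of_nat \<nu> * zvar * f"
  by (simp add: box_factor_def Dop_def)

lemma leads_id: "leads pd id {#}"
  using Low.zero by (simp add: leads_def)

lemma leads_box_factor:
  assumes "leads pd Q s"
  shows "leads pd (box_factor pd i \<nu> \<circ> Q) (add_mset i s)"
proof -
  define L where "L = (\<lambda>f. Q f - Dmon pd s f)"
  have L: "L \<in> Low pd (size s)" using assms by (simp add: leads_def L_def)
  have "(\<lambda>f. Dop pd i (L f) - ((of_nat \<nu> * zvar) * Dmon pd s f + of_nat \<nu> * zvar * L f))
      \<in> Low pd (Suc (size s))"
    using L by (intro Low_diff Low_Dop Low.add Low.gen Low_smult) (auto intro: Low_mono)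
  then show ?thesis
    by (simp add: leads_def box_factor_Dop L_def Dop_diff algebra_simps)
qed

definition box_block :: "('r::finite \<Rightarrow> int ^ 'm) \<Rightarrow> 'm \<Rightarrow> nat list \<Rightarrow> 'r oper" where
  "box_block pd i xs = foldr (\<lambda>\<nu> T'. box_factor pd i \<nu> \<circ> T') xs id"

lemma leads_box_block:
  "leads pd Q s \<Longrightarrow> leads pd (box_block pd i xs \<circ> Q) (replicate_mset (length xs) i + s)"
proof (induction xs)
  case (Cons \<nu> xs)
  have "box_block pd i (\<nu> # xs) \<circ> Q = box_factor pd i \<nu> \<circ> (box_block pd i xs \<circ> Q)"
    by (simp add: box_block_def fun_eq_iff)
  moreover have "replicate_mset (length (\<nu> # xs)) i + s = add_mset i (replicate_mset (length xs) i + s)"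
    by simp
  ultimately show ?case using leads_box_factor[OF Cons.IH[OF Cons.prems], of i \<nu>] by (simp only:)
qed (simp add: box_block_def)

lemma box_factor_commute: "box_factor pd i \<nu> (box_factor pd j \<mu> f) = box_factor pd j \<mu> (box_factor pd i \<nu> f)"
  by (simp add: box_factor_Dop Dop_diff Dop_mult Dop_commute[of pd i j] algebra_simps)

lemma box_block_factor_commute:
  "box_block pd i xs (box_factor pd j \<mu> f) = box_factor pd j \<mu> (box_block pd i xs f)"
  by (induction xs) (simp_all add: box_block_def box_factor_commute)

lemma box_block_commute: "box_block pd i xs (box_block pd j ys f) = box_block pd j ys (box_block pd i xs f)"
  unfolding box_block_def[of pd j]
  by (induction ys) (simp_all add: box_block_factor_commute)

text \<open>Each factor is D_i up to the term -\<nu> z of order zero. The fold can be unfolded index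
  by index because the blocks commute.\<close>

lemma leads_box_product:
  assumes "finite I"
  shows "leads pd (box_product pd I k) (\<Sum>i\<in>I. replicate_mset (k i) i)"
proof -
  interpret comp_fun_commute "\<lambda>i T. box_block pd i [0..<k i] \<circ> T"
    by unfold_locales (simp add: fun_eq_iff box_block_commute)
  have "box_product pd I k = Finite_Set.fold (\<lambda>i T. box_block pd i [0..<k i] \<circ> T) id I"
    by (simp add: box_product_def box_block_def)
  moreover have "leads pd (Finite_Set.fold (\<lambda>i T. box_block pd i [0..<k i] \<circ> T) id I)
      (\<Sum>i\<in>I. replicate_mset (k i) i)"
    using assms
  proof (induction I rule: finite_induct)
    case (insert i I)
    have "Finite_Set.fold (\<lambda>i T. box_block pd i [0..<k i] \<circ> T) id (insert i I) =
        box_block pd i [0..<k i] \<circ> Finite_Set.fold (\<lambda>i T. box_block pd i [0..<k i] \<circ> T) id I"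
      using insert by (intro fold_insert)
    moreover have "(\<Sum>i\<in>insert i I. replicate_mset (k i) i) =
        replicate_mset (length [0..<k i]) i + (\<Sum>i\<in>I. replicate_mset (k i) i)"
      using insert by simp
    ultimately show ?case using leads_box_block[OF insert.IH, of i "[0..<k i]"] by (simp only:)
  next
    case empty
    show ?case using leads_id by (simp only: fold_empty sum.empty)
  qed
  ultimately show ?thesis by simp
qed

section \<open>The order filtration modulo a left ideal\<close>

definition mod_order :: "'r oper set \<Rightarrow> ('r::finite \<Rightarrow> int ^ 'm) \<Rightarrow> nat \<Rightarrow> 'r oper set" where
  "mod_order G pd d = {P. \<exists>Q\<in>left_ideal G. (\<lambda>f. P f - Q f) \<in> Low pd d}"

lemma mod_orderI: "Q \<in> left_ideal G \<Longrightarrow> (\<lambda>f. P f - Q f) \<in> Low pd d \<Longrightarrow> P \<in> mod_order G pd d"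
  by (auto simp: mod_order_def)

lemma Low_mod_order: "P \<in> Low pd d \<Longrightarrow> P \<in> mod_order G pd d"
  using mod_orderI[OF left_ideal.zero, of P pd d G] by simp

lemma left_ideal_mod_order: "P \<in> left_ideal G \<Longrightarrow> P \<in> mod_order G pd d"
  using mod_orderI[of P G P pd d] Low.zero[of pd d] by simp

lemma mod_order_mono: "P \<in> mod_order G pd d \<Longrightarrow> d \<le> e \<Longrightarrow> P \<in> mod_order G pd e"
  unfolding mod_order_def using Low_mono by blast

lemma mod_order_add:
  assumes "P \<in> mod_order G pd d" "P' \<in> mod_order G pd d"
  shows "(\<lambda>f. P f + P' f) \<in> mod_order G pd d"
proof -
  obtain Q Q' where "Q \<in> left_ideal G" "Q' \<in> left_ideal G"
      "(\<lambda>f. P f - Q f) \<in> Low pd d" "(\<lambda>f. P' f - Q' f) \<in> Low pd d"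
    using assms by (auto simp: mod_order_def)
  then show ?thesis
    using Low.add[of "\<lambda>f. P f - Q f" pd d "\<lambda>f. P' f - Q' f"]
    by (intro mod_orderI[OF left_ideal.add[of Q G Q']]) (simp_all add: algebra_simps)
qed

lemma mod_order_smult:
  assumes "P \<in> mod_order G pd d"
  shows "(\<lambda>f. h * P f) \<in> mod_order G pd d"
proof -
  obtain Q where "Q \<in> left_ideal G" "(\<lambda>f. P f - Q f) \<in> Low pd d"
    using assms by (auto simp: mod_order_def)
  then show ?thesis
    using Low_smult[of "\<lambda>f. P f - Q f" pd d h]
    by (intro mod_orderI[OF left_ideal_smult[of Q G h]]) (simp_all add: algebra_simps)
qed

lemma mod_order_diff:
  assumes "P \<in> mod_order G pd d" "Q \<in> mod_order G pd d"
  shows "(\<lambda>f. P f - Q f) \<in> mod_order G pd d"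
  using mod_order_add[OF assms(1) mod_order_smult[OF assms(2), of "- 1"]] by simp

lemma mod_order_Dop:
  assumes "P \<in> mod_order G pd d"
  shows "(\<lambda>f. Dop pd i (P f)) \<in> mod_order G pd (Suc d)"
proof -
  obtain Q where "Q \<in> left_ideal G" "(\<lambda>f. P f - Q f) \<in> Low pd d"
    using assms by (auto simp: mod_order_def)
  then show ?thesis
    using Low_Dop[of "\<lambda>f. P f - Q f" pd d i]
    by (intro mod_orderI[OF left_ideal_comp[OF _ Dop_in_Rtilde[of pd i], of Q G]])
       (simp_all add: Dop_diff)
qed

text \<open>The monomial of t composed with the box operator lies in the left ideal. Its two leading
  monomials survive; by \<open>le\<close> all other terms have order below N.\<close>

lemma mod_order_box_relation:
  assumes box: "box_operator p pd l \<in> G"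
    and p: "\<And>a. 0 \<le> p a l"
    and N: "size t + size (\<Sum>i | l $ i > 0. replicate_mset (nat (l $ i)) i) = N"
    and le: "size (\<Sum>i | l $ i < 0. replicate_mset (nat (- (l $ i))) i) \<le>
      size (\<Sum>i | l $ i > 0. replicate_mset (nat (l $ i)) i)"
  shows "(\<lambda>f. (\<Prod>a\<in>UNIV. qvar a ^ nat (p a l)) *
        Dmon pd (t + (\<Sum>i | l $ i < 0. replicate_mset (nat (- (l $ i))) i)) f -
      Dmon pd (t + (\<Sum>i | l $ i > 0. replicate_mset (nat (l $ i)) i)) f)
    \<in> mod_order G (pd :: 'r::finite \<Rightarrow> int ^ 'm::finite) N"
proof -
  let ?pos = "\<Sum>i | l $ i > 0. replicate_mset (nat (l $ i)) i"
  let ?neg = "\<Sum>i | l $ i < 0. replicate_mset (nat (- (l $ i))) i"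
  let ?q = "\<Prod>a\<in>UNIV. qvar a ^ nat (p a l)"
  let ?bneg = "box_product pd {i. l $ i < 0} (\<lambda>i. nat (- (l $ i)))"
  let ?bpos = "box_product pd {i. l $ i > 0} (\<lambda>i. nat (l $ i))"
  \<comment> \<open>As all p_a(l) are nonnegative, the whole q-monomial stands in front of the
    negative product and an empty one in front of the positive product.\<close>
  have "(\<Prod>a | p a l > 0. qvar a ^ nat (p a l)) = ?q"
    using p by (intro prod.mono_neutral_left) (auto simp: not_less)
  moreover have "{a. p a l < 0} = {}" using p by (auto simp: not_less)
  ultimately have box_eq: "box_operator p pd l = (\<lambda>f. ?q * ?bneg f - ?bpos f)"
    by (simp add: box_operator_def)
  define L where "L = (\<lambda>f. ?bneg f - Dmon pd ?neg f)"
  define L' where "L' = (\<lambda>f. ?bpos f - Dmon pd ?pos f)"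
  have L: "L \<in> Low pd (size ?neg)" "L' \<in> Low pd (size ?pos)"
    using leads_box_product[of "{i. l $ i < 0}" pd "\<lambda>i. nat (- (l $ i))"]
      leads_box_product[of "{i. l $ i > 0}" pd "\<lambda>i. nat (l $ i)"]
    by (simp_all add: leads_def L_def L'_def)
  \<comment> \<open>The three errors: lower terms of the positive product, the commutator with the
    q-monomial, and lower terms of the negative product.\<close>
  have low: "(\<lambda>f. Dmon pd t (L' f) - (Dmon pd t (?q * Dmon pd ?neg f) - ?q * Dmon pd (t + ?neg) f) -
      Dmon pd t (?q * L f)) \<in> Low pd N"
  proof (rule Low_diff[OF Low_diff])
    show "(\<lambda>f. Dmon pd t (L' f)) \<in> Low pd N" using Low_Dmon_comp[OF L(2), of t] N by simp
    show "(\<lambda>f. Dmon pd t (?q * Dmon pd ?neg f) - ?q * Dmon pd (t + ?neg) f) \<in> Low pd N"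
      using Dmon_smult[of pd t ?q ?neg] by (rule Low_mono) (use N le in simp)
    show "(\<lambda>f. Dmon pd t (?q * L f)) \<in> Low pd N"
      using Low_Dmon_comp[OF Low_smult[OF L(1), of ?q], of t] by (rule Low_mono) (use N le in simp)
  qed
  have bneg: "?bneg f = Dmon pd ?neg f + L f" and bpos: "?bpos f = Dmon pd ?pos f + L' f" for f
    by (simp_all add: L_def L'_def)
  have X: "Dmon pd t \<circ> box_operator p pd l \<in> left_ideal G"
    using box by (intro left_ideal.gen Dmon_in_Rtilde)
  have Y: "(\<lambda>f. ?q * Dmon pd (t + ?neg) f - Dmon pd (t + ?pos) f -
      (Dmon pd t \<circ> box_operator p pd l) f) = (\<lambda>f. Dmon pd t (L' f) -
      (Dmon pd t (?q * Dmon pd ?neg f) - ?q * Dmon pd (t + ?neg) f) - Dmon pd t (?q * L f))"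
    unfolding box_eq bneg bpos
    by (simp add: Dmon_diff_arg Dmon_add_arg Dmon_union distrib_left fun_eq_iff)
  show ?thesis by (rule mod_orderI[OF X]) (simp only: Y low)
qed

section \<open>Expressing all generators of \<open>Rtilde\<close> through the D_i\<close>

lemma log_der_None_Dop: "log_der None (Dop pd i f) = Dop pd i (log_der None f) + zvar * Dop pd i f"
  by (simp add: Dop_def log_der_sum log_der_mult log_der_None_commute distrib_left sum.distrib
      sum_distrib_left ac_simps)

lemma log_der_None_Dmon:
  "log_der None (Dmon pd s f) = Dmon pd s (log_der None f) + of_nat (size s) * zvar * Dmon pd s f"
  by (induction s) (simp_all add: log_der_None_Dop Dop_add Dop_mult algebra_simps)

text \<open>The anticanonical class takes on the dual basis vector of index a the value \<Sum> m_ia,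
  summed over i; exchanging the sums collects the D_i.\<close>

lemma euler_operator_Dop:
  assumes "\<And>a. pd a \<in> rel_lattice A"
  shows "euler_operator A pd f = log_der None f + (\<Sum>i\<in>UNIV. Dop pd i f)"
proof -
  have "(\<Sum>i\<in>UNIV. Dop pd i f) =
      (\<Sum>a\<in>UNIV. \<Sum>i\<in>UNIV. of_int (pd a $ i) * log_der (Some a) f)"
    unfolding Dop_def by (rule sum.swap)
  also have "\<dots> = (\<Sum>a\<in>UNIV. of_int (anticanonical_class A (pd a)) * log_der (Some a) f)"
    using assms by (simp add: divisor_class_def anticanonical_divisor_def sum_distrib_right)
  finally show ?thesis by (simp add: euler_operator_def)
qed

text \<open>The D_i are obtained from the z q_a d/dq_a by the matrix m, and the exponents g provide
  a left inverse of m.\<close>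

lemma log_der_Some_Dop:
  assumes "\<And>a b. (\<Sum>i\<in>UNIV. int (g i a) * pd b $ i) = (if a = b then 1 else 0)"
  shows "log_der (Some a) f = (\<Sum>i\<in>UNIV. of_nat (g i a) * Dop pd i f)"
proof -
  have "(\<Sum>i\<in>UNIV. of_nat (g i a) * Dop pd i f) =
      (\<Sum>i\<in>UNIV. \<Sum>b\<in>UNIV. of_int (int (g i a) * pd b $ i) * log_der (Some b) f)"
    by (simp add: Dop_def sum_distrib_left mult.assoc)
  also have "\<dots> = (\<Sum>b\<in>UNIV. \<Sum>i\<in>UNIV. of_int (int (g i a) * pd b $ i) * log_der (Some b) f)"
    by (rule sum.swap)
  also have "\<dots> = (\<Sum>b\<in>UNIV. of_int (\<Sum>i\<in>UNIV. int (g i a) * pd b $ i) * log_der (Some b) f)"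
    by (simp only: of_int_sum sum_distrib_right)
  also have "\<dots> = (\<Sum>b\<in>UNIV. if a = b then log_der (Some b) f else 0)"
    unfolding assms by (rule sum.cong) auto
  finally show ?thesis by simp
qed

lemma mod_order_sum:
  "(\<And>x. x \<in> S \<Longrightarrow> P x \<in> mod_order G pd d) \<Longrightarrow> (\<lambda>f. \<Sum>x\<in>S. P x f) \<in> mod_order G pd d"
  by (induction S rule: infinite_finite_induct)
     (auto intro: Low_mod_order Low.zero mod_order_add)

text \<open>In a left ideal the Euler operator must stand on the right. So z^2 d_z is commuted to
  the right of h and of the monomial, which does not raise the order, and is replaced there by minus
  the sum of the D_i.\<close>

lemma mod_order_log_der_None:
  assumes pd: "\<And>a. pd a \<in> rel_lattice A" and euler: "euler_operator A pd \<in> G"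
    and P: "P \<in> mod_order G pd d"
  shows "(\<lambda>f. log_der None (P f)) \<in> mod_order G pd (Suc d)"
proof -
  obtain Q where Q: "Q \<in> left_ideal G" "(\<lambda>f. P f - Q f) \<in> Low pd d"
    using P by (auto simp: mod_order_def)
  have low: "(\<lambda>f. log_der None (L f)) \<in> mod_order G pd (Suc d)" if "L \<in> Low pd d" for L
    using that
  proof (induction rule: Low.induct)
    case zero
    then show ?case by (simp add: Low_mod_order Low.zero)
  next
    case (gen s h)
    have "(\<lambda>f. h * (Dmon pd s \<circ> euler_operator A pd) f) \<in> mod_order G pd (Suc d)"
      using euler by (intro mod_order_smult left_ideal_mod_order left_ideal.gen Dmon_in_Rtilde)
    moreover have "(\<lambda>f. \<Sum>i\<in>UNIV. h * Dmon pd (s + {#i#}) f) \<in> mod_order G pd (Suc d)"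
      using gen by (intro mod_order_sum Low_mod_order Low.gen) simp
    moreover have "(\<lambda>f. (h * of_nat (size s) * zvar + log_der None h) * Dmon pd s f)
        \<in> mod_order G pd (Suc d)"
      using gen by (intro Low_mod_order Low.gen) simp
    ultimately have "(\<lambda>f. h * (Dmon pd s \<circ> euler_operator A pd) f -
        (\<Sum>i\<in>UNIV. h * Dmon pd (s + {#i#}) f) +
        (h * of_nat (size s) * zvar + log_der None h) * Dmon pd s f) \<in> mod_order G pd (Suc d)"
      by (intro mod_order_add mod_order_diff)
    moreover have "Dmon pd s (\<Sum>i\<in>S. F i) = (\<Sum>i\<in>S. Dmon pd s (F i))" for S :: "'b set" and F
      by (induction S rule: infinite_finite_induct)
         (simp_all add: Dmon_add_arg Rtilde_0_arg[OF Dmon_in_Rtilde])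
    ultimately show ?case
      by (simp add: euler_operator_Dop[OF pd] log_der_None_Dmon log_der_mult Dmon_add_arg
          Dmon_union Dmon_Dop_commute sum_distrib_left algebra_simps)
  next
    case (add P Q)
    then show ?case using mod_order_add by simp
  qed
  have "(\<lambda>f. (log_der None \<circ> Q) f + log_der None (P f - Q f)) \<in> mod_order G pd (Suc d)"
    by (rule mod_order_add[OF left_ideal_mod_order[OF left_ideal_comp[OF Q(1) Rtilde.der]] low[OF Q(2)]])
  then show ?thesis by simp
qed

text \<open>Multiplications preserve the order modulo the ideal, and each \<open>log_der v\<close>
  raises it by at most one.\<close>

lemma Rtilde_mod_order:
  assumes pd: "\<And>a. pd a \<in> rel_lattice A" and euler: "euler_operator A pd \<in> G"
    and g: "\<And>a b. (\<Sum>i\<in>UNIV. int (g i a) * pd b $ i) = (if a = b then 1 else 0)"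
    and P: "P \<in> Rtilde"
  shows "\<exists>d. P \<in> mod_order G pd d"
proof -
  \<comment> \<open>An arbitrary Q on the right makes the induction pass through compositions; in
    the end Q is the identity.\<close>
  have "\<exists>e. (\<lambda>f. P (Q f)) \<in> mod_order G pd e" if "Q \<in> mod_order G pd d" for Q d
    using P that
  proof (induction arbitrary: Q d rule: Rtilde.induct)
    case (mul h)
    then show ?case using mod_order_smult by blast
  next
    case (der v)
    show ?case
    proof (cases v)
      case None
      then show ?thesis using mod_order_log_der_None[OF pd euler der] by blast
    next
      case (Some a)
      have "(\<lambda>f. \<Sum>i\<in>UNIV. of_nat (g i a) * Dop pd i (Q f)) \<in> mod_order G pd (Suc d)"
        using der by (intro mod_order_sum mod_order_smult mod_order_Dop)
      then show ?thesis using Some by (auto simp: log_der_Some_Dop[OF g])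
    qed
  next
    case (add P P')
    obtain e e' where "(\<lambda>f. P (Q f)) \<in> mod_order G pd e" "(\<lambda>f. P' (Q f)) \<in> mod_order G pd e'"
      using add by blast
    then have "(\<lambda>f. P (Q f)) \<in> mod_order G pd (max e e')" "(\<lambda>f. P' (Q f)) \<in> mod_order G pd (max e e')"
      by (auto intro: mod_order_mono)
    then show ?case using mod_order_add by blast
  next
    case (comp P P')
    then show ?case unfolding o_def by blast
  qed
  moreover have "id \<in> mod_order G pd 1"
    using Low_Dmon[of "{#}" 1 pd] by (simp add: Low_mod_order)
  ultimately show ?thesis by fastforce
qed

text \<open>If multiplication by \<open>F\<close> lowers the order at one degree, powers of \<open>F\<close> lower it at all higher
  degrees, because the commutators of the \<open>D\<^sub>i\<close> with \<open>F\<close> have order zero.\<close>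

lemma mod_order_power:
  assumes N: "N > 0" and F: "\<And>s. size s = N \<Longrightarrow> (\<lambda>f. F * Dmon pd s f) \<in> mod_order G pd N"
    and P: "P \<in> mod_order G pd d"
  shows "\<exists>k. (\<lambda>f. F ^ k * P f) \<in> mod_order G pd N"
proof -
  \<comment> \<open>Besides the monomials of size N covered by the assumption, only monomials of
    order below N occur.\<close>
  have lower: "(\<lambda>f. F * P f) \<in> mod_order G pd N" if P: "P \<in> mod_order G pd (Suc N)" for P
  proof -
    obtain Q where Q: "Q \<in> left_ideal G" "(\<lambda>f. P f - Q f) \<in> Low pd (Suc N)"
      using P by (auto simp: mod_order_def)
    have "(\<lambda>f. F * L f) \<in> mod_order G pd N" if "L \<in> Low pd (Suc N)" for L
      using that
    proof (induction rule: Low.induct)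
      case zero
      then show ?case by (simp add: Low_mod_order Low.zero)
    next
      case (gen s h)
      show ?case
      proof (cases "size s < N")
        case True
        then show ?thesis by (intro mod_order_smult Low_mod_order Low.gen)
      next
        case False
        then have "(\<lambda>f. h * (F * Dmon pd s f)) \<in> mod_order G pd N"
          using gen by (intro mod_order_smult F) simp
        then show ?thesis by (simp add: ac_simps)
      qed
    next
      case (add P Q)
      then show ?case using mod_order_add by (simp add: distrib_left)
    qed
    from this[OF Q(2)] left_ideal_mod_order[OF left_ideal_smult[OF Q(1), of F]]
    have "(\<lambda>f. F * Q f + F * (P f - Q f)) \<in> mod_order G pd N" by (intro mod_order_add)
    then show ?thesis by (simp add: algebra_simps)
  qed
  have mon: "\<exists>k. (\<lambda>f. F ^ k * Dmon pd s f) \<in> mod_order G pd N" for s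
  proof (induction s)
    case empty
    show ?case using N Low_Dmon[of "{#}" N pd] by (intro exI[of _ 0]) (simp add: Low_mod_order id_def)
  next
    case (add i s)
    then obtain k where k: "(\<lambda>f. F ^ k * Dmon pd s f) \<in> mod_order G pd N" by blast
    \<comment> \<open>D_i raises the order of the reduced operator by one and the factor F lowers it
      again. The further factor F ^ k allows the commutator term, which contains D_i(F ^ k), to be
      reduced by the induction hypothesis as well.\<close>
    have "(\<lambda>f. F ^ k * (F * Dop pd i (F ^ k * Dmon pd s f)) -
        (F * Dop pd i (F ^ k)) * (F ^ k * Dmon pd s f)) \<in> mod_order G pd N"
      by (rule mod_order_diff[OF mod_order_smult[OF lower[OF mod_order_Dop[OF k]]] mod_order_smult[OF k]])
    moreover have "F ^ k * (F * Dop pd i (F ^ k * Dmon pd s f)) -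
        (F * Dop pd i (F ^ k)) * (F ^ k * Dmon pd s f) = F ^ (k + 1 + k) * Dmon pd (add_mset i s) f"
      for f
      by (simp add: Dop_mult power_add algebra_simps)
    ultimately show ?case by (intro exI[of _ "k + 1 + k"]) simp
  qed
  have raise: "(\<lambda>f. F ^ (j + k) * P f) \<in> mod_order G pd N"
    if "(\<lambda>f. F ^ k * P f) \<in> mod_order G pd N" for j k P
    using mod_order_smult[OF that, of "F ^ j"] by (simp add: power_add mult.assoc)
  have low: "\<exists>k. (\<lambda>f. F ^ k * L f) \<in> mod_order G pd N" if "L \<in> Low pd d" for L
    using that
  proof (induction rule: Low.induct)
    case zero
    then show ?case by (simp add: Low_mod_order Low.zero)
  next
    case (gen s h)
    obtain k where "(\<lambda>f. F ^ k * Dmon pd s f) \<in> mod_order G pd N" using mon by blast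
    from mod_order_smult[OF this, of h] show ?case
      by (intro exI[of _ k]) (simp add: ac_simps)
  next
    case (add P Q)
    then obtain j k where "(\<lambda>f. F ^ j * P f) \<in> mod_order G pd N" "(\<lambda>f. F ^ k * Q f) \<in> mod_order G pd N"
      by blast
    from mod_order_add[OF raise[OF this(1), of k] raise[OF this(2), of j]]
    show ?case by (intro exI[of _ "k + j"]) (simp add: distrib_left add.commute)
  qed
  obtain Q where Q: "Q \<in> left_ideal G" "(\<lambda>f. P f - Q f) \<in> Low pd d"
    using P by (auto simp: mod_order_def)
  obtain k where k: "(\<lambda>f. F ^ k * (P f - Q f)) \<in> mod_order G pd N" using low[OF Q(2)] by blast
  from mod_order_add[OF k left_ideal_mod_order[OF left_ideal_smult[OF Q(1), of "F ^ k"]]]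
  show ?thesis by (intro exI[of _ k]) (simp add: algebra_simps)
qed

lemma finite_multisets_size: "finite {s :: 'm::finite multiset. size s = n}"
proof (induction n)
  case (Suc n)
  have "{s :: 'm multiset. size s = Suc n} \<subseteq> (\<Union>i. add_mset i ` {s. size s = n})"
  proof
    fix s :: "'m multiset" assume "s \<in> {s. size s = Suc n}"
    then obtain i t where "s = add_mset i t" "size t = n"
      using size_eq_Suc_imp_eq_union[of s n] by auto
    then show "s \<in> (\<Union>i. add_mset i ` {s. size s = n})" by auto
  qed
  moreover have "finite (\<Union>i. add_mset i ` {s :: 'm multiset. size s = n})" using Suc by simp
  ultimately show ?case by (rule finite_subset)
qed simp

lemma Low_eq_sum:
  assumes "P \<in> Low pd d"
  shows "\<exists>r. P = (\<lambda>f. \<Sum>s\<in>{s :: 'm::finite multiset. size s < d}. r s * Dmon pd s f)"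
  using assms
proof (induction rule: Low.induct)
  case zero
  show ?case by (intro exI[of _ "\<lambda>_. 0"]) simp
next
  case (gen s h)
  have "finite {s :: 'm multiset. size s < d}"
  proof -
    have "{s :: 'm multiset. size s < d} = (\<Union>n<d. {s. size s = n})" by auto
    then show ?thesis by (simp add: finite_multisets_size)
  qed
  then show ?case
    using gen by (intro exI[of _ "\<lambda>t. if t = s then h else 0"]) 
        (simp add: fun_eq_iff if_distrib[of "\<lambda>x. x * _"] cong: if_cong)
next
  case (add P Q)
  then obtain r r' where "P = (\<lambda>f. \<Sum>s\<in>{s. size s < d}. r s * Dmon pd s f)"
      "Q = (\<lambda>f. \<Sum>s\<in>{s. size s < d}. r' s * Dmon pd s f)" by blast
  then show ?case by (intro exI[of _ "\<lambda>s. r s + r' s"]) (simp add: distrib_right sum.distrib)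
qed

section \<open>Cones of a smooth complete fan\<close>

lemma lat_add: "lat (u + v) = lat u + lat v"
  and lat_smult: "lat (c *s v) = of_int c *\<^sub>R lat v"
  and lat_0 [simp]: "lat 0 = 0"
  by (simp_all add: lat_def vec_eq_iff)

lemma lat_sum: "lat (sum f S) = (\<Sum>x\<in>S. lat (f x))"
  by (induction S rule: infinite_finite_induct) (simp_all add: lat_add)

lemma lat_eq_iff [simp]: "lat u = lat v \<longleftrightarrow> u = v"
  by (simp add: lat_def vec_eq_iff)

definition dot :: "int ^ 'n \<Rightarrow> int ^ 'n \<Rightarrow> int" where
  "dot u w = (\<Sum>j\<in>UNIV. u $ j * w $ j)"

lemma lat_inner: "lat u \<bullet> lat w = of_int (dot u w)"
  by (simp add: lat_def dot_def inner_vec_def)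

lemma dot_add: "dot u (v + w) = dot u v + dot u w"
  and dot_smult: "dot u (c *s w) = c * dot u w"
  and dot_0 [simp]: "dot u 0 = 0"
  by (simp_all add: dot_def distrib_left sum.distrib sum_distrib_left ac_simps)

lemma dot_sum: "dot u (sum f S) = (\<Sum>x\<in>S. dot u (f x))"
  by (induction S rule: infinite_finite_induct) (simp_all add: dot_add)

lemma ex1_unique: "\<exists>!x. P x \<Longrightarrow> P a \<Longrightarrow> P b \<Longrightarrow> a = b"
  by blast

text \<open>In use, b is a lattice basis and d its dual basis, realised by integer vectors through
  the standard pairing.\<close>

abbreviation expands_in :: "('n \<Rightarrow> int ^ 'n) \<Rightarrow> ('n \<Rightarrow> int ^ 'n) \<Rightarrow> bool" where
  "expands_in b d \<equiv> \<forall>w. w = (\<Sum>k\<in>UNIV. dot (d k) w *s b k)"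

abbreviation dual_vectors :: "('n \<Rightarrow> int ^ 'n) \<Rightarrow> ('n \<Rightarrow> int ^ 'n) \<Rightarrow> bool" where
  "dual_vectors b d \<equiv> \<forall>j k. dot (d k) (b j) = (if j = k then 1 else 0)"

text \<open>For d dual to a lattice basis, these inequalities describe the cone spanned by the basis
  vectors with index in K.\<close>

abbreviation cone_coordinates :: "(real ^ 'n) set \<Rightarrow> ('n \<Rightarrow> int ^ 'n) \<Rightarrow> 'n set \<Rightarrow> bool" where
  "cone_coordinates \<sigma> d K \<equiv> \<forall>x. x \<in> \<sigma> \<longleftrightarrow> (\<forall>k. 0 \<le> lat (d k) \<bullet> x) \<and>
     (\<forall>k. k \<notin> K \<longrightarrow> lat (d k) \<bullet> x = 0)"

lemma lattice_basis_dual: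
  assumes b: "lattice_basis b"
  obtains d :: "'n \<Rightarrow> int ^ 'n" where
    "expands_in b d" "dual_vectors b d"
proof -
  have "\<forall>w. \<exists>c :: 'n \<Rightarrow> int. w = (\<Sum>k\<in>UNIV. c k *s b k)"
    using b unfolding lattice_basis_def by blast
  then obtain c where c: "\<And>w. w = (\<Sum>k\<in>UNIV. c w k *s b k)" by metis
  \<comment> \<open>The k-th coordinate is a linear form; its values on the unit vectors are the
    entries of the integer vector that represents it.\<close>
  define d :: "'n \<Rightarrow> int ^ 'n" where "d k = (\<chi> j. c (axis j 1) k)" for k
  have w: "w = (\<Sum>k\<in>UNIV. dot (d k) w *s b k)" for w
  proof -
    have "w = (\<Sum>j\<in>UNIV. w $ j *s axis j 1)" by (rule basis_expansion[symmetric])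
    also have "\<dots> = (\<Sum>j\<in>UNIV. w $ j *s (\<Sum>k\<in>UNIV. c (axis j 1) k *s b k))"
      using c by simp
    also have "\<dots> = (\<Sum>j\<in>UNIV. \<Sum>k\<in>UNIV. (d k $ j * w $ j) *s b k)"
      by (simp add: d_def vec_eq_iff sum_distrib_left ac_simps)
    also have "\<dots> = (\<Sum>k\<in>UNIV. \<Sum>j\<in>UNIV. (d k $ j * w $ j) *s b k)" by (rule sum.swap)
    also have "\<dots> = (\<Sum>k\<in>UNIV. dot (d k) w *s b k)"
      by (simp add: dot_def vec_eq_iff sum_distrib_right)
    finally show ?thesis .
  qed
  have "dot (d k) (b j) = (if j = k then 1 else 0)" for j k
  proof -
    have "b j = (\<Sum>k\<in>UNIV. (if j = k then 1 else 0) *s b k)"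
      by (simp add: vec_eq_iff if_distrib[of "\<lambda>x. x * _"] cong: if_cong)
    moreover have "\<exists>!c :: 'n \<Rightarrow> int. b j = (\<Sum>k\<in>UNIV. c k *s b k)"
      using b unfolding lattice_basis_def by blast
    ultimately have "(\<lambda>k. dot (d k) (b j)) = (\<lambda>k. if j = k then 1 else 0)"
      using w[of "b j"] by (intro ex1_unique[of "\<lambda>c. b j = (\<Sum>k\<in>UNIV. c k *s b k)"])
    then show ?thesis by (rule fun_cong)
  qed
  then show ?thesis using that w by blast
qed

lemma real_dual_expansion:
  fixes x :: "real ^ 'n" and b d :: "'n \<Rightarrow> int ^ 'n"
  assumes "expands_in b d"
  shows "x = (\<Sum>k\<in>UNIV. (lat (d k) \<bullet> x) *\<^sub>R lat (b k))"
proof -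
  have "axis j 1 = (\<Sum>k\<in>UNIV. of_int (d k $ j) *\<^sub>R lat (b k))" for j
  proof -
    have "axis j 1 = lat (axis j 1)" by (simp add: lat_def axis_def vec_eq_iff)
    also have "axis j 1 = (\<Sum>k\<in>UNIV. dot (d k) (axis j 1) *s b k)" using assms by blast
    also have "\<dots> = (\<Sum>k\<in>UNIV. d k $ j *s b k)"
      by (simp add: dot_def axis_def if_distrib cong: if_cong)
    finally show ?thesis by (simp add: lat_sum lat_smult)
  qed
  note ax = this
  have "x = (\<Sum>j\<in>UNIV. x $ j *\<^sub>R axis j 1)"
    using basis_expansion[of x] by (simp add: scalar_mult_eq_scaleR)
  also have "\<dots> = (\<Sum>j\<in>UNIV. \<Sum>k\<in>UNIV. (of_int (d k $ j) * x $ j) *\<^sub>R lat (b k))"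
    unfolding ax by (simp add: scaleR_sum_right ac_simps)
  also have "\<dots> = (\<Sum>k\<in>UNIV. \<Sum>j\<in>UNIV. (of_int (d k $ j) * x $ j) *\<^sub>R lat (b k))"
    by (rule sum.swap)
  also have "\<dots> = (\<Sum>k\<in>UNIV. (lat (d k) \<bullet> x) *\<^sub>R lat (b k))"
    by (simp add: lat_def inner_vec_def scaleR_sum_left)
  finally show ?thesis .
qed

lemma convex_cone_hull_sum:
  assumes "finite K" "\<And>k. k \<in> K \<Longrightarrow> 0 \<le> t k" "\<And>k. k \<in> K \<Longrightarrow> v k \<in> convex_cone hull S"
  shows "(\<Sum>k\<in>K. t k *\<^sub>R v k) \<in> convex_cone hull S"
  using assms
  by (induction K rule: finite_induct)
     (auto simp: convex_cone_hull_contains_0 intro!: convex_cone_hull_add convex_cone_hull_mul)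

lemma convex_cone_hull_singleton: "convex_cone hull {v} = {s *\<^sub>R v | s. 0 \<le> s}"
proof (rule hull_unique)
  have "v = 1 *\<^sub>R v" by simp
  then show "{v} \<subseteq> {s *\<^sub>R v | s. 0 \<le> s}" by (metis (mono_tags) empty_subsetI insert_subset mem_Collect_eq zero_le_one)
  show "convex_cone {s *\<^sub>R v | s. 0 \<le> s}"
    unfolding convex_cone_iff
    by (auto intro: exI[of _ 0] simp flip: scaleR_add_left)
  fix T assume "{v} \<subseteq> T" "convex_cone T"
  then show "{s *\<^sub>R v | s. 0 \<le> s} \<subseteq> T" by (auto intro: convex_cone_scaleR)
qed

lemma smooth_cone_iff:
  fixes b d :: "'n \<Rightarrow> int ^ 'n"
  assumes d: "expands_in b d"
    "dual_vectors b d"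
  shows "x \<in> convex_cone hull ((\<lambda>k. lat (b k)) ` K) \<longleftrightarrow>
    (\<forall>k. 0 \<le> lat (d k) \<bullet> x) \<and> (\<forall>k. k \<notin> K \<longrightarrow> lat (d k) \<bullet> x = 0)"
proof
  assume "x \<in> convex_cone hull ((\<lambda>k. lat (b k)) ` K)"
  then show "(\<forall>k. 0 \<le> lat (d k) \<bullet> x) \<and> (\<forall>k. k \<notin> K \<longrightarrow> lat (d k) \<bullet> x = 0)"
  proof (rule hull_induct)
    fix x assume "x \<in> (\<lambda>k. lat (b k)) ` K"
    then show "(\<forall>k. 0 \<le> lat (d k) \<bullet> x) \<and> (\<forall>k. k \<notin> K \<longrightarrow> lat (d k) \<bullet> x = 0)"
      using d(2) by (auto simp: lat_inner)
  next
    show "convex_cone {x. (\<forall>k. 0 \<le> lat (d k) \<bullet> x) \<and> (\<forall>k. k \<notin> K \<longrightarrow> lat (d k) \<bullet> x = 0)}"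
      unfolding convex_cone_iff by (auto simp: inner_add_right)
  qed
next
  assume r: "(\<forall>k. 0 \<le> lat (d k) \<bullet> x) \<and> (\<forall>k. k \<notin> K \<longrightarrow> lat (d k) \<bullet> x = 0)"
  have "x = (\<Sum>k\<in>UNIV. (lat (d k) \<bullet> x) *\<^sub>R lat (b k))" by (rule real_dual_expansion[OF d(1)])
  also have "\<dots> = (\<Sum>k\<in>K. (lat (d k) \<bullet> x) *\<^sub>R lat (b k))"
    using r by (intro sum.mono_neutral_right) auto
  also have "\<dots> \<in> convex_cone hull ((\<lambda>k. lat (b k)) ` K)"
    using r by (intro convex_cone_hull_sum) (auto intro: hull_inc)
  finally show "x \<in> convex_cone hull ((\<lambda>k. lat (b k)) ` K)" .
qed

section \<open>Rays and cones of a smooth complete fan\<close>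

locale smooth_complete_fan =
  fixes F :: "(real ^ 'n) set set" and A :: "'m::finite \<Rightarrow> int ^ 'n"
  assumes fan: "fan F" and rays: "primitive_ray_generators F A"
    and smooth: "smooth_fan F" and complete: "complete_fan F"
begin

lemma coneE:
  assumes "\<sigma> \<in> F"
  obtains b d :: "'n \<Rightarrow> int ^ 'n" and K where "expands_in b d"
    "dual_vectors b d"
    "cone_coordinates \<sigma> d K"
proof -
  obtain b K where b: "lattice_basis b" "\<sigma> = convex_cone hull ((\<lambda>k. lat (b k)) ` K)"
    using smooth assms unfolding smooth_fan_def by blast
  obtain d where d: "expands_in b d"
      "dual_vectors b d"
    using b(1) by (rule lattice_basis_dual)
  show ?thesis by (rule that[OF d, of K]) (simp add: b(2) smooth_cone_iff[OF d])
qed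

lemma convex_cone_cone: "\<sigma> \<in> F \<Longrightarrow> convex_cone \<sigma>"
  using smooth unfolding smooth_fan_def by (metis convex_cone_convex_cone_hull)

lemma closed_cone: "\<sigma> \<in> F \<Longrightarrow> closed \<sigma>"
  using smooth unfolding smooth_fan_def by (metis closed_convex_cone_hull finite finite_imageI)

lemma ray_in_fan: "convex_cone hull {lat (A i)} \<in> F"
  using rays unfolding primitive_ray_generators_def by blast

lemma A_nonzero: "A i \<noteq> 0"
proof
  assume "A i = 0"
  then have "Gcd (range (($) (A i))) = 0" by (simp add: Gcd_0_iff image_subset_iff)
  then show False using rays unfolding primitive_ray_generators_def by simp
qed

text \<open>The ray of A i is a face of \<sigma>, so it contains the ends of every segment in
  \<sigma> with A i in its interior. Splitting off one coordinate gives such a segment and forces A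
  i to be a multiple of one b k; primitivity makes the factor 1.\<close>

lemma A_in_cone:
  fixes b d :: "'n \<Rightarrow> int ^ 'n"
  assumes \<sigma>: "\<sigma> \<in> F" and A: "lat (A i) \<in> \<sigma>"
    and d: "expands_in b d"
    "dual_vectors b d"
    and mem: "cone_coordinates \<sigma> d K"
  obtains k where "k \<in> K" "A i = b k"
proof -
  define c where "c k = dot (d k) (A i)" for k
  have dl: "lat (d k) \<bullet> lat (b j) = (if j = k then 1 else 0)" for j k
    using d(2) by (simp add: lat_inner)
  have c: "lat (d k) \<bullet> lat (A i) = of_int (c k)" for k by (simp add: lat_inner c_def)
  have "\<forall>k. 0 \<le> lat (d k) \<bullet> lat (A i)" "\<forall>k. k \<notin> K \<longrightarrow> lat (d k) \<bullet> lat (A i) = 0"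
    using A mem by blast+
  then have c_nonneg: "0 \<le> c k" and c_off: "k \<notin> K \<Longrightarrow> c k = 0" for k
    unfolding c by simp_all
  have Asum: "A i = (\<Sum>k\<in>UNIV. c k *s b k)" using d(1) by (simp add: c_def)
  have "\<exists>k. c k \<noteq> 0"
  proof (rule ccontr)
    assume "\<nexists>k. c k \<noteq> 0"
    then show False using Asum A_nonzero[of i] by simp
  qed
  then obtain k where k: "c k \<noteq> 0" by blast
  then have kK: "k \<in> K" and ck: "c k > 0" using c_off c_nonneg[of k] by auto
  let ?\<rho> = "convex_cone hull {lat (A i)}"
  have sub: "?\<rho> \<subseteq> \<sigma>"
    using A convex_cone_cone[OF \<sigma>] by (intro hull_minimal) auto
  have "(\<sigma> \<inter> ?\<rho>) face_of \<sigma>"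
    using fan \<sigma> ray_in_fan[of i] unfolding fan_def by blast
  then have face: "?\<rho> face_of \<sigma>" using sub by (simp add: Int_absorb1)
  \<comment> \<open>A i is the midpoint of y and r: y doubles the k-th coordinate and drops all
    others, r does the opposite.\<close>
  define y where "y = (2 * of_int (c k)) *\<^sub>R lat (b k)"
  define r where "r = 2 *\<^sub>R lat (A i) - y"
  have dy: "lat (d j) \<bullet> y = (if j = k then 2 * of_int (c k) else 0)" for j
    by (simp add: y_def dl)
  have dr: "lat (d j) \<bullet> r = (if j = k then 0 else 2 * of_int (c j))" for j
    by (simp add: r_def inner_diff_right dy c)
  have y: "y \<in> \<sigma>" and r: "r \<in> \<sigma>"
    using mem dy dr kK ck c_nonneg c_off by auto
  have "y \<noteq> r" using dy[of k] dr[of k] ck by auto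
  moreover have "lat (A i) = (1 - 1/2) *\<^sub>R y + (1/2) *\<^sub>R r"
    by (simp add: r_def algebra_simps)
  ultimately have "lat (A i) \<in> open_segment y r"
    unfolding in_segment by (intro conjI exI[of _ "1/2"]) simp_all
  moreover have "lat (A i) \<in> ?\<rho>" by (simp add: hull_inc)
  ultimately have "y \<in> ?\<rho>" using face y r unfolding face_of_def by blast
  then obtain s where s: "y = s *\<^sub>R lat (A i)" "0 \<le> s"
    unfolding convex_cone_hull_singleton by blast
  have "s \<noteq> 0" using s dy[of k] ck by auto
  have off: "c j = 0" if "j \<noteq> k" for j
    using dy[of j] c[of j] that \<open>s \<noteq> 0\<close> by (simp add: s(1))
  have "A i = (\<Sum>j\<in>UNIV. if j = k then c k *s b k else 0)"
    unfolding Asum by (rule sum.cong) (auto simp: off)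
  then have Ak: "A i = c k *s b k" by simp
  then have "c k dvd A i $ j" for j by simp
  then have "c k dvd Gcd (range (($) (A i)))" by (intro Gcd_greatest) auto
  then have "c k dvd 1" using rays unfolding primitive_ray_generators_def by simp
  then have "c k = 1" using ck by simp
  then show ?thesis using that kK Ak by simp
qed

text \<open>The ray of b k is cut out of \<sigma> by a supporting hyperplane, hence a cone of the
  fan. Its generator A j is a basis vector by \<open>A_in_cone\<close>, and the only one on this ray
  is b k.\<close>

lemma basis_vector_is_ray:
  fixes b d :: "'n \<Rightarrow> int ^ 'n"
  assumes \<sigma>: "\<sigma> \<in> F" and k: "k \<in> K"
    and d: "expands_in b d"
    "dual_vectors b d"
    and mem: "cone_coordinates \<sigma> d K"
  obtains j where "A j = b k"
proof -
  let ?\<tau> = "convex_cone hull {lat (b k)}"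
  have dl: "lat (d k) \<bullet> lat (b j) = (if j = k then 1 else 0)" for j k
    using d(2) by (simp add: lat_inner)
  \<comment> \<open>On \<sigma> all coordinates are nonnegative, so w vanishes there only if every
    coordinate except the k-th does.\<close>
  define w where "w = (\<Sum>j\<in>UNIV - {k}. lat (d j))"
  have w: "w \<bullet> x = (\<Sum>j\<in>UNIV - {k}. lat (d j) \<bullet> x)" for x by (simp add: w_def inner_sum_left)
  have "?\<tau> = \<sigma> \<inter> {x. w \<bullet> x = 0}"
  proof (intro subset_antisym subsetI)
    fix x assume "x \<in> ?\<tau>"
    then obtain s where s: "x = s *\<^sub>R lat (b k)" "0 \<le> s"
      unfolding convex_cone_hull_singleton by blast
    then show "x \<in> \<sigma> \<inter> {x. w \<bullet> x = 0}" using mem k by (auto simp: dl w)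
  next
    fix x assume x: "x \<in> \<sigma> \<inter> {x. w \<bullet> x = 0}"
    then have nn: "\<forall>j. 0 \<le> lat (d j) \<bullet> x" using mem by blast
    have "(\<Sum>j\<in>UNIV - {k}. lat (d j) \<bullet> x) = 0" using x w[of x] by simp
    then have "\<forall>j\<in>UNIV - {k}. lat (d j) \<bullet> x = 0" using nn by (simp add: sum_nonneg_eq_0_iff)
    then have z: "lat (d j) \<bullet> x = 0" if "j \<noteq> k" for j using that by blast
    have "x = (\<Sum>j\<in>UNIV. (lat (d j) \<bullet> x) *\<^sub>R lat (b j))" by (rule real_dual_expansion[OF d(1)])
    also have "\<dots> = (\<Sum>j\<in>UNIV. if j = k then (lat (d k) \<bullet> x) *\<^sub>R lat (b k) else 0)"
      by (rule sum.cong) (auto simp: z)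
    finally have "x = (lat (d k) \<bullet> x) *\<^sub>R lat (b k)" by simp
    then show "x \<in> ?\<tau>" using nn unfolding convex_cone_hull_singleton by blast
  qed
  moreover have "(\<sigma> \<inter> {x. w \<bullet> x = 0}) face_of \<sigma>"
  proof (rule face_of_Int_supporting_hyperplane_ge)
    show "convex \<sigma>" using convex_cone_cone[OF \<sigma>] by (simp add: convex_cone_def)
    show "0 \<le> w \<bullet> x" if "x \<in> \<sigma>" for x using mem that by (auto simp: w intro: sum_nonneg)
  qed
  ultimately have face: "?\<tau> face_of \<sigma>" by simp
  have \<tau>F: "?\<tau> \<in> F"
    using fan \<sigma> face convex_cone_hull_nonempty[of "{lat (b k)}"] unfolding fan_def by blast
  have "lat (b k) \<noteq> 0" using dl[of k k] by auto
  have "dim ?\<tau> = 1"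
  proof -
    have "span ?\<tau> = span {lat (b k)}"
    proof (rule span_eq[THEN iffD2], intro conjI subsetI)
      fix x assume "x \<in> ?\<tau>"
      then show "x \<in> span {lat (b k)}"
        unfolding convex_cone_hull_singleton by (auto intro: span_scale span_base)
    next
      fix x assume "x \<in> {lat (b k)}"
      then show "x \<in> span ?\<tau>" by (auto intro: span_base hull_inc)
    qed
    then have "dim ?\<tau> = dim {lat (b k)}" by (metis dim_span)
    then show ?thesis using \<open>lat (b k) \<noteq> 0\<close> by simp
  qed
  then have "?\<tau> \<in> {\<sigma>\<in>F. dim \<sigma> = 1}" using \<tau>F by simp
  also have "{\<sigma>\<in>F. dim \<sigma> = 1} = range (\<lambda>i. convex_cone hull {lat (A i)})"
    using rays unfolding primitive_ray_generators_def by blast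
  finally obtain j where j: "?\<tau> = convex_cone hull {lat (A j)}" by blast
  then have A\<tau>: "lat (A j) \<in> ?\<tau>" by (simp add: hull_inc)
  then have "lat (A j) \<in> \<sigma>" using face face_of_imp_subset by blast
  then obtain k' where k': "k' \<in> K" "A j = b k'" by (rule A_in_cone[OF \<sigma> _ d mem])
  obtain s where s: "lat (A j) = s *\<^sub>R lat (b k)" using A\<tau> unfolding convex_cone_hull_singleton by blast
  have "k' = k"
  proof (rule ccontr)
    assume "k' \<noteq> k"
    then have "lat (d k') \<bullet> lat (A j) = 0" unfolding s by (simp add: dl)
    then show False using k'(2) dl by simp
  qed
  then show ?thesis using that k'(2) by blast
qed

lemma A_inj: "A i = A j \<Longrightarrow> i = j"
  using rays unfolding primitive_ray_generators_def inj_def by blast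

text \<open>Rays in a common cone belong to a lattice basis, and u is the dual vector of A i. The
  linear relation between the D_j defined by u thus expresses D_i by factors outside I.\<close>

lemma face_dual_vector:
  assumes \<sigma>: "\<sigma> \<in> F" and I: "\<forall>i\<in>I. lat (A i) \<in> \<sigma>" and i: "i \<in> I"
  obtains u where "dot u (A i) = 1" "\<forall>j\<in>I - {i}. dot u (A j) = 0"
proof -
  obtain b d :: "'n \<Rightarrow> int ^ 'n" and K where d: "expands_in b d"
      "dual_vectors b d"
    and mem: "cone_coordinates \<sigma> d K"
    using \<sigma> by (rule coneE)
  have "lat (A i) \<in> \<sigma>" using I i by blast
  then obtain k where k: "A i = b k" by (rule A_in_cone[OF \<sigma> _ d mem])
  have "dot (d k) (A j) = 0" if j: "j \<in> I - {i}" for j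
  proof -
    have "lat (A j) \<in> \<sigma>" using I j by blast
    then obtain k' where "A j = b k'" by (rule A_in_cone[OF \<sigma> _ d mem])
    moreover have "k' \<noteq> k" using A_inj[of i j] k j calculation by auto
    ultimately show ?thesis using d(2) by simp
  qed
  then show ?thesis using that[of "d k"] k d(2) by simp
qed

lemma cone_point_expansion:
  assumes \<sigma>: "\<sigma> \<in> F" and w: "lat w \<in> \<sigma>"
  obtains c :: "'m \<Rightarrow> int" where "\<forall>j. 0 \<le> c j" "\<forall>j. c j \<noteq> 0 \<longrightarrow> lat (A j) \<in> \<sigma>"
    "w = (\<Sum>j\<in>UNIV. c j *s A j)"
proof -
  obtain b d :: "'n \<Rightarrow> int ^ 'n" and K where d: "expands_in b d"
      "dual_vectors b d"
    and mem: "cone_coordinates \<sigma> d K"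
    using \<sigma> by (rule coneE)
  have "\<forall>k\<in>K. \<exists>j. A j = b k" using basis_vector_is_ray[OF \<sigma> _ d mem] by metis
  then obtain \<iota> where \<iota>: "\<And>k. k \<in> K \<Longrightarrow> A (\<iota> k) = b k" by metis
  \<comment> \<open>Summing over all k with \<iota> k = j makes it possible to work without the
    injectivity of \<iota>.\<close>
  define c where "c j = (\<Sum>k\<in>K. if j = \<iota> k then dot (d k) w else 0)" for j
  have nn: "0 \<le> dot (d k) w" and off: "k \<notin> K \<Longrightarrow> dot (d k) w = 0" for k
    using w mem by (auto simp: lat_inner)
  have "w = (\<Sum>k\<in>UNIV. dot (d k) w *s b k)" using d(1) by blast
  also have "\<dots> = (\<Sum>k\<in>K. dot (d k) w *s b k)"
    using off by (intro sum.mono_neutral_right) auto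
  also have "\<dots> = (\<Sum>k\<in>K. \<Sum>j\<in>UNIV. if j = \<iota> k then dot (d k) w *s A j else 0)"
    by (rule sum.cong) (auto simp: \<iota>)
  also have "\<dots> = (\<Sum>j\<in>UNIV. \<Sum>k\<in>K. if j = \<iota> k then dot (d k) w *s A j else 0)"
    by (rule sum.swap)
  also have "\<dots> = (\<Sum>j\<in>UNIV. c j *s A j)"
    by (rule sum.cong)
       (auto simp: c_def vec_eq_iff sum_distrib_right if_distrib[of "\<lambda>x. x * _"]
         if_distrib[of "\<lambda>x. x $ _"] cong: if_cong)
  finally have "w = (\<Sum>j\<in>UNIV. c j *s A j)" .
  moreover have "0 \<le> c j" for j using nn by (auto simp: c_def intro: sum_nonneg)
  moreover have "lat (A j) \<in> \<sigma>" if cj: "c j \<noteq> 0" for j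
  proof -
    have "\<exists>k\<in>K. j = \<iota> k"
    proof (rule ccontr)
      assume "\<not> (\<exists>k\<in>K. j = \<iota> k)"
      then have "c j = 0" unfolding c_def by (intro sum.neutral) auto
      then show False using cj by simp
    qed
    then obtain k where "k \<in> K" "j = \<iota> k" by blast
    then show ?thesis using \<iota>[of k] mem d(2) by (auto simp: lat_inner)
  qed
  ultimately show ?thesis using that by blast
qed

text \<open>The cones of full dimension have a closed union. Its complement is open and covered by
  finitely many cones of smaller dimension, which are negligible, so it is empty.\<close>

lemma full_dim_cone_exists:
  obtains \<sigma> where "\<sigma> \<in> F" "dim \<sigma> = CARD('n)" "x \<in> \<sigma>"
proof -
  let ?C = "\<Union>{\<sigma>\<in>F. dim \<sigma> = CARD('n)}" and ?L = "\<Union>{\<sigma>\<in>F. dim \<sigma> \<noteq> CARD('n)}"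
  have fin: "finite F" using fan by (simp add: fan_def)
  have "closed ?C" using fin closed_cone by (intro closed_Union) auto
  moreover have "negligible ?L"
  proof (intro negligible_Union)
    fix \<sigma> assume "\<sigma> \<in> {\<sigma>\<in>F. dim \<sigma> \<noteq> CARD('n)}"
    moreover have "dim \<sigma> \<le> DIM(real ^ 'n)" by (rule dim_subset_UNIV)
    ultimately show "negligible \<sigma>" by (intro negligible_lowdim) simp
  qed (use fin in simp)
  moreover have "- ?C \<subseteq> ?L" using complete unfolding complete_fan_def by blast
  ultimately have "- ?C = {}"
    using open_not_negligible[of "- ?C"] negligible_subset[of ?L "- ?C"] by (auto simp: open_Compl)
  then show ?thesis using that by blast
qed

text \<open>In a fan \<sigma> would be a proper face of \<tau>, and proper faces have smaller
  dimension.\<close>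

lemma full_dim_maximal:
  assumes "\<sigma> \<in> F" "dim \<sigma> = CARD('n)" "\<tau> \<in> F" "\<sigma> \<subseteq> \<tau>"
  shows "\<tau> = \<sigma>"
proof (rule ccontr)
  assume "\<tau> \<noteq> \<sigma>"
  have "(\<tau> \<inter> \<sigma>) face_of \<tau>" using fan assms unfolding fan_def by blast
  then have "\<sigma> face_of \<tau>" using assms(4) by (simp add: Int_absorb1)
  moreover have "convex \<tau>" using convex_cone_cone[OF assms(3)] by (simp add: convex_cone_def)
  ultimately have "aff_dim \<sigma> < aff_dim \<tau>"
    using face_of_aff_dim_lt \<open>\<tau> \<noteq> \<sigma>\<close> by metis
  moreover have "aff_dim \<rho> = int (dim \<rho>)" if "\<rho> \<in> F" for \<rho>
    using convex_cone_contains_0[OF convex_cone_cone[OF that]] by (intro aff_dim_zero hull_inc)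
  then have "aff_dim \<sigma> = int (dim \<sigma>)" "aff_dim \<tau> = int (dim \<tau>)" using assms by blast+
  moreover have "dim \<tau> \<le> DIM(real ^ 'n)" by (rule dim_subset_UNIV)
  ultimately show False using assms(2) by simp
qed

section \<open>Support functions of divisors and their concavity\<close>

lemma support_function_scale:
  assumes "support_function F A u \<psi>" "0 \<le> s"
  shows "\<psi> (s *\<^sub>R x) = s * \<psi> x"
proof -
  obtain \<sigma> where \<sigma>: "\<sigma> \<in> F" "x \<in> \<sigma>" using complete unfolding complete_fan_def by blast
  then obtain v where "\<forall>x\<in>\<sigma>. \<psi> x = v \<bullet> x" using assms(1) unfolding support_function_def by blast
  moreover have "s *\<^sub>R x \<in> \<sigma>" using convex_cone_scaleR[OF convex_cone_cone] \<sigma> assms(2) by blast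
  ultimately show ?thesis using \<sigma>(2) by simp
qed

lemma support_function_superadditive:
  assumes \<psi>: "support_function F A u \<psi>" and concave: "concave_on UNIV \<psi>" and "finite I"
  shows "(\<Sum>i\<in>I. \<psi> (f i)) \<le> \<psi> (\<Sum>i\<in>I. f i)"
  using assms(3)
proof (induction I rule: finite_induct)
  case empty
  show ?case using support_function_scale[OF \<psi>, of 0 0] by simp
next
  case (insert i I)
  have "\<psi> x + \<psi> y \<le> \<psi> (x + y)" for x y
  proof -
    have "(1 - 1/2) * \<psi> x + 1/2 * \<psi> y \<le> \<psi> ((1 - 1/2) *\<^sub>R x + (1/2) *\<^sub>R y)"
      by (rule concave_onD[OF concave]) auto
    also have "(1 - 1/2) *\<^sub>R x + (1/2) *\<^sub>R y = (1/2) *\<^sub>R (x + y)" by (simp add: algebra_simps)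
    also have "\<psi> \<dots> = 1/2 * \<psi> (x + y)" by (rule support_function_scale[OF \<psi>]) simp
    finally show ?thesis by simp
  qed
  from this[of "f i" "sum f I"] show ?case using insert by simp
qed

text \<open>Moving slightly from an interior point x of \<sigma> towards y one stays in \<sigma>,
  where \<psi> agrees with v; concavity along this segment gives the estimate at y.\<close>

lemma ample_support_le:
  assumes \<sigma>: "\<sigma> \<in> F" "dim \<sigma> = CARD('n)" and concave: "concave_on UNIV \<psi>"
    and v: "\<forall>x\<in>\<sigma>. \<psi> x = v \<bullet> x"
  shows "\<psi> y \<le> v \<bullet> y"
proof -
  obtain b d :: "'n \<Rightarrow> int ^ 'n" and K where d: "expands_in b d"
      "dual_vectors b d"
    and mem: "cone_coordinates \<sigma> d K"
    using \<sigma>(1) by (rule coneE)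
  have dl: "lat (d k) \<bullet> lat (b j) = (if j = k then 1 else 0)" for j k
    using d(2) by (simp add: lat_inner)
  \<comment> \<open>A coordinate vanishing on \<sigma> would confine a cone of full dimension to a
    hyperplane.\<close>
  have K: "k \<in> K" for k
  proof (rule ccontr)
    assume "k \<notin> K"
    then have "\<sigma> \<subseteq> {x. lat (d k) \<bullet> x = 0}" using mem by blast
    then have "dim \<sigma> \<le> dim {x. lat (d k) \<bullet> x = 0}" by (rule dim_subset)
    moreover have "lat (d k) \<noteq> 0" using dl[of k k] by auto
    then have "dim {x. lat (d k) \<bullet> x = 0} = DIM(real ^ 'n) - 1" by (rule dim_hyperplane)
    moreover have "DIM(real ^ 'n) = CARD('n)" by simp
    moreover have "0 < CARD('n)" by (rule zero_less_card_finite)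
    ultimately show False using \<sigma>(2) by linarith
  qed
  define x where "x = (\<Sum>k\<in>UNIV. lat (b k))"
  have dx: "lat (d k) \<bullet> x = 1" for k by (simp add: x_def inner_sum_right dl)
  define S where "S = (\<Sum>k\<in>UNIV. \<bar>lat (d k) \<bullet> y - 1\<bar>)"
  \<comment> \<open>Small enough for all coordinates 1 + e * (y_k - 1) of z to be nonnegative; the
    summand 1 covers the case S = 0.\<close>
  define e where "e = 1 / (1 + S)"
  have S: "0 \<le> S" "\<And>k. \<bar>lat (d k) \<bullet> y - 1\<bar> \<le> S"
    unfolding S_def by (auto intro: sum_nonneg member_le_sum)
  then have e: "0 < e" "e \<le> 1" "e * S \<le> 1" by (auto simp: e_def)
  define z where "z = (1 - e) *\<^sub>R x + e *\<^sub>R y"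
  have "0 \<le> lat (d k) \<bullet> z" for k
  proof -
    have "lat (d k) \<bullet> z = 1 + e * (lat (d k) \<bullet> y - 1)"
      by (simp add: z_def inner_add_right dx algebra_simps)
    moreover have "e * \<bar>lat (d k) \<bullet> y - 1\<bar> \<le> 1"
      using mult_left_mono[OF S(2)[of k], of e] e by linarith
    then have "- 1 \<le> e * (lat (d k) \<bullet> y - 1)"
      using abs_ge_minus_self[of "e * (lat (d k) \<bullet> y - 1)"] e(1) by (simp add: abs_mult)
    ultimately show ?thesis by linarith
  qed
  then have "z \<in> \<sigma>" "x \<in> \<sigma>" using mem K dx by auto
  then have "\<psi> z = v \<bullet> z" "\<psi> x = v \<bullet> x" using v by auto
  moreover have "(1 - e) * \<psi> x + e * \<psi> y \<le> \<psi> z"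
    unfolding z_def using e by (intro concave_onD[OF concave]) auto
  ultimately have "e * \<psi> y \<le> e * (v \<bullet> y)" by (simp add: z_def inner_add_right)
  then show ?thesis using e(1) by simp
qed

text \<open>Both inequalities follow from one formula: u paired with l gives \<psi>(w) minus the sum
  of the \<psi>(A i), i in I, because \<psi>(A i) = - u_i and \<psi> is linear on the cone \<sigma>
  that contains w.\<close>

lemma nonface_relation:
  assumes I: "\<not> (\<exists>\<sigma>\<in>F. \<forall>i\<in>I. lat (A i) \<in> \<sigma>)"
  obtains l where "l \<in> rel_lattice A" "l \<noteq> 0" "\<forall>i. 0 < l $ i \<longrightarrow> i \<in> I \<and> l $ i = 1"
    "\<forall>u. nef_divisor F A u \<longrightarrow> 0 \<le> (\<Sum>i\<in>UNIV. u $ i * l $ i)"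
    "fano F A \<longrightarrow> 0 < (\<Sum>i\<in>UNIV. l $ i)"
proof -
  define w where "w = (\<Sum>i\<in>I. A i)"
  \<comment> \<open>Full dimension matters for the strict inequality: ampleness speaks about maximal
    cones only.\<close>
  obtain \<sigma> where \<sigma>: "\<sigma> \<in> F" "dim \<sigma> = CARD('n)" "lat w \<in> \<sigma>" by (rule full_dim_cone_exists)
  obtain c :: "'m \<Rightarrow> int" where c: "\<forall>j. 0 \<le> c j" "\<forall>j. c j \<noteq> 0 \<longrightarrow> lat (A j) \<in> \<sigma>"
      "w = (\<Sum>j\<in>UNIV. c j *s A j)"
    by (rule cone_point_expansion[OF \<sigma>(1,3)])
  define l :: "int ^ 'm" where "l = (\<chi> i. (if i \<in> I then 1 else 0) - c i)"
  have "(\<Sum>i\<in>UNIV. (l $ i) *s A i) = (\<Sum>i\<in>UNIV. (if i \<in> I then A i else 0) - c i *s A i)"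
    by (rule sum.cong) (auto simp: l_def vec_eq_iff algebra_simps)
  also have "\<dots> = 0"
    using c(3) by (simp add: sum_subtractf w_def sum.If_cases)
  finally have 1: "l \<in> rel_lattice A" by (simp add: rel_lattice_def)
  have 2: "l \<noteq> 0"
  proof
    assume "l = 0"
    then have l0: "l $ i = 0" for i by simp
    \<comment> \<open>Then all rays of I would occur in the expansion of w and lie in
      \<sigma>.\<close>
    have "c i = 1" if "i \<in> I" for i using l0[of i] that by (simp add: l_def)
    then show False using I \<sigma>(1) c(2) by force
  qed
  have 3: "\<forall>i. 0 < l $ i \<longrightarrow> i \<in> I \<and> l $ i = 1"
    using c(1) by (auto simp: l_def split: if_splits) (metis add_le_same_cancel2 diff_gt_0_iff_gt
        not_le order_antisym_conv zle_diff1_eq diff_self diff_0_right zless_imp_add1_zle add_0)+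
  have key: "of_int (\<Sum>i\<in>UNIV. u $ i * l $ i) = \<psi> (lat w) - (\<Sum>i\<in>I. \<psi> (lat (A i)))"
    if \<psi>: "support_function F A u \<psi>" for u \<psi>
  proof -
    obtain v where v: "\<forall>x\<in>\<sigma>. \<psi> x = v \<bullet> x" using \<psi> \<sigma>(1) unfolding support_function_def by blast
    have u: "of_int (u $ i) = - \<psi> (lat (A i))" for i using \<psi> unfolding support_function_def by simp
    have "\<psi> (lat w) = v \<bullet> (\<Sum>j\<in>UNIV. of_int (c j) *\<^sub>R lat (A j))"
      using v \<sigma>(3) arg_cong[OF c(3), of lat] by (simp add: lat_sum lat_smult)
    also have "\<dots> = (\<Sum>j\<in>UNIV. of_int (c j) * \<psi> (lat (A j)))"
      unfolding inner_sum_right by (rule sum.cong) (use v c(2) in auto)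
    finally have \<psi>w: "\<psi> (lat w) = \<dots>" .
    have "of_int (\<Sum>i\<in>UNIV. u $ i * l $ i) =
        (\<Sum>i\<in>UNIV. of_int (c i) * \<psi> (lat (A i)) - (if i \<in> I then \<psi> (lat (A i)) else 0))"
      by (simp add: u l_def algebra_simps) (rule sum.cong, auto simp: algebra_simps)
    also have "\<dots> = \<psi> (lat w) - (\<Sum>i\<in>I. \<psi> (lat (A i)))"
      by (simp add: sum_subtractf \<psi>w sum.If_cases)
    finally show ?thesis .
  qed
  have latw: "lat w = (\<Sum>i\<in>I. lat (A i))" by (simp add: w_def lat_sum)
  have 4: "0 \<le> (\<Sum>i\<in>UNIV. u $ i * l $ i)" if nef: "nef_divisor F A u" for u
  proof -
    obtain \<psi> where \<psi>: "support_function F A u \<psi>" "concave_on UNIV \<psi>"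
      using nef unfolding nef_divisor_def by blast
    have "0 \<le> real_of_int (\<Sum>i\<in>UNIV. u $ i * l $ i)"
      unfolding key[OF \<psi>(1)] latw
      using support_function_superadditive[OF \<psi>, of I "\<lambda>i. lat (A i)"] by simp
    then show ?thesis by linarith
  qed
  have 5: "0 < (\<Sum>i\<in>UNIV. l $ i)" if fano: "fano F A"
  proof -
    obtain \<psi> where \<psi>: "support_function F A anticanonical_divisor \<psi>" "concave_on UNIV \<psi>"
      and max: "\<And>\<sigma>. \<sigma> \<in> F \<Longrightarrow> (\<forall>\<tau>\<in>F. \<sigma> \<subseteq> \<tau> \<longrightarrow> \<tau> = \<sigma>) \<Longrightarrow> \<exists>v. \<forall>x. \<psi> x = v \<bullet> x \<longleftrightarrow> x \<in> \<sigma>"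
      using fano unfolding fano_def ample_divisor_def by blast
    obtain v where v: "\<forall>x. \<psi> x = v \<bullet> x \<longleftrightarrow> x \<in> \<sigma>"
      using max[OF \<sigma>(1)] full_dim_maximal[OF \<sigma>(1,2)] by blast
    have le: "\<psi> y \<le> v \<bullet> y" for y using ample_support_le[OF \<sigma>(1,2) \<psi>(2)] v by blast
    \<comment> \<open>Since I does not fit into \<sigma>, at least one summand is strictly smaller
      than its value under v.\<close>
    obtain i where i: "i \<in> I" "lat (A i) \<notin> \<sigma>" using I \<sigma>(1) by blast
    have "\<psi> (lat (A i)) < v \<bullet> lat (A i)" using v i(2) le[of "lat (A i)"] by force
    then have "(\<Sum>i\<in>I. \<psi> (lat (A i))) < (\<Sum>i\<in>I. v \<bullet> lat (A i))"
      using i(1) le by (intro sum_strict_mono_ex1) auto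
    also have "\<dots> = v \<bullet> lat w" by (simp add: latw inner_sum_right)
    also have "\<dots> = \<psi> (lat w)" using v \<sigma>(3) by metis
    finally have "0 < real_of_int (\<Sum>i\<in>UNIV. anticanonical_divisor $ i * l $ i)"
      unfolding key[OF \<psi>(1)] by simp
    then show ?thesis by (simp add: anticanonical_divisor_def flip: of_int_sum)
  qed
  show ?thesis using that[of l] 1 2 3 4 5 by blast
qed

end

section \<open>Reduction of monomials of large degree\<close>

definition function_submodule :: "('e \<Rightarrow> 'k::comm_ring_1) set \<Rightarrow> bool" where
  "function_submodule P \<longleftrightarrow> (\<lambda>_. 0) \<in> P \<and> (\<forall>v\<in>P. \<forall>w\<in>P. (\<lambda>e. v e + w e) \<in> P) \<and>
     (\<forall>h. \<forall>v\<in>P. (\<lambda>e. h * v e) \<in> P)"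

definition ring_ideal :: "'k::comm_ring_1 set \<Rightarrow> bool" where
  "ring_ideal B \<longleftrightarrow> 0 \<in> B \<and> (\<forall>f\<in>B. \<forall>g\<in>B. f + g \<in> B) \<and> (\<forall>h. \<forall>f\<in>B. h * f \<in> B)"

definition unit_vec :: "'e \<Rightarrow> 'e \<Rightarrow> 'k::comm_ring_1" where
  "unit_vec s = (\<lambda>t. if t = s then 1 else 0)"

lemma function_submoduleD:
  assumes "function_submodule P"
  shows "(\<lambda>_. 0) \<in> P" "v \<in> P \<Longrightarrow> w \<in> P \<Longrightarrow> (\<lambda>e. v e + w e) \<in> P" "v \<in> P \<Longrightarrow> (\<lambda>e. h * v e) \<in> P"
  using assms by (auto simp: function_submodule_def)

lemma function_submodule_sum:
  assumes "function_submodule P" "\<And>x. x \<in> S \<Longrightarrow> v x \<in> P"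
  shows "(\<lambda>e. \<Sum>x\<in>S. v x e) \<in> P"
  using assms(2) function_submoduleD[OF assms(1)]
  by (induction S rule: infinite_finite_induct) auto

lemma ring_idealD:
  assumes "ring_ideal B"
  shows "0 \<in> B" "f \<in> B \<Longrightarrow> g \<in> B \<Longrightarrow> f + g \<in> B" "f \<in> B \<Longrightarrow> h * f \<in> B"
  using assms by (auto simp: ring_ideal_def)

text \<open>Nakayama's lemma, by eliminating one generator at a time.\<close>

lemma nakayama:
  fixes P :: "('e \<Rightarrow> 'k::comm_ring_1) set" and v :: "'i \<Rightarrow> 'e \<Rightarrow> 'k"
  assumes P: "function_submodule P" and B: "ring_ideal B" and "finite E"
    and "\<And>s. s \<in> E \<Longrightarrow> (\<lambda>e. v s e - (\<Sum>t\<in>E. h s t * v t e)) \<in> P"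
    and "\<And>s t. s \<in> E \<Longrightarrow> t \<in> E \<Longrightarrow> h s t \<in> B"
  shows "\<exists>f. f - 1 \<in> B \<and> (\<forall>s\<in>E. (\<lambda>e. f * v s e) \<in> P)"
  using assms(3-5)
proof (induction E arbitrary: h rule: finite_induct)
  case empty
  show ?case using ring_idealD(1)[OF B] by (intro exI[of _ 1]) simp
next
  case (insert a E)
  define R where "R s = (\<lambda>e. v s e - (\<Sum>t\<in>insert a E. h s t * v t e))" for s
  have R: "R s \<in> P" if "s \<in> insert a E" for s using insert.prems(1)[OF that] by (simp add: R_def)
  have R_eq: "R s e = v s e - h s a * v a e - (\<Sum>t\<in>E. h s t * v t e)" for s e
    using insert.hyps by (simp add: R_def)
  \<comment> \<open>The relation of s is multiplied by 1 - h a a, and (1 - h a a) * v a is replaced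
    by the sum of the h a t * v t. Moving h a a * v s to the other side restores the leading
    coefficient 1.\<close>
  define H where "H s t = (if s = t then h a a else 0) + (1 - h a a) * h s t + h s a * h a t" for s t
  have "(\<lambda>e. v s e - (\<Sum>t\<in>E. H s t * v t e)) \<in> P" if s: "s \<in> E" for s
  proof -
    have "(\<Sum>t\<in>E. H s t * v t e) = h a a * v s e + (1 - h a a) * (\<Sum>t\<in>E. h s t * v t e) +
        h s a * (\<Sum>t\<in>E. h a t * v t e)" for e
    proof -
      have "(\<Sum>t\<in>E. H s t * v t e) = (\<Sum>t\<in>E. (if s = t then h a a * v t e else 0) +
          (1 - h a a) * (h s t * v t e) + h s a * (h a t * v t e))"
        by (rule sum.cong) (auto simp: H_def algebra_simps)
      also have "\<dots> = (\<Sum>t\<in>E. if s = t then h a a * v t e else 0) +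
          (1 - h a a) * (\<Sum>t\<in>E. h s t * v t e) + h s a * (\<Sum>t\<in>E. h a t * v t e)"
        by (simp only: sum.distrib sum_distrib_left)
      finally show ?thesis using s insert.hyps(1) by simp
    qed
    then have "(\<lambda>e. v s e - (\<Sum>t\<in>E. H s t * v t e)) = (\<lambda>e. (1 - h a a) * R s e + h s a * R a e)"
      by (simp add: R_eq fun_eq_iff algebra_simps)
    also have "\<dots> \<in> P" using R s function_submoduleD[OF P] by auto
    finally show ?thesis .
  qed
  moreover have "H s t \<in> B" if "s \<in> E" "t \<in> E" for s t
  proof -
    have "(if s = t then h a a else 0) \<in> B"
      using insert.prems(2)[of a a] ring_idealD(1)[OF B] by simp
    then show ?thesis
      unfolding H_def using insert.prems(2) that by (intro ring_idealD(2,3)[OF B]) auto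
  qed
  ultimately obtain f where f: "f - 1 \<in> B" "\<forall>s\<in>E. (\<lambda>e. f * v s e) \<in> P"
    using insert.IH[of H] by blast
  \<comment> \<open>Modulo P, u * v a is a combination of the remaining generators, which f already
    sends into P.\<close>
  define u where "u = 1 - h a a"
  have "u * f - 1 = (f - 1) + (- f) * h a a" by (simp add: u_def algebra_simps)
  also have "\<dots> \<in> B" using f(1) insert.prems(2)[of a a] ring_idealD[OF B] by blast
  finally have 1: "u * f - 1 \<in> B" .
  have 2: "(\<lambda>e. u * f * v s e) \<in> P" if s: "s \<in> insert a E" for s
  proof (cases "s = a")
    case True
    have "(\<lambda>e. u * f * v a e) = (\<lambda>e. f * R a e + (\<Sum>t\<in>E. h a t * (f * v t e)))"
      by (simp add: R_eq fun_eq_iff u_def algebra_simps sum_distrib_left)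
    also have "\<dots> \<in> P"
      using f(2) R[of a] function_submoduleD[OF P]
      by (intro function_submoduleD(2)[OF P] function_submodule_sum[OF P]) auto
    finally show ?thesis using True by simp
  next
    case False
    then have "(\<lambda>e. u * (f * v s e)) \<in> P" using f(2) s function_submoduleD(3)[OF P] by blast
    then show ?thesis by (simp add: mult.assoc)
  qed
  show ?case using 1 2 by blast
qed

section \<open>Reducing all monomials of degree N to each other\<close>

definition pos_part :: "int ^ 'm::finite \<Rightarrow> 'm multiset" where
  "pos_part l = (\<Sum>i | l $ i > 0. replicate_mset (nat (l $ i)) i)"

definition neg_part :: "int ^ 'm::finite \<Rightarrow> 'm multiset" where
  "neg_part l = (\<Sum>i | l $ i < 0. replicate_mset (nat (- (l $ i))) i)"

lemma size_pos_neg: "int (size (pos_part l)) = int (size (neg_part l)) + (\<Sum>i\<in>UNIV. l $ i)"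
proof -
  have "(\<Sum>i\<in>UNIV. l $ i) = (\<Sum>i\<in>UNIV. (if l $ i > 0 then l $ i else 0) - (if l $ i < 0 then - (l $ i) else 0))"
    by (rule sum.cong) auto
  also have "\<dots> = (\<Sum>i | l $ i > 0. l $ i) - (\<Sum>i | l $ i < 0. - (l $ i))"
    by (simp add: sum_subtractf sum.If_cases)
  also have "(\<Sum>i | l $ i > 0. l $ i) = int (size (pos_part l))"
    by (simp add: pos_part_def size_multiset_sum)
  also have "(\<Sum>i | l $ i < 0. - (l $ i)) = int (size (neg_part l))"
    by (simp add: neg_part_def size_multiset_sum)
  finally show ?thesis by simp
qed

lemma count_pos_part: "count (pos_part l) i = (if l $ i > 0 then nat (l $ i) else 0)"
  by (simp add: pos_part_def count_sum if_distrib sum.If_cases cong: if_cong)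

context smooth_complete_fan
begin

text \<open>Induction on the number of indices that do not occur in s. Only the box relations
  introduce coefficients, and these lie in B; the linear relations merely combine reductions already
  found.\<close>

lemma monomial_reduction:
  fixes P :: "('m multiset \<Rightarrow> 'k::comm_ring_1) set"
  assumes P: "function_submodule P" and B: "ring_ideal B" and N: "CARD('m) < N"
    and lin: "\<And>u t. Suc (size t) = N \<Longrightarrow>
      (\<lambda>e. \<Sum>j\<in>UNIV. of_int (dot u (A j)) * unit_vec (add_mset j t) e) \<in> P"
    and box: "\<And>l t. l \<in> rel_lattice A \<Longrightarrow> l \<noteq> 0 \<Longrightarrow>
      \<forall>u. nef_divisor F A u \<longrightarrow> 0 \<le> (\<Sum>i\<in>UNIV. u $ i * l $ i) \<Longrightarrow>
      fano F A \<longrightarrow> 0 < (\<Sum>i\<in>UNIV. l $ i) \<Longrightarrow> size t + size (pos_part l) = N \<Longrightarrow>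
      \<exists>h\<in>B. \<exists>t'. size t' = N \<and> (\<lambda>e. unit_vec (t + pos_part l) e - h * unit_vec t' e) \<in> P"
    and s: "size s = N"
  shows "\<exists>h. (\<forall>t. h t \<in> B \<and> (size t \<noteq> N \<longrightarrow> h t = 0)) \<and> (\<lambda>e. unit_vec s e - h e) \<in> P"
  using s
proof (induction "card (UNIV - set_mset s)" arbitrary: s rule: less_induct)
  case less
  show ?case
  proof (cases "\<exists>\<sigma>\<in>F. \<forall>i\<in>set_mset s. lat (A i) \<in> \<sigma>")
    case False
    then obtain l where l: "l \<in> rel_lattice A" "l \<noteq> 0" "\<forall>i. 0 < l $ i \<longrightarrow> i \<in> set_mset s \<and> l $ i = 1"
      "\<forall>u. nef_divisor F A u \<longrightarrow> 0 \<le> (\<Sum>i\<in>UNIV. u $ i * l $ i)"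
      "fano F A \<longrightarrow> 0 < (\<Sum>i\<in>UNIV. l $ i)"
      by (rule nonface_relation)
    have "pos_part l \<subseteq># s"
      using l(3) by (auto simp: subseteq_mset_def count_pos_part Suc_leI)
    then have split: "s = (s - pos_part l) + pos_part l" by simp
    then have "size (s - pos_part l) + size (pos_part l) = N"
      using less.prems by (metis size_union)
    then obtain h t' where h: "h \<in> B" "size t' = N"
        "(\<lambda>e. unit_vec s e - h * unit_vec t' e) \<in> P"
      using box[OF l(1,2,4,5), of "s - pos_part l"] split by auto
    show ?thesis
    proof (intro exI conjI allI impI)
      show "(\<lambda>e. unit_vec s e - (if e = t' then h else 0)) \<in> P"
        using h(3) by (simp add: unit_vec_def if_distrib[of "(*) h"] cong: if_cong)
    qed (use h ring_idealD(1)[OF B] in auto)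
  next
    case True
    then obtain \<sigma> where \<sigma>: "\<sigma> \<in> F" "\<forall>i\<in>set_mset s. lat (A i) \<in> \<sigma>" by blast
    \<comment> \<open>Pigeonhole: there are more factors than indices.\<close>
    have "\<exists>i. 2 \<le> count s i"
    proof (rule ccontr)
      assume "\<nexists>i. 2 \<le> count s i"
      then have "count s i \<le> 1" for i by (metis Suc_1 not_less_eq_eq)
      then have "size s \<le> (\<Sum>i\<in>set_mset s. 1)"
        unfolding size_multiset_overloaded_eq by (intro sum_mono) simp
      also have "\<dots> \<le> CARD('m)" by (simp add: card_mono)
      finally show False using less.prems N by simp
    qed
    then obtain i where i: "2 \<le> count s i" by blast
    define t where "t = s - {#i#}"
    have i_in: "i \<in># s" using i by (metis count_eq_zero_iff not_numeral_le_zero)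
    have s_eq: "s = add_mset i t" using i_in by (simp add: t_def)
    have "i \<in># t" using i by (simp add: t_def in_diff_count)
    \<comment> \<open>The second copy of i keeps the support of t equal to that of s, so every j
      outside enlarges it.\<close>
    then have set_t: "set_mset t = set_mset s" unfolding s_eq by auto
    obtain u where u: "dot u (A i) = 1" "\<forall>j\<in>set_mset s - {i}. dot u (A j) = 0"
      using \<sigma> i_in by (rule face_dual_vector)
    let ?C = "UNIV - set_mset s"
    have ih: "\<exists>h. (\<forall>t. h t \<in> B \<and> (size t \<noteq> N \<longrightarrow> h t = 0)) \<and>
        (\<lambda>e. unit_vec (add_mset j t) e - h e) \<in> P" if "j \<in> ?C" for j
    proof (rule less.hyps)
      have "UNIV - set_mset (add_mset j t) \<subset> ?C" using that set_t by auto
      then show "card (UNIV - set_mset (add_mset j t)) < card ?C" by (intro psubset_card_mono) auto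
      show "size (add_mset j t) = N" using less.prems s_eq by simp
    qed
    then obtain h where h: "\<And>j t. j \<in> ?C \<Longrightarrow> h j t \<in> B \<and> (size t \<noteq> N \<longrightarrow> h j t = 0)"
        "\<And>j. j \<in> ?C \<Longrightarrow> (\<lambda>e. unit_vec (add_mset j t) e - h j e) \<in> P"
      by metis
    define c where "c j = (of_int (dot u (A j)) :: 'k)" for j
    define H where "H e = (\<Sum>j\<in>?C. - c j * h j e)" for e
    \<comment> \<open>u vanishes on the other rays of the support: only s itself, with coefficient
      1, and terms with larger support remain.\<close>
    have "(\<Sum>j\<in>UNIV. c j * unit_vec (add_mset j t) e) =
        unit_vec s e + (\<Sum>j\<in>?C. c j * unit_vec (add_mset j t) e)" for e
    proof -
      have "(\<Sum>j\<in>UNIV. c j * unit_vec (add_mset j t) e) =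
          (\<Sum>j\<in>insert i ?C. c j * unit_vec (add_mset j t) e)"
        using u(2) by (intro sum.mono_neutral_right) (auto simp: c_def)
      then show ?thesis using i_in u(1) s_eq by (simp add: c_def)
    qed
    then have "(\<lambda>e. unit_vec s e - H e) = (\<lambda>e. (\<Sum>j\<in>UNIV. c j * unit_vec (add_mset j t) e) +
        (\<Sum>j\<in>?C. - c j * (unit_vec (add_mset j t) e - h j e)))"
      by (simp add: H_def fun_eq_iff algebra_simps sum_subtractf sum.distrib sum_negf)
    also have "\<dots> \<in> P"
    proof (rule function_submoduleD(2)[OF P])
      show "(\<lambda>e. \<Sum>j\<in>UNIV. c j * unit_vec (add_mset j t) e) \<in> P"
        unfolding c_def using less.prems s_eq by (intro lin) simp
    qed (intro function_submodule_sum[OF P] function_submoduleD(3)[OF P] h(2))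
    finally have "(\<lambda>e. unit_vec s e - H e) \<in> P" .
    moreover have "H e \<in> B" for e
    proof -
      have "(\<Sum>j\<in>J. - c j * h j e) \<in> B" if "finite J" "J \<subseteq> ?C" for J
        using that
      proof (induction J rule: finite_induct)
        case (insert j J)
        then have "- c j * h j e \<in> B" using h(1) by (intro ring_idealD(3)[OF B]) blast
        moreover have "(\<Sum>j\<in>J. - c j * h j e) \<in> B" using insert by blast
        ultimately show ?case
          unfolding sum.insert[OF insert.hyps(1,2)] by (rule ring_idealD(2)[OF B])
      qed (simp add: ring_idealD(1)[OF B])
      from this[OF finite subset_refl] show ?thesis by (simp only: H_def)
    qed
    moreover have "H e = 0" if "size e \<noteq> N" for e
      unfolding H_def using h(1) that by (intro sum.neutral) auto
    ultimately show ?thesis by blast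
  qed
qed

text \<open>Nakayama's lemma with the unit vectors of all monomials of degree N as
  generators.\<close>

lemma monomials_annihilated:
  fixes P :: "('m multiset \<Rightarrow> 'k::comm_ring_1) set"
  assumes P: "function_submodule P" and B: "ring_ideal B" and N: "CARD('m) < N"
    and lin: "\<And>u t. Suc (size t) = N \<Longrightarrow>
      (\<lambda>e. \<Sum>j\<in>UNIV. of_int (dot u (A j)) * unit_vec (add_mset j t) e) \<in> P"
    and box: "\<And>l t. l \<in> rel_lattice A \<Longrightarrow> l \<noteq> 0 \<Longrightarrow>
      \<forall>u. nef_divisor F A u \<longrightarrow> 0 \<le> (\<Sum>i\<in>UNIV. u $ i * l $ i) \<Longrightarrow>
      fano F A \<longrightarrow> 0 < (\<Sum>i\<in>UNIV. l $ i) \<Longrightarrow> size t + size (pos_part l) = N \<Longrightarrow>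
      \<exists>h\<in>B. \<exists>t'. size t' = N \<and> (\<lambda>e. unit_vec (t + pos_part l) e - h * unit_vec t' e) \<in> P"
  obtains f where "f - 1 \<in> B" "\<forall>s. size s = N \<longrightarrow> (\<lambda>e. f * unit_vec s e) \<in> P"
proof -
  let ?E = "{s :: 'm multiset. size s = N}"
  have "\<forall>s\<in>?E. \<exists>h. (\<forall>t. h t \<in> B \<and> (size t \<noteq> N \<longrightarrow> h t = 0)) \<and> (\<lambda>e. unit_vec s e - h e) \<in> P"
    using monomial_reduction[OF P B N lin box] by blast
  then obtain h where h: "\<forall>s\<in>?E. (\<forall>t. h s t \<in> B \<and> (size t \<noteq> N \<longrightarrow> h s t = 0)) \<and>
      (\<lambda>e. unit_vec s e - h s e) \<in> P"
    unfolding bchoice_iff by blast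
  have "\<exists>f. f - 1 \<in> B \<and> (\<forall>s\<in>?E. (\<lambda>e. f * unit_vec s e) \<in> P)"
  proof (rule nakayama[OF P B finite_multisets_size])
    fix s :: "'m multiset" assume s: "s \<in> ?E"
    have "(\<Sum>t\<in>?E. h s t * unit_vec t e) = h s e" for e
    proof -
      have "(\<Sum>t\<in>?E. h s t * unit_vec t e) = (\<Sum>t\<in>?E. if e = t then h s t else 0)"
        by (rule sum.cong) (auto simp: unit_vec_def)
      also have "\<dots> = (if e \<in> ?E then h s e else 0)"
        using finite_multisets_size[where 'm='m, of N] by (simp add: sum.delta)
      finally show ?thesis using h s by auto
    qed
    then show "(\<lambda>e. unit_vec s e - (\<Sum>t\<in>?E. h s t * unit_vec t e)) \<in> P" using h s by simp
  qed (use h in auto)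
  then show ?thesis using that by auto
qed

end

section \<open>Degenerate parameters\<close>

lemma prod_mset_replicate_sum:
  fixes D :: "'m::finite \<Rightarrow> 'a::comm_monoid_mult"
  shows "prod_mset (image_mset D (\<Sum>i\<in>S. replicate_mset (k i) i)) = (\<Prod>i\<in>S. D i ^ k i)"
  by (induction S rule: infinite_finite_induct) simp_all

lemma prod_power_int:
  fixes x :: "'a \<Rightarrow> 'b::field"
  shows "(\<Prod>j\<in>S. x j) powi n = (\<Prod>j\<in>S. x j powi n)"
  by (induction S rule: infinite_finite_induct) (simp_all add: power_int_mult_distrib)

lemma power_int_sum:
  fixes x :: "'b::field"
  assumes "x \<noteq> 0"
  shows "x powi (sum f S) = (\<Prod>j\<in>S. x powi f j)"
  using assms by (induction S rule: infinite_finite_induct) (simp_all add: power_int_add)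

text \<open>The sum is the logarithmic derivative of the face polynomial in the direction of y_k,
  computed along a curve through y.\<close>

lemma laurent_part_critical:
  fixes A :: "'m::finite \<Rightarrow> int ^ 'n"
  assumes y: "\<forall>k. y $ k \<noteq> 0" and crit: "(laurent_part A g q \<sigma> has_derivative (\<lambda>_. 0)) (at y)"
  shows "(\<Sum>i | lat (A i) \<in> \<sigma>.
    (\<Prod>j\<in>UNIV. (y $ j) powi (A i $ j)) * (\<Prod>a\<in>UNIV. q a ^ g i a) * of_int (A i $ k)) = 0"
proof -
  define X where "X i = (\<Prod>j\<in>UNIV. (y $ j) powi (A i $ j)) * (\<Prod>a\<in>UNIV. q a ^ g i a)" for i
  \<comment> \<open>Scales the k-th coordinate by exp t, so that the i-th term is multiplied by the
    exponential of t times its exponent, also when that exponent is negative.\<close>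
  define \<gamma> where "\<gamma> t = y + (exp t - 1) *\<^sub>R axis k (y $ k)" for t :: real
  have "(\<gamma> has_vector_derivative axis k (y $ k)) (at 0)"
    unfolding \<gamma>_def by (auto intro!: derivative_eq_intros)
  then have "(\<gamma> has_derivative (\<lambda>t. t *\<^sub>R axis k (y $ k))) (at 0)"
    by (simp add: has_vector_derivative_def)
  moreover have "\<gamma> 0 = y" by (simp add: \<gamma>_def)
  ultimately have "((laurent_part A g q \<sigma> \<circ> \<gamma>) has_derivative ((\<lambda>_. 0) \<circ> (\<lambda>t. t *\<^sub>R axis k (y $ k)))) (at 0)"
    using crit by (intro diff_chain_at) simp_all
  then have 1: "((laurent_part A g q \<sigma> \<circ> \<gamma>) has_vector_derivative 0) (at 0)"
    by (simp add: has_vector_derivative_def o_def)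
  have \<gamma>: "\<gamma> t $ j = y $ j * (if j = k then of_real (exp t) else 1)" for t j
    by (simp add: \<gamma>_def axis_def) (simp add: scaleR_conv_of_real algebra_simps)
  have "(\<Prod>j\<in>UNIV. (\<gamma> t $ j) powi (A i $ j)) =
      (\<Prod>j\<in>UNIV. (y $ j) powi (A i $ j)) * of_real (exp (of_int (A i $ k) * t))" for t i
  proof -
    have "(\<Prod>j\<in>UNIV. (\<gamma> t $ j) powi (A i $ j)) = (\<Prod>j\<in>UNIV. (y $ j) powi (A i $ j) *
        (if j = k then of_real (exp (of_int (A i $ k) * t)) else 1))"
      by (rule prod.cong) (auto simp: \<gamma> power_int_mult_distrib exp_power_int simp flip: of_real_power_int)
    then show ?thesis by (simp add: prod.distrib)
  qed
  then have E: "(laurent_part A g q \<sigma> \<circ> \<gamma>) =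
      (\<lambda>t. \<Sum>i | lat (A i) \<in> \<sigma>. X i * of_real (exp (of_int (A i $ k) * t)))"
    by (simp add: laurent_part_def X_def fun_eq_iff ac_simps)
  have d: "((\<lambda>t. \<Sum>i | lat (A i) \<in> \<sigma>. X i * of_real (exp (of_int (A i $ k) * t)))
      has_vector_derivative (\<Sum>i | lat (A i) \<in> \<sigma>. X i * of_real (of_int (A i $ k)))) (at 0)"
  proof (rule has_vector_derivative_sum)
    fix i
    have "((\<lambda>t. exp (of_int (A i $ k) * t)) has_real_derivative of_int (A i $ k)) (at 0)"
      by (auto intro!: derivative_eq_intros)
    then have "((\<lambda>t. of_real (exp (of_int (A i $ k) * t)) :: complex) has_vector_derivative
        of_real (of_int (A i $ k))) (at 0)"
      by (rule has_vector_derivative_of_real)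
    then show "((\<lambda>t. X i * of_real (exp (of_int (A i $ k) * t))) has_vector_derivative
        X i * of_real (of_int (A i $ k))) (at 0)"
      by (rule has_vector_derivative_mult_right)
  qed
  have "(\<Sum>i | lat (A i) \<in> \<sigma>. X i * of_real (of_int (A i $ k))) = 0"
    by (rule vector_derivative_unique_at[OF d 1[unfolded E]])
  then show ?thesis by (simp add: X_def)
qed

text \<open>The point \<open>(q, D)\<close> of the relative cotangent bundle lies on the characteristic variety: the
  principal symbols of the operators used for the reduction vanish there.\<close>

definition characteristic_point ::
    "('m::finite \<Rightarrow> int ^ 'n) \<Rightarrow> ('r::finite \<Rightarrow> int ^ 'm \<Rightarrow> int) \<Rightarrow> ('r \<Rightarrow> complex) \<Rightarrow>
     ('m \<Rightarrow> complex) \<Rightarrow> bool" where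
  "characteristic_point A p q D \<longleftrightarrow>
     (\<forall>u. (\<Sum>j\<in>UNIV. of_int (dot u (A j)) * D j) = 0) \<and>
     (\<forall>l\<in>rel_lattice A. (\<forall>a. 0 \<le> p a l) \<and> size (neg_part l) \<le> size (pos_part l) \<longrightarrow>
        prod_mset (image_mset D (pos_part l)) =
          (if size (neg_part l) = size (pos_part l)
           then (\<Prod>a\<in>UNIV. q a ^ nat (p a l)) * prod_mset (image_mset D (neg_part l)) else 0))"

lemma sum_pos_neg:
  fixes w :: "'m::finite \<Rightarrow> real"
  shows "(\<Sum>i\<in>UNIV. of_int (l $ i) * w i) =
    (\<Sum>i | l $ i > 0. of_int (l $ i) * w i) - (\<Sum>i | l $ i < 0. of_int (- (l $ i)) * w i)"
proof -
  have "(\<Sum>i\<in>UNIV. of_int (l $ i) * w i) = (\<Sum>i\<in>UNIV. (if l $ i > 0 then of_int (l $ i) * w i else 0) -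
      (if l $ i < 0 then of_int (- (l $ i)) * w i else 0))"
    by (rule sum.cong) auto
  then show ?thesis by (simp add: sum_subtractf sum.If_cases)
qed

lemma rel_lattice_component:
  assumes "l \<in> rel_lattice A"
  shows "(\<Sum>i\<in>UNIV. l $ i * A i $ k) = 0"
  using arg_cong[OF assms[unfolded rel_lattice_def mem_Collect_eq], of "\<lambda>v. v $ k"] by simp

text \<open>D i is the value of the i-th term at the critical point if A i lies on the face, and 0
  otherwise. Criticality gives the linear equations; the multiplicative ones result from comparing
  the weights w of both parts of l.\<close>

lemma degenerate_characteristic_point:
  fixes A :: "'m::finite \<Rightarrow> int ^ 'n" and g :: "'m \<Rightarrow> 'r::finite \<Rightarrow> nat"
  assumes q: "q \<in> S2" and deg: "\<not> nondegenerate A g q"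
    and p: "\<And>a l. l \<in> rel_lattice A \<Longrightarrow> p a l = (\<Sum>i\<in>UNIV. int (g i a) * l $ i)"
  obtains D i where "characteristic_point A p q D" "D i \<noteq> 0"
proof -
  obtain \<sigma> y where \<sigma>: "\<sigma> face_of newton_polytope A" "\<sigma> \<noteq> {}" "0 \<notin> \<sigma>"
    and y: "\<forall>k. y $ k \<noteq> 0" and crit: "(laurent_part A g q \<sigma> has_derivative (\<lambda>_. 0)) (at y)"
    using deg unfolding nondegenerate_def by blast
  have "polytope (newton_polytope A)"
    unfolding polytope_def newton_polytope_def by (intro exI[of _ "insert 0 (range (\<lambda>i. lat (A i)))"]) simp
  then have "\<sigma> exposed_face_of newton_polytope A"
    using \<sigma>(1) exposed_face_of_polyhedron polytope_imp_polyhedron by blast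
  then obtain c b where c: "newton_polytope A \<subseteq> {x. c \<bullet> x \<le> b}" "\<sigma> = newton_polytope A \<inter> {x. c \<bullet> x = b}"
    unfolding exposed_face_of_def by blast
  have mem: "0 \<in> newton_polytope A" "\<And>i. lat (A i) \<in> newton_polytope A"
    unfolding newton_polytope_def by (auto intro: hull_inc)
  \<comment> \<open>The origin belongs to the polytope but not to the face.\<close>
  have "b > 0" using c mem(1) \<sigma>(3) by force
  define w where "w i = c \<bullet> lat (A i)" for i
  have w_le: "w i \<le> b" and w_eq: "lat (A i) \<in> \<sigma> \<longleftrightarrow> w i = b" for i
    using c mem(2)[of i] by (auto simp: w_def)
  define X where "X i = (\<Prod>j\<in>UNIV. (y $ j) powi (A i $ j)) * (\<Prod>a\<in>UNIV. q a ^ g i a)" for i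
  have q0: "q a \<noteq> 0" for a using q by (simp add: S2_def)
  have X0: "X i \<noteq> 0" for i using y q0 by (simp add: X_def)
  define D where "D i = (if lat (A i) \<in> \<sigma> then X i else 0)" for i
  have "\<exists>i. lat (A i) \<in> \<sigma>"
  proof (rule ccontr)
    assume "\<nexists>i. lat (A i) \<in> \<sigma>"
    then have "w i < b" for i using w_le[of i] w_eq[of i] by force
    then have "insert 0 (range (\<lambda>i. lat (A i))) \<subseteq> {x. c \<bullet> x < b}"
      using \<open>b > 0\<close> by (auto simp: w_def)
    then have "newton_polytope A \<subseteq> {x. c \<bullet> x < b}"
      unfolding newton_polytope_def by (intro hull_minimal convex_halfspace_lt)
    then show False using c(2) \<sigma>(2) by fastforce
  qed
  then obtain i where "D i \<noteq> 0" using X0 by (auto simp: D_def)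
  have "(\<Sum>i\<in>UNIV. of_int (A i $ k) * D i) = 0" for k
  proof -
    have "(\<Sum>i\<in>UNIV. of_int (A i $ k) * D i) = (\<Sum>i\<in>UNIV. if lat (A i) \<in> \<sigma> then X i * of_int (A i $ k) else 0)"
      by (rule sum.cong) (auto simp: D_def)
    also have "\<dots> = (\<Sum>i | lat (A i) \<in> \<sigma>. X i * of_int (A i $ k))" by (simp add: sum.If_cases)
    also have "\<dots> = 0" unfolding X_def by (rule laurent_part_critical[OF y crit])
    finally show ?thesis .
  qed
  note lin0 = this
  have lin: "(\<Sum>j\<in>UNIV. of_int (dot u (A j)) * D j) = 0" for u
  proof -
    have "(\<Sum>j\<in>UNIV. of_int (dot u (A j)) * D j) = (\<Sum>j\<in>UNIV. \<Sum>k\<in>UNIV. of_int (u $ k) * (of_int (A j $ k) * D j))"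
      by (simp add: dot_def sum_distrib_right mult.assoc)
    also have "\<dots> = (\<Sum>k\<in>UNIV. \<Sum>j\<in>UNIV. of_int (u $ k) * (of_int (A j $ k) * D j))" by (rule sum.swap)
    also have "\<dots> = (\<Sum>k\<in>UNIV. of_int (u $ k) * (\<Sum>j\<in>UNIV. of_int (A j $ k) * D j))"
      by (simp add: sum_distrib_left)
    finally show ?thesis by (simp add: lin0)
  qed
  have "prod_mset (image_mset D (pos_part l)) =
      (if size (neg_part l) = size (pos_part l)
       then (\<Prod>a\<in>UNIV. q a ^ nat (p a l)) * prod_mset (image_mset D (neg_part l)) else 0)"
    if l: "l \<in> rel_lattice A" and pl: "\<forall>a. 0 \<le> p a l" and le: "size (neg_part l) \<le> size (pos_part l)" for l
  proof -
    let ?P = "{i. l $ i > 0}" and ?N = "{i. l $ i < 0}"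
    have Dpos: "prod_mset (image_mset D (pos_part l)) = (\<Prod>i\<in>?P. D i ^ nat (l $ i))"
      and Dneg: "prod_mset (image_mset D (neg_part l)) = (\<Prod>i\<in>?N. D i ^ nat (- (l $ i)))"
      unfolding pos_part_def neg_part_def by (rule prod_mset_replicate_sum)+
    have sz: "real (size (pos_part l)) = (\<Sum>i\<in>?P. of_int (l $ i))"
      "real (size (neg_part l)) = (\<Sum>i\<in>?N. of_int (- (l $ i)))"
      by (simp_all add: pos_part_def neg_part_def size_multiset_sum)
    \<comment> \<open>Pairing with c annihilates relations, so both parts of l have the same
      weight.\<close>
    have "(\<Sum>i\<in>UNIV. of_int (l $ i) * w i) = c \<bullet> lat (\<Sum>i\<in>UNIV. (l $ i) *s A i)"
      by (simp add: w_def lat_sum lat_smult inner_sum_right)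
    also have "\<dots> = 0" using l by (simp add: rel_lattice_def)
    finally have bal: "(\<Sum>i\<in>?P. of_int (l $ i) * w i) = (\<Sum>i\<in>?N. of_int (- (l $ i)) * w i)"
      using sum_pos_neg[of l w] by simp
    have le_P: "(\<Sum>i\<in>?P. of_int (l $ i) * w i) \<le> b * size (pos_part l)"
      and lt_P: "(\<exists>i\<in>?P. lat (A i) \<notin> \<sigma>) \<Longrightarrow> (\<Sum>i\<in>?P. of_int (l $ i) * w i) < b * size (pos_part l)"
    proof -
      have bd: "of_int (l $ i) * w i \<le> of_int (l $ i) * b" if "i \<in> ?P" for i
        using that w_le by simp
      then show "(\<Sum>i\<in>?P. of_int (l $ i) * w i) \<le> b * size (pos_part l)"
        unfolding sz sum_distrib_left by (intro sum_mono) (simp add: mult.commute)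
      assume "\<exists>i\<in>?P. lat (A i) \<notin> \<sigma>"
      then have "\<exists>i\<in>?P. of_int (l $ i) * w i < b * of_int (l $ i)"
        using w_le w_eq by (auto simp: mult.commute less_le)
      then show "(\<Sum>i\<in>?P. of_int (l $ i) * w i) < b * size (pos_part l)"
        unfolding sz sum_distrib_left using bd by (intro sum_strict_mono_ex1) (auto simp: mult.commute)
    qed
    have le_N: "(\<Sum>i\<in>?N. of_int (- (l $ i)) * w i) \<le> b * size (neg_part l)"
      and lt_N: "(\<exists>i\<in>?N. lat (A i) \<notin> \<sigma>) \<Longrightarrow> (\<Sum>i\<in>?N. of_int (- (l $ i)) * w i) < b * size (neg_part l)"
    proof -
      have bd: "of_int (- (l $ i)) * w i \<le> of_int (- (l $ i)) * b" if "i \<in> ?N" for i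
        using that w_le[of i] by (intro mult_left_mono) auto
      then show "(\<Sum>i\<in>?N. of_int (- (l $ i)) * w i) \<le> b * size (neg_part l)"
        unfolding sz sum_distrib_left by (intro sum_mono) (simp add: mult.commute)
      assume "\<exists>i\<in>?N. lat (A i) \<notin> \<sigma>"
      then obtain i where i: "i \<in> ?N" "w i < b" using w_le w_eq by (auto simp: less_le)
      then have "of_int (- (l $ i)) * w i < of_int (- (l $ i)) * b"
        by (intro mult_strict_left_mono) auto
      then have "\<exists>i\<in>?N. of_int (- (l $ i)) * w i < b * of_int (- (l $ i))"
        using i(1) by (metis mult.commute)
      then show "(\<Sum>i\<in>?N. of_int (- (l $ i)) * w i) < b * size (neg_part l)"
        unfolding sz sum_distrib_left using bd by (intro sum_strict_mono_ex1) (auto simp: mult.commute)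
    qed
    show ?thesis
    proof (cases "\<exists>i\<in>?P. lat (A i) \<notin> \<sigma>")
      case True
      then have "prod_mset (image_mset D (pos_part l)) = 0"
        unfolding Dpos by (auto simp: D_def)
      \<comment> \<open>For equal degrees, a negative part lying on the face would have maximal
        weight, more than the positive part has.\<close>
      moreover have "prod_mset (image_mset D (neg_part l)) = 0" if eq: "size (neg_part l) = size (pos_part l)"
      proof -
        have "\<exists>i\<in>?N. lat (A i) \<notin> \<sigma>"
        proof (rule ccontr)
          assume "\<not> (\<exists>i\<in>?N. lat (A i) \<notin> \<sigma>)"
          then have "(\<Sum>i\<in>?N. of_int (- (l $ i)) * w i) = (\<Sum>i\<in>?N. of_int (- (l $ i)) * b)"
            using w_eq by (intro sum.cong) auto
          then have "(\<Sum>i\<in>?N. of_int (- (l $ i)) * w i) = b * size (neg_part l)"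
            unfolding sz sum_distrib_left by (simp add: mult.commute)
          then show False using lt_P[OF True] bal eq by simp
        qed
        then show ?thesis unfolding Dneg by (auto simp: D_def)
      qed
      ultimately show ?thesis by (metis mult_zero_right)
    next
      case False
      then have P: "lat (A i) \<in> \<sigma>" if "i \<in> ?P" for i using that by blast
      have "(\<Sum>i\<in>?P. of_int (l $ i) * w i) = (\<Sum>i\<in>?P. of_int (l $ i) * b)"
        using P w_eq by (intro sum.cong) auto
      then have S: "(\<Sum>i\<in>?P. of_int (l $ i) * w i) = b * size (pos_part l)"
        unfolding sz sum_distrib_left by (simp add: mult.commute)
      \<comment> \<open>The positive part has maximal weight for its degree. The negative part must
        match it, hence has the same degree and lies on the face too.\<close>
      then have "b * size (pos_part l) \<le> b * size (neg_part l)" using bal le_N by simp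
      then have eq: "size (neg_part l) = size (pos_part l)" using le \<open>b > 0\<close> by simp
      then have N: "lat (A i) \<in> \<sigma>" if "i \<in> ?N" for i using lt_N S bal that by force
      have split: "(\<Prod>i\<in>?P. x i ^ nat (l $ i)) = (\<Prod>i\<in>UNIV. x i powi (l $ i)) * (\<Prod>i\<in>?N. x i ^ nat (- (l $ i)))"
        if x: "\<And>i. x i \<noteq> 0" for x :: "'m \<Rightarrow> complex"
      proof -
        have "(\<Prod>i\<in>?P. x i ^ nat (l $ i)) = (\<Prod>i\<in>UNIV. if l $ i > 0 then x i ^ nat (l $ i) else 1)"
          by (simp add: prod.If_cases)
        also have "\<dots> = (\<Prod>i\<in>UNIV. x i powi (l $ i) * (if l $ i < 0 then x i ^ nat (- (l $ i)) else 1))"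
        proof (rule prod.cong)
          fix i
          show "(if l $ i > 0 then x i ^ nat (l $ i) else 1) =
              x i powi (l $ i) * (if l $ i < 0 then x i ^ nat (- (l $ i)) else 1)"
            using x[of i] by (auto simp: power_int_def field_simps)
        qed simp
        also have "\<dots> = (\<Prod>i\<in>UNIV. x i powi (l $ i)) * (\<Prod>i\<in>?N. x i ^ nat (- (l $ i)))"
          by (simp add: prod.distrib prod.If_cases)
        finally show ?thesis .
      qed
      \<comment> \<open>The powers of y cancel because l is a relation, and the exponents of q add
        up to p_a(l) by the choice of g.\<close>
      have "(\<Prod>i\<in>UNIV. X i powi (l $ i)) = (\<Prod>a\<in>UNIV. q a ^ nat (p a l))"
      proof -
        have "X i powi (l $ i) = (\<Prod>k\<in>UNIV. (y $ k) powi (l $ i * A i $ k)) *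
            (\<Prod>a\<in>UNIV. q a powi (int (g i a) * l $ i))" for i
          by (simp add: X_def power_int_mult_distrib prod_power_int mult.commute[of "l $ i"]
              power_int_mult)
        then have "(\<Prod>i\<in>UNIV. X i powi (l $ i)) =
            (\<Prod>i\<in>UNIV. \<Prod>k\<in>UNIV. (y $ k) powi (l $ i * A i $ k)) *
            (\<Prod>i\<in>UNIV. \<Prod>a\<in>UNIV. q a powi (int (g i a) * l $ i))"
          by (simp add: prod.distrib)
        also have "(\<Prod>i\<in>UNIV. \<Prod>k\<in>UNIV. (y $ k) powi (l $ i * A i $ k)) =
            (\<Prod>k\<in>UNIV. \<Prod>i\<in>UNIV. (y $ k) powi (l $ i * A i $ k))" by (rule prod.swap)
        also have "\<dots> = (\<Prod>k\<in>UNIV. (y $ k) powi (\<Sum>i\<in>UNIV. l $ i * A i $ k))"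
          using y by (simp add: power_int_sum)
        also have "\<dots> = 1" using rel_lattice_component[OF l] by simp
        also have "(\<Prod>i\<in>UNIV. \<Prod>a\<in>UNIV. q a powi (int (g i a) * l $ i)) =
            (\<Prod>a\<in>UNIV. \<Prod>i\<in>UNIV. q a powi (int (g i a) * l $ i))" by (rule prod.swap)
        also have "\<dots> = (\<Prod>a\<in>UNIV. q a powi (p a l))"
          using q0 by (simp add: power_int_sum p[OF l])
        also have "\<dots> = (\<Prod>a\<in>UNIV. q a ^ nat (p a l))" using pl by (simp add: power_int_def)
        finally show ?thesis by simp
      qed
      then have "(\<Prod>i\<in>?P. X i ^ nat (l $ i)) =
          (\<Prod>a\<in>UNIV. q a ^ nat (p a l)) * (\<Prod>i\<in>?N. X i ^ nat (- (l $ i)))"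
        using split[of X] X0 by simp
      moreover have "(\<Prod>i\<in>?P. D i ^ nat (l $ i)) = (\<Prod>i\<in>?P. X i ^ nat (l $ i))"
        using P by (intro prod.cong) (auto simp: D_def)
      moreover have "(\<Prod>i\<in>?N. D i ^ nat (- (l $ i))) = (\<Prod>i\<in>?N. X i ^ nat (- (l $ i)))"
        using N by (intro prod.cong) (auto simp: D_def)
      ultimately show ?thesis unfolding Dpos Dneg using eq by simp
    qed
  qed
  then have "characteristic_point A p q D"
    unfolding characteristic_point_def using lin by blast
  then show ?thesis using that \<open>D i \<noteq> 0\<close> by blast
qed

section \<open>Finite generation\<close>

lemma finsum_residue_class:
  fixes G :: "'r::finite oper set"
  assumes "finite E" "\<And>s. s \<in> E \<Longrightarrow> P s \<in> Rtilde"
  shows "finsum (operator_quotient G) (\<lambda>s. op_class G (P s)) E =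
    op_class G (\<lambda>f. \<Sum>s\<in>E. P s f)"
proof -
  interpret mpol_module "operator_quotient G" by (rule mpol_module_Rtilde_quotient)
  show ?thesis
    using assms
  proof (induction E rule: finite_induct)
    case empty
    then show ?case by (simp add: Rtilde_quotient_carrier)
  next
    case (insert s E)
    then show ?case
      by (subst finsum_insert)
         (auto simp: Rtilde_quotient_carrier residue_class_add Rtilde_sum)
  qed
qed

text \<open>Every operator has finite order modulo the ideal, and a power of F, invertible on the
  open set, brings the order below N. So the monomials of size less than N generate.\<close>

lemma finite_type_Rtilde_quotient:
  fixes pd :: "'r::finite \<Rightarrow> int ^ 'm::finite"
  assumes pd: "\<And>a. pd a \<in> rel_lattice A" and euler: "euler_operator A pd \<in> G"
    and g: "\<And>a b. (\<Sum>i\<in>UNIV. int (g i a) * pd b $ i) = (if a = b then 1 else 0)"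
    and N: "N > 0" and F: "\<And>s. size s = N \<Longrightarrow> (\<lambda>f. F * Dmon pd s f) \<in> mod_order G pd N"
  shows "finite_type_on (operator_quotient G) {x. eval x F \<noteq> 0}"
proof -
  interpret mpol_module "operator_quotient G" by (rule mpol_module_Rtilde_quotient)
  let ?E = "{s :: 'm multiset. size s < N}"
  have "?E = (\<Union>n<N. {s. size s = n})" by auto
  then have fin: "finite ?E" by (simp add: finite_multisets_size)
  show ?thesis
  proof (rule finite_type_onI[OF zariski_open_basic fin])
    show "op_class G (Dmon pd s) \<in> carrier (operator_quotient G)" for s
      by (auto simp: Rtilde_quotient_carrier Dmon_in_Rtilde)
  next
    fix x m assume x: "x \<in> {x. eval x F \<noteq> 0}" and "m \<in> carrier (operator_quotient G)"
    then obtain P where P: "P \<in> Rtilde" "m = op_class G P"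
      by (auto simp: Rtilde_quotient_carrier)
    obtain d where "P \<in> mod_order G pd d" using Rtilde_mod_order[OF pd euler g P(1)] by blast
    then obtain k where "(\<lambda>f. F ^ k * P f) \<in> mod_order G pd N"
      using mod_order_power[OF N F] by blast
    then obtain Q where Q: "Q \<in> left_ideal G" "(\<lambda>f. F ^ k * P f - Q f) \<in> Low pd N"
      by (auto simp: mod_order_def)
    obtain r where r: "(\<lambda>f. F ^ k * P f - Q f) = (\<lambda>f. \<Sum>s\<in>?E. r s * Dmon pd s f)"
      using Low_eq_sum[OF Q(2)] by blast
    have "F ^ k \<odot>\<^bsub>operator_quotient G\<^esub> m =
        op_class G (\<lambda>f. F ^ k * P f)"
      using P by (simp add: residue_class_smult)
    also have "\<dots> = op_class G (\<lambda>f. \<Sum>s\<in>?E. r s * Dmon pd s f)"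
    proof (rule residue_class_eqI)
      have "F ^ k * P f - (\<Sum>s\<in>?E. r s * Dmon pd s f) = Q f" for f
        using fun_cong[OF r, of f] by (simp add: algebra_simps)
      then show "(\<lambda>f. F ^ k * P f - (\<Sum>s\<in>?E. r s * Dmon pd s f)) \<in> left_ideal G" using Q(1) by simp
    qed
    also have "\<dots> = finsum (operator_quotient G)
        (\<lambda>s. op_class G (\<lambda>f. r s * Dmon pd s f)) ?E"
      by (rule finsum_residue_class[symmetric]) (auto intro: fin Rtilde_smult Dmon_in_Rtilde)
    also have "\<dots> = finsum (operator_quotient G) (\<lambda>s. r s
        \<odot>\<^bsub>operator_quotient G\<^esub> op_class G (Dmon pd s)) ?E"
      by (simp add: residue_class_smult Dmon_in_Rtilde)
    finally show "\<exists>f r. eval x f \<noteq> 0 \<and> f \<odot>\<^bsub>operator_quotient G\<^esub> m =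
        finsum (operator_quotient G) (\<lambda>s. r s
          \<odot>\<^bsub>operator_quotient G\<^esub> op_class G (Dmon pd s)) ?E"
      using x by (intro exI[of _ "F ^ k"] exI[of _ r]) simp
  qed
qed

section \<open>Coefficient vectors of the relations between monomials\<close>

lemma rel_lattice_add: "l \<in> rel_lattice A \<Longrightarrow> l' \<in> rel_lattice A \<Longrightarrow> l + l' \<in> rel_lattice A"
  by (simp add: rel_lattice_def vector_sadd_rdistrib sum.distrib)

text \<open>Each coordinate function on the relation lattice is an integral combination of the p
  a.\<close>

lemma dual_lattice_basis_separates:
  assumes p: "dual_lattice_basis A p" and l: "l \<in> rel_lattice A" "\<And>a. p a l = 0"
  shows "l = 0"
proof -
  have "l $ i = 0" for i
  proof -
    have "(\<lambda>l\<in>rel_lattice A. l $ i) \<in> dual_lattice A"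
      by (simp add: dual_lattice_def rel_lattice_add)
    then obtain c where "\<forall>l\<in>rel_lattice A. (\<lambda>l\<in>rel_lattice A. l $ i) l = (\<Sum>a\<in>UNIV. c a * p a l)"
      using p unfolding dual_lattice_basis_def by blast
    then show ?thesis using l by simp
  qed
  then show ?thesis by (simp add: vec_eq_iff)
qed

text \<open>The vectors whose entries are the coefficients, in front of the monomials of degree \<open>N\<close>, of
  operators that are of lower order modulo the ideal and of functions vanishing on the
  characteristic variety.\<close>

definition symbol_relations ::
    "('m::finite \<Rightarrow> int ^ 'n) \<Rightarrow> ('r::finite \<Rightarrow> int ^ 'm \<Rightarrow> int) \<Rightarrow> ('r \<Rightarrow> int ^ 'm) \<Rightarrow>
     'r oper set \<Rightarrow> nat \<Rightarrow> ('m multiset \<Rightarrow> 'r mpol) set" where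
  "symbol_relations A p pd G N = {v.
     (\<forall>q D. characteristic_point A p q D \<longrightarrow>
       (\<Sum>s | size s = N. eval q (v s) * prod_mset (image_mset D s)) = 0) \<and>
     (\<lambda>f. \<Sum>s | size s = N. q_embed (v s) * Dmon pd s f) \<in> mod_order G pd N}"

lemma function_submodule_symbol_relations: "function_submodule (symbol_relations A p pd G N)"
  unfolding function_submodule_def
proof (intro conjI ballI allI)
  show "(\<lambda>_. 0) \<in> symbol_relations A p pd G N"
    by (simp add: symbol_relations_def Low_mod_order Low.zero)
next
  fix v w assume "v \<in> symbol_relations A p pd G N" "w \<in> symbol_relations A p pd G N"
  then show "(\<lambda>e. v e + w e) \<in> symbol_relations A p pd G N"
    using mod_order_add[of "\<lambda>f. \<Sum>s | size s = N. q_embed (v s) * Dmon pd s f" G pd N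
        "\<lambda>f. \<Sum>s | size s = N. q_embed (w s) * Dmon pd s f"]
    by (simp add: symbol_relations_def distrib_right sum.distrib)
next
  fix h v assume "v \<in> symbol_relations A p pd G N"
  then show "(\<lambda>e. h * v e) \<in> symbol_relations A p pd G N"
    using mod_order_smult[of "\<lambda>f. \<Sum>s | size s = N. q_embed (v s) * Dmon pd s f" G pd N "q_embed h"]
    by (simp add: symbol_relations_def mult.assoc flip: sum_distrib_left)
qed

text \<open>Used with both \<open>eval q\<close> and \<open>q_embed\<close> for \<phi>, to read off
  the term of a single monomial.\<close>

lemma sum_unit_vec:
  fixes F :: "'m::finite multiset \<Rightarrow> 'a::comm_ring_1"
  assumes "size s = N" "\<phi> 0 = 0" "\<phi> 1 = 1"
  shows "(\<Sum>t | size t = N. \<phi> (unit_vec s t) * F t) = F s"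
proof -
  have "(\<Sum>t | size t = N. \<phi> (unit_vec s t) * F t) = (\<Sum>t | size t = N. if s = t then F t else 0)"
    using assms by (intro sum.cong) (auto simp: unit_vec_def)
  then show ?thesis using assms(1) by (simp add: sum.delta finite_multisets_size)
qed

text \<open>The vectors pd a are relations between the A j, so the combination of the D_j given by u
  is zero as an operator, not merely of lower order.\<close>

lemma symbol_relations_linear:
  fixes A :: "'m::finite \<Rightarrow> int ^ 'n" and pd :: "'r::finite \<Rightarrow> int ^ 'm"
  assumes pd: "\<And>a. pd a \<in> rel_lattice A" and t: "Suc (size t) = N"
  shows "(\<lambda>e. \<Sum>j\<in>UNIV. of_int (dot u (A j)) * unit_vec (add_mset j t) e) \<in> symbol_relations A p pd G N"
proof -
  have "(\<Sum>s | size s = N. eval q (\<Sum>j\<in>UNIV. of_int (dot u (A j)) * unit_vec (add_mset j t) s) *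
      prod_mset (image_mset D s)) = 0" if D: "characteristic_point A p q D" for q D
  proof -
    have "(\<Sum>s | size s = N. eval q (\<Sum>j\<in>UNIV. of_int (dot u (A j)) * unit_vec (add_mset j t) s) *
        prod_mset (image_mset D s)) = (\<Sum>s | size s = N. \<Sum>j\<in>UNIV.
        of_int (dot u (A j)) * (eval q (unit_vec (add_mset j t) s) * prod_mset (image_mset D s)))"
      by (simp add: eval_sum sum_distrib_right mult.assoc)
    also have "\<dots> = (\<Sum>j\<in>UNIV. \<Sum>s | size s = N.
        of_int (dot u (A j)) * (eval q (unit_vec (add_mset j t) s) * prod_mset (image_mset D s)))"
      by (rule sum.swap)
    also have "\<dots> = (\<Sum>j\<in>UNIV. of_int (dot u (A j)) * prod_mset (image_mset D (add_mset j t)))"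
      using t by (simp add: sum_unit_vec[of _ N "eval q"] flip: sum_distrib_left)
    also have "\<dots> = (\<Sum>j\<in>UNIV. of_int (dot u (A j)) * D j) * prod_mset (image_mset D t)"
      by (simp add: sum_distrib_right mult.assoc)
    also have "\<dots> = 0" using D by (simp add: characteristic_point_def)
    finally show ?thesis .
  qed
  moreover have "(\<Sum>s | size s = N. q_embed (\<Sum>j\<in>UNIV. of_int (dot u (A j)) * unit_vec (add_mset j t) s) *
      Dmon pd s f) = 0" for f
  proof -
    have q_embed_sum: "q_embed (sum F S) = (\<Sum>j\<in>S. q_embed (F j))" for F :: "'m \<Rightarrow> 'r mpol" and S
      by (induction S rule: infinite_finite_induct) simp_all
    have "(\<Sum>s | size s = N. q_embed (\<Sum>j\<in>UNIV. of_int (dot u (A j)) * unit_vec (add_mset j t) s) *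
        Dmon pd s f) = (\<Sum>s | size s = N. \<Sum>j\<in>UNIV.
        of_int (dot u (A j)) * (q_embed (unit_vec (add_mset j t) s) * Dmon pd s f))"
      by (simp add: q_embed_sum sum_distrib_right mult.assoc)
    also have "\<dots> = (\<Sum>j\<in>UNIV. \<Sum>s | size s = N.
        of_int (dot u (A j)) * (q_embed (unit_vec (add_mset j t) s) * Dmon pd s f))"
      by (rule sum.swap)
    also have "\<dots> = (\<Sum>j\<in>UNIV. of_int (dot u (A j)) * Dmon pd (add_mset j t) f)"
      using t by (simp only: sum_unit_vec[of _ N q_embed] q_embed_0 q_embed_1 size_add_mset flip: sum_distrib_left)
    also have "\<dots> = (\<Sum>j\<in>UNIV. \<Sum>a\<in>UNIV.
        of_int (pd a $ j * dot u (A j)) * log_der (Some a) (Dmon pd t f))"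
      by (simp add: Dop_def sum_distrib_left mult_ac)
    also have "\<dots> = (\<Sum>a\<in>UNIV. \<Sum>j\<in>UNIV.
        of_int (pd a $ j * dot u (A j)) * log_der (Some a) (Dmon pd t f))"
      by (rule sum.swap)
    also have "\<dots> = (\<Sum>a\<in>UNIV. of_int (\<Sum>j\<in>UNIV. pd a $ j * dot u (A j)) * log_der (Some a) (Dmon pd t f))"
      by (simp only: of_int_sum sum_distrib_right)
    also have "\<dots> = 0"
    proof -
      have "(\<Sum>j\<in>UNIV. pd a $ j * dot u (A j)) = dot u (\<Sum>j\<in>UNIV. (pd a $ j) *s A j)" for a
        by (simp add: dot_sum dot_smult)
      also have "\<dots> a = 0" for a using pd[of a] by (simp add: rel_lattice_def)
      finally show ?thesis by simp
    qed
    finally show ?thesis .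
  qed
  ultimately show ?thesis by (simp add: symbol_relations_def Low_mod_order Low.zero)
qed

text \<open>For parts of equal size the box operator exchanges one monomial for a q-multiple of the
  other. If the negative part is smaller, it counts as lower order, and the positive monomial
  reduces to 0.\<close>

lemma symbol_relations_box:
  fixes A :: "'m::finite \<Rightarrow> int ^ 'n" and pd :: "'r::finite \<Rightarrow> int ^ 'm"
  assumes box: "box_operator p pd l \<in> G" and l: "l \<in> rel_lattice A" and p: "\<And>a. 0 \<le> p a l"
    and le: "size (neg_part l) \<le> size (pos_part l)" and N: "size t + size (pos_part l) = N"
  shows "\<exists>t'. size t' = N \<and> (\<lambda>e. unit_vec (t + pos_part l) e -
    (if size (neg_part l) = size (pos_part l) then \<Prod>a\<in>UNIV. var a ^ nat (p a l) else 0) * unit_vec t' e)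
    \<in> symbol_relations A p pd G N"
proof -
  let ?eq = "size (neg_part l) = size (pos_part l)"
  define h :: "'r mpol" where "h = (if ?eq then \<Prod>a\<in>UNIV. var a ^ nat (p a l) else 0)"
  \<comment> \<open>In the second case the coefficient of t' is 0, and t' only has to have size
    N.\<close>
  define t' where "t' = (if ?eq then t + neg_part l else t + pos_part l)"
  have t': "size t' = N" using N by (simp add: t'_def)
  have pos: "size (t + pos_part l) = N" using N by simp
  have "(\<Sum>s | size s = N. eval q (unit_vec (t + pos_part l) s - h * unit_vec t' s) *
      prod_mset (image_mset D s)) = 0" if D: "characteristic_point A p q D" for q D
  proof -
    have "(\<Sum>s | size s = N. eval q (unit_vec (t + pos_part l) s - h * unit_vec t' s) *
        prod_mset (image_mset D s)) =
        (\<Sum>s | size s = N. eval q (unit_vec (t + pos_part l) s) * prod_mset (image_mset D s)) -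
        eval q h * (\<Sum>s | size s = N. eval q (unit_vec t' s) * prod_mset (image_mset D s))"
      by (simp add: left_diff_distrib sum_subtractf sum_distrib_left mult.assoc)
    also have "\<dots> = prod_mset (image_mset D (t + pos_part l)) - eval q h * prod_mset (image_mset D t')"
      using sum_unit_vec[OF pos, of "eval q"] sum_unit_vec[OF t', of "eval q"] by simp
    also have "\<dots> = 0"
    proof -
      have "prod_mset (image_mset D (pos_part l)) =
          (if ?eq then (\<Prod>a\<in>UNIV. q a ^ nat (p a l)) * prod_mset (image_mset D (neg_part l)) else 0)"
        using D l p le unfolding characteristic_point_def by blast
      then show ?thesis by (simp add: h_def t'_def)
    qed
    finally show ?thesis .
  qed
  moreover have "(\<lambda>f. \<Sum>s | size s = N. q_embed (unit_vec (t + pos_part l) s - h * unit_vec t' s) * Dmon pd s f)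
      \<in> mod_order G pd N"
  proof -
    have q_embed_diff: "q_embed (f - g) = q_embed f - q_embed g" for f g :: "'r mpol"
      using q_embed_add[of f "- g"] by simp
    have "(\<Sum>s | size s = N. q_embed (unit_vec (t + pos_part l) s - h * unit_vec t' s) * Dmon pd s f) =
        (\<Sum>s | size s = N. q_embed (unit_vec (t + pos_part l) s) * Dmon pd s f) -
        q_embed h * (\<Sum>s | size s = N. q_embed (unit_vec t' s) * Dmon pd s f)" for f
      by (simp add: q_embed_diff left_diff_distrib sum_subtractf sum_distrib_left mult.assoc)
    then have eq: "(\<lambda>f. \<Sum>s | size s = N. q_embed (unit_vec (t + pos_part l) s - h * unit_vec t' s) * Dmon pd s f) =
        (\<lambda>f. Dmon pd (t + pos_part l) f - q_embed h * Dmon pd t' f)"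
      using sum_unit_vec[OF pos, of "q_embed :: 'r mpol \<Rightarrow> _"]
        sum_unit_vec[OF t', of "q_embed :: 'r mpol \<Rightarrow> _"] by simp
    have rel: "(\<lambda>f. (\<Prod>a\<in>UNIV. qvar a ^ nat (p a l)) * Dmon pd (t + neg_part l) f -
        Dmon pd (t + pos_part l) f) \<in> mod_order G pd N"
      using mod_order_box_relation[OF box p, of t N] N le unfolding pos_part_def neg_part_def by blast
    show ?thesis
    proof (cases ?eq)
      case True
      then show ?thesis
        unfolding eq using mod_order_smult[OF rel, of "- 1"] by (simp add: h_def t'_def)
    next
      case False
      then have "(\<lambda>f. (\<Prod>a\<in>UNIV. qvar a ^ nat (p a l)) * Dmon pd (t + neg_part l) f) \<in> mod_order G pd N"
        using le N by (intro Low_mod_order Low.gen) simp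
      from mod_order_diff[OF this rel] show ?thesis
        unfolding eq using False by (simp add: h_def)
    qed
  qed
  ultimately have "(\<lambda>e. unit_vec (t + pos_part l) e - h * unit_vec t' e) \<in> symbol_relations A p pd G N"
    by (simp add: symbol_relations_def)
  then show ?thesis using t' unfolding h_def by blast
qed

lemma lowering_polynomial_exists:
  fixes F :: "(real ^ 'n) set set"
    and A :: "'m::finite \<Rightarrow> int ^ 'n"
    and p :: "'r::finite \<Rightarrow> int ^ 'm \<Rightarrow> int"
    and pd :: "'r \<Rightarrow> int ^ 'm"
  assumes toric: "smooth_projective_toric F A"
    and basis: "dual_lattice_basis A p"
    and nef: "\<forall>a. nef_class F A (p a)"
    and cone: "in_generated_cone A p (anticanonical_class A)"
    and pd: "\<And>a. pd a \<in> rel_lattice A"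
    and G: "box_operator p pd ` rel_lattice A \<subseteq> G"
    and N: "CARD('m) < N"
  obtains f where "eval (\<lambda>_. 0) f \<noteq> 0" "fano F A \<longrightarrow> f = 1"
    "\<forall>s. size s = N \<longrightarrow> (\<lambda>e. f * unit_vec s e) \<in> symbol_relations A p pd G N"
proof -
  interpret smooth_complete_fan F A
    using toric by unfold_locales (simp_all add: smooth_projective_toric_def)
  \<comment> \<open>In the Fano case all box coefficients are 0, and f - 1 in the zero ideal means f
    = 1; otherwise B is the maximal ideal of the origin.\<close>
  define B :: "'r mpol set" where "B = (if fano F A then {0} else {h. eval (\<lambda>_. 0) h = 0})"
  have B: "ring_ideal B" by (auto simp: B_def ring_ideal_def)
  obtain f where f: "f - 1 \<in> B"
      "\<forall>s. size s = N \<longrightarrow> (\<lambda>e. f * unit_vec s e) \<in> symbol_relations A p pd G N"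
  proof (rule monomials_annihilated[OF function_submodule_symbol_relations B N])
    show "(\<lambda>e. \<Sum>j\<in>UNIV. of_int (dot u (A j)) * unit_vec (add_mset j t) e) \<in> symbol_relations A p pd G N"
      if "Suc (size t) = N" for u t
      using pd that by (rule symbol_relations_linear)
  next
    fix l and t :: "'m multiset"
    assume l: "l \<in> rel_lattice A" "l \<noteq> 0"
      and nef_l: "\<forall>u. nef_divisor F A u \<longrightarrow> 0 \<le> (\<Sum>i\<in>UNIV. u $ i * l $ i)"
      and fano_l: "fano F A \<longrightarrow> 0 < (\<Sum>i\<in>UNIV. l $ i)"
      and t: "size t + size (pos_part l) = N"
    have p_nonneg: "0 \<le> p a l" for a
    proof -
      obtain u where "nef_divisor F A u" "p a = divisor_class A u"
        using nef unfolding nef_class_def by blast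
      then show ?thesis using nef_l l(1) by (simp add: divisor_class_def)
    qed
    obtain c where c: "\<forall>a. 0 \<le> c a"
        "\<forall>l\<in>rel_lattice A. real_of_int (anticanonical_class A l) = (\<Sum>a\<in>UNIV. c a * real_of_int (p a l))"
      using cone unfolding in_generated_cone_def by blast
    \<comment> \<open>The sum of the entries of l is the value of the anticanonical class, a
      nonnegative combination of the p_a; so the negative part of l is not the larger one.\<close>
    have "0 \<le> real_of_int (anticanonical_class A l)"
      using c l(1) p_nonneg by (auto intro!: sum_nonneg mult_nonneg_nonneg)
    moreover have "anticanonical_class A l = (\<Sum>i\<in>UNIV. l $ i)"
      using l(1) by (simp add: divisor_class_def anticanonical_divisor_def)
    ultimately have "0 \<le> (\<Sum>i\<in>UNIV. l $ i)" by linarith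
    then have le: "size (neg_part l) \<le> size (pos_part l)" using size_pos_neg[of l] by linarith
    let ?h = "if size (neg_part l) = size (pos_part l) then \<Prod>a\<in>UNIV. var a ^ nat (p a l) else 0"
    have "?h \<in> B"
    proof (cases "fano F A")
      case True
      \<comment> \<open>The positive part is strictly larger, which makes the coefficient 0.\<close>
      then show ?thesis using fano_l size_pos_neg[of l] by (auto simp: B_def)
    next
      case False
      \<comment> \<open>The p_a separate relations, so some q_a divides the coefficient and makes it
        vanish at the origin.\<close>
      obtain a where "p a l \<noteq> 0" using dual_lattice_basis_separates[OF basis l(1)] l(2) by blast
      then have "nat (p a l) \<noteq> 0" using p_nonneg[of a] by simp
      then have "eval (\<lambda>_. 0) (var a ^ nat (p a l)) = 0" by simp
      then have "eval (\<lambda>_. 0) (\<Prod>a\<in>UNIV. var a ^ nat (p a l)) = 0"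
        unfolding eval_prod by (intro prod_zero bexI[of _ a]) simp_all
      then show ?thesis using False by (auto simp: B_def)
    qed
    moreover have "box_operator p pd l \<in> G" using G l(1) by blast
    then have "\<exists>t'. size t' = N \<and> (\<lambda>e. unit_vec (t + pos_part l) e - ?h * unit_vec t' e)
        \<in> symbol_relations A p pd G N"
      by (rule symbol_relations_box) (use l(1) p_nonneg le t in auto)
    ultimately show "\<exists>h\<in>B. \<exists>t'. size t' = N \<and>
        (\<lambda>e. unit_vec (t + pos_part l) e - h * unit_vec t' e) \<in> symbol_relations A p pd G N"
      by blast
  qed
  have "eval (\<lambda>_. 0) f \<noteq> 0"
  proof
    assume "eval (\<lambda>_. 0) f = 0"
    then have "eval (\<lambda>_. 0) (f - 1) = - 1" by simp
    moreover have "eval (\<lambda>_. 0) (f - 1) = 0" using f(1) by (auto simp: B_def split: if_splits)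
    ultimately show False by simp
  qed
  moreover have "fano F A \<longrightarrow> f = 1" using f(1) by (auto simp: B_def)
  ultimately show ?thesis using that f(2) by blast
qed

theorem theorem3p7:
  fixes F :: "(real ^ 'n) set set"
    and A :: "'m::finite \<Rightarrow> int ^ 'n"
    and p :: "'r::finite \<Rightarrow> int ^ 'm \<Rightarrow> int"
    and pd :: "'r \<Rightarrow> int ^ 'm"
    and g :: "'m \<Rightarrow> 'r \<Rightarrow> nat"
  assumes "smooth_projective_toric F A"
    and "weak_fano F A"
    and "dual_lattice_basis A p"
    and "\<forall>a. nef_class F A (p a)"
    and "in_generated_cone A p (anticanonical_class A)"
    and "is_dual_basis A p pd"
    and "monomial_exponents A p g"
  shows "(\<exists>U. zariski_open U \<and> U \<subseteq> S2_0_bar A g \<and> (\<lambda>_. 0) \<in> U \<and>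
            coherent_on (QM A p pd) (z_line_times U) \<and>
            (\<exists>nabla. log_connection (QM A p pd) (z_line_times U) nabla \<and>
               extends_dmodule_structure (Itilde A p pd) (tau_line_times (U \<inter> S2)) nabla)) \<and>
         (fano F A \<longrightarrow> S2_0_bar A g = UNIV \<and>
            coherent_on (QM A p pd) (z_line_times UNIV) \<and>
            (\<exists>nabla. log_connection (QM A p pd) (z_line_times UNIV) nabla \<and>
               extends_dmodule_structure (Itilde A p pd) (tau_line_times (UNIV \<inter> S2)) nabla))"
proof -
  define G where "G = insert (euler_operator A pd) (box_operator p pd ` rel_lattice A)"
  have I: "Itilde A p pd = left_ideal G" by (simp add: Itilde_def G_def)
  have M: "QM A p pd = operator_quotient G" by (simp add: QM_def I)
  interpret mpol_module "operator_quotient G" by (rule mpol_module_Rtilde_quotient)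
  have pd: "pd a \<in> rel_lattice A" for a using assms(6) by (simp add: is_dual_basis_def)
  have p: "p a l = (\<Sum>i\<in>UNIV. int (g i a) * l $ i)" if "l \<in> rel_lattice A" for a l
    using assms(7) that by (simp add: monomial_exponents_def divisor_class_def)
  have g: "(\<Sum>i\<in>UNIV. int (g i a) * pd b $ i) = (if a = b then 1 else 0)" for a b
    using assms(6) p[OF pd, of a b] by (simp add: is_dual_basis_def)
  \<comment> \<open>One more than the number of rays, as needed for the pigeonhole argument.\<close>
  define N where "N = Suc CARD('m)"
  obtain f where f: "eval (\<lambda>_. 0) f \<noteq> 0" "fano F A \<longrightarrow> f = 1"
      "\<forall>s. size s = N \<longrightarrow> (\<lambda>e. f * unit_vec s e) \<in> symbol_relations A p pd G N"
    by (rule lowering_polynomial_exists[OF assms(1,3,4,5), of pd G N]) (auto simp: pd G_def N_def)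
  define U where "U = {q. eval q f \<noteq> 0}"
  have open_U: "zariski_open U" unfolding U_def by (rule zariski_open_basic)
  have zU: "z_line_times U = {x. eval x (q_embed f) \<noteq> 0}"
    by (simp add: z_line_times_def U_def eval_q_embed)
  have "(\<lambda>h. q_embed f * Dmon pd s h) \<in> mod_order G pd N" if s: "size s = N" for s
  proof -
    have "(\<lambda>h. \<Sum>t | size t = N. q_embed (f * unit_vec s t) * Dmon pd t h) \<in> mod_order G pd N"
      using f(3) s by (simp add: symbol_relations_def)
    moreover have "(\<Sum>t | size t = N. q_embed (f * unit_vec s t) * Dmon pd t h) = q_embed f * Dmon pd s h" for h
      using sum_unit_vec[OF s q_embed_0 q_embed_1, of "\<lambda>t. Dmon pd t h"]
      by (simp add: mult.assoc flip: sum_distrib_left)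
    ultimately show ?thesis by simp
  qed
  then have "finite_type_on (operator_quotient G) (z_line_times U)"
    unfolding zU by (intro finite_type_Rtilde_quotient[OF pd _ g]) (auto simp: G_def N_def)
  then have coherent: "coherent_on (QM A p pd) (z_line_times U)"
    unfolding M by (rule coherent_onI)
  \<comment> \<open>Stated for all V, to serve U as well as the whole space in the Fano
    case.\<close>
  have connection: "\<exists>nabla. log_connection (QM A p pd) (z_line_times V) nabla \<and>
      extends_dmodule_structure (Itilde A p pd) (tau_line_times (V \<inter> S2)) nabla" for V
  proof (intro exI conjI)
    show "log_connection (QM A p pd) (z_line_times V) (\<lambda>V s v. \<lambda>x\<in>V. germ_der
        (operator_quotient G) (log_der v) (left_action (left_ideal G) (log_der v)) x (s x))"
      unfolding M by (rule log_connection_germ_der[OF mpol_module_derivation_Rtilde_quotient])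
    have "x v \<noteq> 0" if "x \<in> tau_line_times (V \<inter> S2)" for x v
      using that by (cases v) (auto simp: tau_line_times_def S2_def)
    then show "extends_dmodule_structure (Itilde A p pd) (tau_line_times (V \<inter> S2)) (\<lambda>V s v. \<lambda>x\<in>V. germ_der
        (operator_quotient G) (log_der v) (left_action (left_ideal G) (log_der v)) x (s x))"
      unfolding I by (rule extends_dmodule_structure_germ_der)
  qed
  have "S2 - S2_0 A g \<subseteq> - U"
  proof
    fix q assume "q \<in> S2 - S2_0 A g"
    then have "q \<in> S2" "\<not> nondegenerate A g q" by (auto simp: S2_0_def)
    then obtain D i where D: "characteristic_point A p q D" "D i \<noteq> 0"
      using p by (rule degenerate_characteristic_point)
    \<comment> \<open>The relation for the N-th power of D_i, evaluated at the characteristic point,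
      reads f(q) * D i ^ N = 0, where D i is nonzero.\<close>
    let ?s = "replicate_mset N i"
    have "0 = (\<Sum>t | size t = N. eval q (f * unit_vec ?s t) * prod_mset (image_mset D t))"
      using f(3) D(1) by (simp add: symbol_relations_def)
    also have "\<dots> = eval q f * (\<Sum>t | size t = N. eval q (unit_vec ?s t) * prod_mset (image_mset D t))"
      by (simp add: sum_distrib_left mult.assoc)
    also have "\<dots> = eval q f * D i ^ N"
      using sum_unit_vec[of ?s N "eval q" "\<lambda>t. prod_mset (image_mset D t)"] by simp
    finally show "q \<in> - U" using D(2) by (simp add: U_def)
  qed
  \<comment> \<open>The complement of U is closed, so it contains the Zariski closure of the
    degenerate parameters as well.\<close>
  moreover have "zariski_closed (- U)" using open_U by (simp add: zariski_open_def)
  ultimately have "zariski_closure (S2 - S2_0 A g) \<subseteq> - U" unfolding zariski_closure_def by blast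
  then have sub: "U \<subseteq> S2_0_bar A g" unfolding S2_0_bar_def by blast
  have "(\<lambda>_. 0) \<in> U" using f(1) by (simp add: U_def)
  then have "\<exists>U. zariski_open U \<and> U \<subseteq> S2_0_bar A g \<and> (\<lambda>_. 0) \<in> U \<and>
      coherent_on (QM A p pd) (z_line_times U) \<and>
      (\<exists>nabla. log_connection (QM A p pd) (z_line_times U) nabla \<and>
         extends_dmodule_structure (Itilde A p pd) (tau_line_times (U \<inter> S2)) nabla)"
    using open_U sub coherent connection[of U] by (intro exI[of _ U] conjI)
  moreover have "S2_0_bar A g = UNIV \<and> coherent_on (QM A p pd) (z_line_times UNIV)" if "fano F A"
  proof -
    have "U = UNIV" using f(2) that by (simp add: U_def)
    then show ?thesis using sub coherent by auto
  qed
  ultimately show ?thesis using connection[of UNIV] by (intro conjI impI) simp_all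
qed

end
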